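(* Let $I\subset\mathbb{R}$ be an open interval, $(F,g_F)$ a pseudo-Riemannian manifold with $\dim F=l$, $f:I\to(0,\infty)$ smooth, and let $M=I\times F$ carry the metric $g=-dt^2+f(t)^2g_F$. Let $\lambda_1,\lambda_2$ be nonzero real constants, $P=\frac{\partial}{\partial t}$, and let $\overline\nabla$ be the quarter-symmetric connection on $M$ determined by $P,\lambda_1,\lambda_2$. Then $(M,\overline\nabla)$ is Einstein with Einstein constant $\alpha$ if and only if the following conditions are satisfied: (1) $(F,\nabla^F)$ is Einstein with Einstein constant $\alpha_F$; (2) $l\left(\lambda_2\frac{f'}{f}-\frac{f''}{f}+\lambda_1^2-\lambda_1\lambda_2\right)=\alpha$; (3) $\alpha_F-ff''+(1-l)(f')^2+[\lambda_2^2-l\lambda_1\lambda_2-\alpha]f^2+[l\lambda_1+(l-1)\lambda_2]ff'=0$.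
   Context: On a pseudo-Riemannian manifold $(M,g)$ with Levi-Civita connection $\nabla$, a vector field $P$, the 1-form $\pi(X)=g(X,P)$ and nonzero real constants $\lambda_1,\lambda_2$, the quarter-symmetric connection is $\overline\nabla_XY=\nabla_XY+\lambda_1\pi(Y)X-\lambda_2g(X,Y)P$. Its curvature is $\overline R(X,Y)=\overline\nabla_X\overline\nabla_Y-\overline\nabla_Y\overline\nabla_X-\overline\nabla_{[X,Y]}$ and its Ricci tensor is $\overline{Ric}(X,Y)=\sum_k\varepsilon_k\,g(\overline R(X,E_k)Y,E_k)$, where $(E_k)$ is a local orthonormal frame with $g(E_k,E_k)=\varepsilon_k=\pm1$ (note the sign convention; $\overline{Ric}$ need not be symmetric). The same formulas with the Levi-Civita connection $\nabla^F$ of $(F,g_F)$ define $Ric^F$ (same sign convention). $(M,\overline\nabla)$ is Einstein with Einstein constant $\alpha\in\mathbb{R}$ if $\overline{Ric}(X,Y)=\alpha g(X,Y)$ for all vector fields $X,Y$; $(F,\nabla^F)$ is Einstein with constant $\alpha_F\in\mathbb{R}$ if $Ric^F=\alpha_Fg_F$. Primes denote $d/dt$. *)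

theory Defs
  imports "HOL-Analysis.Analysis"
begin

section \<open>Smooth maps between Euclidean spaces\<close>

text \<open>
  \<open>Ck_on n S f\<close>: for open \<open>S\<close> in a finite-dimensional space, \<open>f\<close> is \<open>n\<close> times continuously
  differentiable on \<open>S\<close>; the recursion runs through all directional derivatives of \<open>f\<close>.
\<close>

primrec Ck_on ::
  "nat \<Rightarrow> 'a::real_normed_vector set \<Rightarrow> ('a \<Rightarrow> 'b::real_normed_vector) \<Rightarrow> bool" where
  "Ck_on 0 S f \<longleftrightarrow> continuous_on S f"
| "Ck_on (Suc n) S f \<longleftrightarrow>
     (\<forall>x\<in>S. f differentiable (at x)) \<and> (\<forall>v. Ck_on n S (\<lambda>x. frechet_derivative f (at x) v))"

definition smooth_on :: "'a::real_normed_vector set \<Rightarrow> ('a \<Rightarrow> 'b::real_normed_vector) \<Rightarrow> bool" where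
  "smooth_on S f \<longleftrightarrow> (\<forall>n. Ck_on n S f)"


section \<open>Smooth manifolds\<close>

text \<open>
  A chart is its domain together with its coordinate map; the values of the coordinate map
  outside the domain are irrelevant. A manifold of dimension \<open>n\<close> is modelled on a Euclidean space
  \<open>'e\<close> with \<open>DIM('e) = n\<close>. The atlas need not be maximal: it determines the smooth structure.
\<close>

datatype ('a, 'e) chart = Chart (cdom: "'a set") (cmap: "'a \<Rightarrow> 'e")

datatype ('a, 'e) manifold = Manifold (mtop: "'a topology") (atlas: "('a, 'e) chart set")

abbreviation mpoints :: "('a, 'e) manifold \<Rightarrow> 'a set" where
  "mpoints M \<equiv> topspace (mtop M)"

definition cinv :: "('a, 'e) chart \<Rightarrow> 'e \<Rightarrow> 'a" where
  "cinv c = inv_into (cdom c) (cmap c)"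

definition charts_at :: "('a, 'e) manifold \<Rightarrow> 'a \<Rightarrow> ('a, 'e) chart set" where
  "charts_at M p = {c \<in> atlas M. p \<in> cdom c}"

definition smooth_manifold :: "('a, 'e::euclidean_space) manifold \<Rightarrow> bool" where
  "smooth_manifold M \<longleftrightarrow>
     Hausdorff_space (mtop M) \<and> second_countable (mtop M) \<and>
     mpoints M = (\<Union>c\<in>atlas M. cdom c) \<and>
     (\<forall>c\<in>atlas M. openin (mtop M) (cdom c) \<and> open (cmap c ` cdom c) \<and>
        homeomorphic_map (subtopology (mtop M) (cdom c)) (top_of_set (cmap c ` cdom c)) (cmap c)) \<and>
     (\<forall>c\<in>atlas M. \<forall>d\<in>atlas M. smooth_on (cmap c ` (cdom c \<inter> cdom d)) (cmap d \<circ> cinv c))"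

definition smooth_fun :: "('a, 'e::euclidean_space) manifold \<Rightarrow> 'a set \<Rightarrow> ('a \<Rightarrow> real) \<Rightarrow> bool" where
  "smooth_fun M U h \<longleftrightarrow> (\<forall>c\<in>atlas M. smooth_on (cmap c ` (cdom c \<inter> U)) (h \<circ> cinv c))"

text \<open>
  A tangent vector at \<open>p\<close> assigns to every chart around \<open>p\<close> its component vector in that chart,
  subject to the transformation law of contravariant vectors; charts not containing \<open>p\<close> are sent
  to \<open>0\<close>, so that equality of functions is equality of tangent vectors.
\<close>

type_synonym ('a, 'e) tangent = "('a, 'e) chart \<Rightarrow> 'e"
type_synonym ('a, 'e) vfield = "'a \<Rightarrow> ('a, 'e) tangent"

definition tangent_space ::
  "('a, 'e::euclidean_space) manifold \<Rightarrow> 'a \<Rightarrow> ('a, 'e) tangent set" where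
  "tangent_space M p =
     {\<xi>. (\<forall>c\<in>charts_at M p. \<forall>d\<in>charts_at M p.
            \<xi> d = frechet_derivative (cmap d \<circ> cinv c) (at (cmap c p)) (\<xi> c)) \<and>
         (\<forall>c. c \<notin> charts_at M p \<longrightarrow> \<xi> c = 0)}"

text \<open>Smooth vector fields on an open set \<open>U\<close>; the values outside \<open>U\<close> are unconstrained.\<close>

definition vector_field ::
  "('a, 'e::euclidean_space) manifold \<Rightarrow> 'a set \<Rightarrow> ('a, 'e) vfield \<Rightarrow> bool" where
  "vector_field M U X \<longleftrightarrow>
     (\<forall>p\<in>U. X p \<in> tangent_space M p) \<and>
     (\<forall>c\<in>atlas M. smooth_on (cmap c ` (cdom c \<inter> U)) (\<lambda>x. X (cinv c x) c))"

definition vf_add :: "('a, 'e::euclidean_space) vfield \<Rightarrow> ('a, 'e) vfield \<Rightarrow> ('a, 'e) vfield" where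
  "vf_add X Y = (\<lambda>p c. X p c + Y p c)"

definition vf_diff :: "('a, 'e::euclidean_space) vfield \<Rightarrow> ('a, 'e) vfield \<Rightarrow> ('a, 'e) vfield" where
  "vf_diff X Y = (\<lambda>p c. X p c - Y p c)"

definition vf_scale :: "('a \<Rightarrow> real) \<Rightarrow> ('a, 'e::euclidean_space) vfield \<Rightarrow> ('a, 'e) vfield" where
  "vf_scale h X = (\<lambda>p c. h p *\<^sub>R X p c)"

text \<open>The derivative \<open>\<xi>(h)\<close> of a function \<open>h\<close> along \<open>\<xi> \<in> T\<^sub>pM\<close>, computed in any chart around \<open>p\<close>.\<close>

definition tangent_deriv ::
  "('a, 'e::euclidean_space) manifold \<Rightarrow> 'a \<Rightarrow> ('a, 'e) tangent \<Rightarrow> ('a \<Rightarrow> real) \<Rightarrow> real" where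
  "tangent_deriv M p \<xi> h =
     (let c = (SOME c. c \<in> charts_at M p)
      in frechet_derivative (h \<circ> cinv c) (at (cmap c p)) (\<xi> c))"

text \<open>The differential \<open>T\<^sub>pM \<rightarrow> T\<^bsub>\<phi>(p)\<^esub>N\<close> of \<open>\<phi> : M \<rightarrow> N\<close>, computed in any chart of \<open>M\<close> around \<open>p\<close>.\<close>

definition differential ::
  "('a, 'e::euclidean_space) manifold \<Rightarrow> ('b, 'f::euclidean_space) manifold \<Rightarrow> ('a \<Rightarrow> 'b) \<Rightarrow>
     'a \<Rightarrow> ('a, 'e) tangent \<Rightarrow> ('b, 'f) tangent" where
  "differential M N \<phi> p \<xi> =
     (let c = (SOME c. c \<in> charts_at M p)
      in (\<lambda>d. if d \<in> charts_at N (\<phi> p)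
              then frechet_derivative (cmap d \<circ> \<phi> \<circ> cinv c) (at (cmap c p)) (\<xi> c) else 0))"

text \<open>In coordinates, \<open>[X, Y]\<^sup>j = \<Sum>\<^sub>i (X\<^sup>i \<partial>\<^sub>iY\<^sup>j - Y\<^sup>i \<partial>\<^sub>iX\<^sup>j)\<close>.\<close>

definition lie_bracket ::
  "('a, 'e::euclidean_space) manifold \<Rightarrow> ('a, 'e) vfield \<Rightarrow> ('a, 'e) vfield \<Rightarrow> ('a, 'e) vfield" where
  "lie_bracket M X Y = (\<lambda>p c.
     if c \<in> charts_at M p
     then frechet_derivative (\<lambda>x. Y (cinv c x) c) (at (cmap c p)) (X p c)
        - frechet_derivative (\<lambda>x. X (cinv c x) c) (at (cmap c p)) (Y p c)
     else 0)"


section \<open>Pseudo-Riemannian metrics and connections\<close>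

type_synonym ('a, 'e) metric_tensor = "'a \<Rightarrow> ('a, 'e) tangent \<Rightarrow> ('a, 'e) tangent \<Rightarrow> real"

definition pseudo_riemannian ::
  "('a, 'e::euclidean_space) manifold \<Rightarrow> ('a, 'e) metric_tensor \<Rightarrow> bool" where
  "pseudo_riemannian M g \<longleftrightarrow>
     smooth_manifold M \<and>
     (\<forall>p\<in>mpoints M. \<forall>\<xi>\<in>tangent_space M p. \<forall>\<eta>\<in>tangent_space M p. g p \<xi> \<eta> = g p \<eta> \<xi>) \<and>
     (\<forall>p\<in>mpoints M. \<forall>\<xi>\<in>tangent_space M p. \<forall>\<eta>\<in>tangent_space M p. \<forall>\<zeta>\<in>tangent_space M p. \<forall>a b.
        g p (\<lambda>c. a *\<^sub>R \<xi> c + b *\<^sub>R \<eta> c) \<zeta> = a * g p \<xi> \<zeta> + b * g p \<eta> \<zeta>) \<and>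
     (\<forall>p\<in>mpoints M. \<forall>\<xi>\<in>tangent_space M p.
        (\<forall>\<eta>\<in>tangent_space M p. g p \<xi> \<eta> = 0) \<longrightarrow> \<xi> = (\<lambda>c. 0)) \<and>
     (\<forall>U X Y. openin (mtop M) U \<and> vector_field M U X \<and> vector_field M U Y \<longrightarrow>
        smooth_fun M U (\<lambda>p. g p (X p) (Y p)))"

type_synonym ('a, 'e) connection = "('a, 'e) vfield \<Rightarrow> ('a, 'e) vfield \<Rightarrow> ('a, 'e) vfield"

text \<open>
  Affine connections. A connection acts on vector fields defined on arbitrary open sets; the
  second condition says that \<open>\<nabla>\<^sub>XY\<close> on \<open>U\<close> only depends on \<open>X\<close> and \<open>Y\<close> on \<open>U\<close>.
\<close>

definition affine_connection ::
  "('a, 'e::euclidean_space) manifold \<Rightarrow> ('a, 'e) connection \<Rightarrow> bool" where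
  "affine_connection M nab \<longleftrightarrow>
     (\<forall>U X Y. openin (mtop M) U \<and> vector_field M U X \<and> vector_field M U Y \<longrightarrow>
        vector_field M U (nab X Y)) \<and>
     (\<forall>U X X' Y Y'. openin (mtop M) U \<and>
        vector_field M U X \<and> vector_field M U X' \<and> vector_field M U Y \<and> vector_field M U Y' \<and>
        (\<forall>p\<in>U. X p = X' p) \<and> (\<forall>p\<in>U. Y p = Y' p) \<longrightarrow>
        (\<forall>p\<in>U. nab X Y p = nab X' Y' p)) \<and>
     (\<forall>U X X' Y. openin (mtop M) U \<and>
        vector_field M U X \<and> vector_field M U X' \<and> vector_field M U Y \<longrightarrow>
        (\<forall>p\<in>U. nab (vf_add X X') Y p = vf_add (nab X Y) (nab X' Y) p)) \<and>
     (\<forall>U X Y Y'. openin (mtop M) U \<and>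
        vector_field M U X \<and> vector_field M U Y \<and> vector_field M U Y' \<longrightarrow>
        (\<forall>p\<in>U. nab X (vf_add Y Y') p = vf_add (nab X Y) (nab X Y') p)) \<and>
     (\<forall>U h X Y. openin (mtop M) U \<and>
        smooth_fun M U h \<and> vector_field M U X \<and> vector_field M U Y \<longrightarrow>
        (\<forall>p\<in>U. nab (vf_scale h X) Y p = vf_scale h (nab X Y) p)) \<and>
     (\<forall>U h X Y. openin (mtop M) U \<and>
        smooth_fun M U h \<and> vector_field M U X \<and> vector_field M U Y \<longrightarrow>
        (\<forall>p\<in>U. nab X (vf_scale h Y) p =
           vf_add (vf_scale (\<lambda>q. tangent_deriv M q (X q) h) Y) (vf_scale h (nab X Y)) p))"

definition torsion_free ::
  "('a, 'e::euclidean_space) manifold \<Rightarrow> ('a, 'e) connection \<Rightarrow> bool" where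
  "torsion_free M nab \<longleftrightarrow>
     (\<forall>U X Y. openin (mtop M) U \<and> vector_field M U X \<and> vector_field M U Y \<longrightarrow>
        (\<forall>p\<in>U. vf_diff (nab X Y) (nab Y X) p = lie_bracket M X Y p))"

definition metric_compatible ::
  "('a, 'e::euclidean_space) manifold \<Rightarrow> ('a, 'e) metric_tensor \<Rightarrow> ('a, 'e) connection \<Rightarrow> bool" where
  "metric_compatible M g nab \<longleftrightarrow>
     (\<forall>U X Y Z. openin (mtop M) U \<and>
        vector_field M U X \<and> vector_field M U Y \<and> vector_field M U Z \<longrightarrow>
        (\<forall>p\<in>U. tangent_deriv M p (X p) (\<lambda>q. g q (Y q) (Z q)) =
           g p (nab X Y p) (Z p) + g p (Y p) (nab X Z p)))"

definition levi_civita ::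
  "('a, 'e::euclidean_space) manifold \<Rightarrow> ('a, 'e) metric_tensor \<Rightarrow> ('a, 'e) connection \<Rightarrow> bool" where
  "levi_civita M g nab \<longleftrightarrow>
     affine_connection M nab \<and> torsion_free M nab \<and> metric_compatible M g nab"

definition quarter_symmetric ::
  "('a, 'e::euclidean_space) metric_tensor \<Rightarrow> ('a, 'e) vfield \<Rightarrow> real \<Rightarrow> real \<Rightarrow>
     ('a, 'e) connection \<Rightarrow> ('a, 'e) connection" where
  "quarter_symmetric g P lam1 lam2 nab = (\<lambda>X Y p c.
     nab X Y p c + (lam1 * g p (Y p) (P p)) *\<^sub>R X p c - (lam2 * g p (X p) (Y p)) *\<^sub>R P p c)"

definition curvature ::
  "('a, 'e::euclidean_space) manifold \<Rightarrow> ('a, 'e) connection \<Rightarrow>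
     ('a, 'e) vfield \<Rightarrow> ('a, 'e) vfield \<Rightarrow> ('a, 'e) vfield \<Rightarrow> ('a, 'e) vfield" where
  "curvature M nab X Y Z =
     vf_diff (vf_diff (nab X (nab Y Z)) (nab Y (nab X Z))) (nab (lie_bracket M X Y) Z)"

definition orthonormal_frame ::
  "('a, 'e::euclidean_space) manifold \<Rightarrow> ('a, 'e) metric_tensor \<Rightarrow> 'a set \<Rightarrow>
     (nat \<Rightarrow> ('a, 'e) vfield) \<Rightarrow> (nat \<Rightarrow> real) \<Rightarrow> bool" where
  "orthonormal_frame M g U E eps \<longleftrightarrow>
     openin (mtop M) U \<and>
     (\<forall>k<DIM('e). vector_field M U (E k) \<and> eps k \<in> {1, -1}) \<and>
     (\<forall>p\<in>U. \<forall>j<DIM('e). \<forall>k<DIM('e). g p (E j p) (E k p) = (if j = k then eps k else 0))"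

text \<open>
  \<open>Ric(X, Y) = \<Sum>\<^sub>k \<epsilon>\<^sub>k g(R(X, E\<^sub>k)Y, E\<^sub>k)\<close> for a local orthonormal frame \<open>E\<close> around the point;
  the value does not depend on the frame. With this sign convention round spheres have negative
  Ricci tensor.
\<close>

definition ricci ::
  "('a, 'e::euclidean_space) manifold \<Rightarrow> ('a, 'e) metric_tensor \<Rightarrow> ('a, 'e) connection \<Rightarrow>
     ('a, 'e) vfield \<Rightarrow> ('a, 'e) vfield \<Rightarrow> 'a \<Rightarrow> real" where
  "ricci M g nab X Y p =
     (THE r. \<exists>U E eps. orthonormal_frame M g U E eps \<and> p \<in> U \<and>
        r = (\<Sum>k<DIM('e). eps k * g p (curvature M nab X (E k) Y p) (E k p)))"

definition einstein ::
  "('a, 'e::euclidean_space) manifold \<Rightarrow> ('a, 'e) metric_tensor \<Rightarrow> ('a, 'e) connection \<Rightarrow>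
     real \<Rightarrow> bool" where
  "einstein M g nab \<alpha> \<longleftrightarrow>
     (\<forall>X Y. vector_field M (mpoints M) X \<and> vector_field M (mpoints M) Y \<longrightarrow>
        (\<forall>p\<in>mpoints M. ricci M g nab X Y p = \<alpha> * g p (X p) (Y p)))"


section \<open>Warped products over an interval\<close>

definition interval_manifold :: "real set \<Rightarrow> (real, real) manifold" where
  "interval_manifold I = Manifold (top_of_set I) {Chart I (\<lambda>t. t)}"

definition product_manifold ::
  "('a, 'e) manifold \<Rightarrow> ('b, 'f) manifold \<Rightarrow> ('a \<times> 'b, 'e \<times> 'f) manifold" where
  "product_manifold M N =
     Manifold (prod_topology (mtop M) (mtop N))
       {Chart (cdom c \<times> cdom d) (\<lambda>(x, y). (cmap c x, cmap d y)) | c d. c \<in> atlas M \<and> d \<in> atlas N}"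

definition warped_manifold ::
  "real set \<Rightarrow> ('a, 'e::euclidean_space) manifold \<Rightarrow> (real \<times> 'a, real \<times> 'e) manifold" where
  "warped_manifold I F = product_manifold (interval_manifold I) F"

text \<open>The metric \<open>-dt\<^sup>2 + f(t)\<^sup>2 g\<^sub>F\<close>; here \<open>dt(\<xi>)\<close> is the derivative along \<open>\<xi>\<close> of \<open>(t, x) \<mapsto> t\<close>.\<close>

definition warped_metric ::
  "real set \<Rightarrow> (real \<Rightarrow> real) \<Rightarrow> ('a, 'e::euclidean_space) manifold \<Rightarrow> ('a, 'e) metric_tensor \<Rightarrow>
     (real \<times> 'a, real \<times> 'e) metric_tensor" where
  "warped_metric I f F gF = (\<lambda>p \<xi> \<eta>.
     (let M = warped_manifold I F
      in - (tangent_deriv M p \<xi> fst * tangent_deriv M p \<eta> fst)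
         + (f (fst p))\<^sup>2 * gF (snd p) (differential M F snd p \<xi>) (differential M F snd p \<eta>)))"

text \<open>\<open>\<partial>/\<partial>t\<close> at \<open>(t, x)\<close> is the velocity at time \<open>t\<close> of the curve \<open>s \<mapsto> (s, x)\<close>.\<close>

definition time_field ::
  "real set \<Rightarrow> ('a, 'e::euclidean_space) manifold \<Rightarrow> (real \<times> 'a, real \<times> 'e) vfield" where
  "time_field I F = (\<lambda>(t, x) c.
     if c \<in> charts_at (warped_manifold I F) (t, x)
     then vector_derivative (\<lambda>s. cmap c (s, x)) (at t) else 0)"

end

theory Submission
  imports Defs
begin

text \<open>
  In a chart, a connection is \<open>(\<nabla>\<^sub>XY) = DY(X) + \<Gamma>(X, Y)\<close>, and since second derivatives commute, its
  curvature is \<open>R(u, v)w = D\<^sub>u\<Gamma>(v, w) - D\<^sub>v\<Gamma>(u, w) + \<Gamma>(u, \<Gamma>(v, w)) - \<Gamma>(v, \<Gamma>(u, w))\<close>. Hence \<open>Ric(u, w)\<close>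
  is the trace of \<open>v \<mapsto> R(u, v)w\<close>. For a warped product, Koszul's formula expresses \<open>\<Gamma>\<close> by \<open>f\<close>, \<open>f'\<close>,
  \<open>h = g\<^sub>F\<close> and \<open>\<Gamma>\<^sub>F\<close>. Writing \<open>u = (u\<^sub>0, u\<^sub>1)\<close>, the quarter-symmetric connection becomes
  \<open>\<Gamma>(u, v) = (b h(u\<^sub>1, v\<^sub>1) + \<mu> u\<^sub>0 v\<^sub>0, \<Gamma>\<^sub>F(u\<^sub>1, v\<^sub>1) + c u\<^sub>0 v\<^sub>1 + a v\<^sub>0 u\<^sub>1)\<close> with \<open>a = f'/f - \<lambda>\<^sub>1\<close>, \<open>b = f f' - \<lambda>\<^sub>2 f\<^sup>2\<close>,
  \<open>c = f'/f\<close>, \<open>\<mu> = \<lambda>\<^sub>2 - \<lambda>\<^sub>1\<close>, and taking traces gives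
  \<open>Ric(u, w) = Ric\<^sub>F(u\<^sub>1, w\<^sub>1) + l (a' + a c - a \<mu>) u\<^sub>0 w\<^sub>0 + ((1 - l) a b - b' + b c - \<mu> b) h(u\<^sub>1, w\<^sub>1)\<close>.
  Comparing coefficients with \<open>\<alpha> (-u\<^sub>0 w\<^sub>0 + f\<^sup>2 h(u\<^sub>1, w\<^sub>1))\<close> yields the three conditions. The Einstein
  condition only speaks about global vector fields; a bump function provides one with any given value.
\<close>

section \<open>Calculus of smooth maps\<close>

lemma Ck_on_cong:
  assumes "open S" "\<And>x. x \<in> S \<Longrightarrow> f x = g x"
  shows "Ck_on n S f \<longleftrightarrow> Ck_on n S g"
  using assms(2)
proof (induction n arbitrary: f g)
  case 0
  then show ?case by (simp cong: continuous_on_cong)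
next
  case (Suc n)
  have hd: "(f has_derivative D) (at x) \<longleftrightarrow> (g has_derivative D) (at x)" if "x \<in> S" for x D
    using has_derivative_transform_within_open[OF _ assms(1) that, of f D UNIV g]
      has_derivative_transform_within_open[OF _ assms(1) that, of g D UNIV f] Suc.prems by auto
  have fd: "frechet_derivative f (at x) = frechet_derivative g (at x)" if "x \<in> S" for x
    using hd[OF that] by (simp add: frechet_derivative_def)
  have "f differentiable (at x) \<longleftrightarrow> g differentiable (at x)" if "x \<in> S" for x
    using hd[OF that] by (simp add: differentiable_def)
  moreover have "Ck_on n S (\<lambda>x. frechet_derivative f (at x) v)
      \<longleftrightarrow> Ck_on n S (\<lambda>x. frechet_derivative g (at x) v)" for v
    by (rule Suc.IH) (simp add: fd)
  ultimately show ?case by auto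
qed

lemma Ck_on_subset: "Ck_on n S f \<Longrightarrow> T \<subseteq> S \<Longrightarrow> Ck_on n T f"
  by (induction n arbitrary: f) (auto intro: continuous_on_subset)

lemma Ck_on_Suc_imp: "Ck_on (Suc n) S f \<Longrightarrow> Ck_on n S f"
proof (induction n arbitrary: f)
  case 0
  then show ?case
    by (auto simp: continuous_on_eq_continuous_within
        intro: differentiable_imp_continuous_within differentiable_at_withinI)
next
  case (Suc n)
  then have "Ck_on n S (\<lambda>x. frechet_derivative f (at x) v)" for v
    by (metis Ck_on.simps(2))
  with Suc.prems show ?case by simp
qed

lemma Ck_on_local:
  assumes "\<And>x. x \<in> S \<Longrightarrow> \<exists>T. open T \<and> x \<in> T \<and> Ck_on n T f"
  shows "Ck_on n S f"
  using assms
proof (induction n arbitrary: f)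
  case 0
  have "isCont f x" if x: "x \<in> S" for x
  proof -
    obtain T where "open T" "x \<in> T" "continuous_on T f" using 0[OF x] by auto
    then show ?thesis by (simp add: continuous_on_eq_continuous_at)
  qed
  then show ?case by (simp add: continuous_at_imp_continuous_on)
next
  case (Suc n)
  have loc: "\<exists>T. open T \<and> x \<in> T \<and> f differentiable (at x) \<and>
      (\<forall>v. Ck_on n T (\<lambda>x. frechet_derivative f (at x) v))" if x: "x \<in> S" for x
    using Suc.prems[OF x] by auto
  have "Ck_on n S (\<lambda>x. frechet_derivative f (at x) v)" for v
  proof (rule Suc.IH)
    show "\<exists>T. open T \<and> x \<in> T \<and> Ck_on n T (\<lambda>x. frechet_derivative f (at x) v)"
      if x: "x \<in> S" for x
      using loc[OF x] by auto
  qed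
  with loc show ?case by auto
qed

lemma Ck_on_const [simp]: "Ck_on n S (\<lambda>x. c)"
  by (induction n arbitrary: c) (simp_all)

lemma Ck_on_bounded_linear: "bounded_linear L \<Longrightarrow> Ck_on n S L"
proof (cases n)
  case 0
  then show "bounded_linear L \<Longrightarrow> Ck_on n S L"
    by (simp add: linear_continuous_on)
next
  case (Suc m)
  assume L: "bounded_linear L"
  then have "frechet_derivative L (at x) = L" for x
    using bounded_linear_imp_has_derivative frechet_derivative_at by metis
  then show ?thesis using Suc L by (simp add: bounded_linear_imp_differentiable)
qed

lemma Ck_on_bounded_linear_compose:
  assumes "open S" "bounded_linear L" "Ck_on n S f"
  shows "Ck_on n S (\<lambda>x. L (f x))"
  using assms(3)
proof (induction n arbitrary: f)
  case 0
  then show ?case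
    by (simp add: bounded_linear.continuous_on[OF assms(2)])
next
  case (Suc n)
  have hd: "((\<lambda>x. L (f x)) has_derivative (\<lambda>v. L (frechet_derivative f (at x) v))) (at x)"
    if "x \<in> S" for x
    using Suc.prems that
    by (intro bounded_linear.has_derivative[OF assms(2)]) (simp add: frechet_derivative_works)
  have "Ck_on n S (\<lambda>x. frechet_derivative (\<lambda>x. L (f x)) (at x) v)" for v
  proof (subst Ck_on_cong[OF assms(1)])
    show "frechet_derivative (\<lambda>x. L (f x)) (at x) v = L (frechet_derivative f (at x) v)"
      if "x \<in> S" for x
      using frechet_derivative_at[OF hd[OF that]] by metis
    show "Ck_on n S (\<lambda>x. L (frechet_derivative f (at x) v))"
      using Suc by simp
  qed
  then show ?case using differentiableI[OF hd] by simp
qed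

lemma Ck_on_add:
  assumes "open S" "Ck_on n S f" "Ck_on n S g"
  shows "Ck_on n S (\<lambda>x. f x + g x)"
  using assms(2,3)
proof (induction n arbitrary: f g)
  case 0
  then show ?case by (simp add: continuous_on_add)
next
  case (Suc n)
  have hd: "((\<lambda>x. f x + g x) has_derivative
      (\<lambda>v. frechet_derivative f (at x) v + frechet_derivative g (at x) v)) (at x)"
    if "x \<in> S" for x
    using Suc.prems that
    by (intro has_derivative_add) (simp_all add: frechet_derivative_works)
  have "Ck_on n S (\<lambda>x. frechet_derivative (\<lambda>x. f x + g x) (at x) v)" for v
  proof (subst Ck_on_cong[OF assms(1)])
    show "frechet_derivative (\<lambda>x. f x + g x) (at x) v
        = frechet_derivative f (at x) v + frechet_derivative g (at x) v"
      if "x \<in> S" for x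
      using frechet_derivative_at[OF hd[OF that]] by metis
    show "Ck_on n S (\<lambda>x. frechet_derivative f (at x) v + frechet_derivative g (at x) v)"
      using Suc by simp
  qed
  then show ?case using differentiableI[OF hd] by simp
qed

lemma Ck_on_bilinear:
  assumes "open S" "bounded_bilinear B" "Ck_on n S f" "Ck_on n S g"
  shows "Ck_on n S (\<lambda>x. B (f x) (g x))"
  using assms(3,4)
proof (induction n arbitrary: f g)
  case 0
  then show ?case by (simp add: bounded_bilinear.continuous_on[OF assms(2)])
next
  case (Suc n)
  have hd: "((\<lambda>x. B (f x) (g x)) has_derivative
      (\<lambda>v. B (f x) (frechet_derivative g (at x) v) + B (frechet_derivative f (at x) v) (g x))) (at x)"
    if "x \<in> S" for x
    using Suc.prems that
    by (intro bounded_bilinear.FDERIV[OF assms(2)]) (simp_all add: frechet_derivative_works)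
  have "Ck_on n S (\<lambda>x. frechet_derivative (\<lambda>x. B (f x) (g x)) (at x) v)" for v
  proof (subst Ck_on_cong[OF assms(1)])
    show "frechet_derivative (\<lambda>x. B (f x) (g x)) (at x) v
        = B (f x) (frechet_derivative g (at x) v) + B (frechet_derivative f (at x) v) (g x)"
      if "x \<in> S" for x
      using frechet_derivative_at[OF hd[OF that]] by metis
    have "Ck_on n S f" "Ck_on n S g" 
      using Suc.prems Ck_on_Suc_imp by blast+
    then show "Ck_on n S (\<lambda>x. B (f x) (frechet_derivative g (at x) v)
        + B (frechet_derivative f (at x) v) (g x))"
      using Suc by (intro Ck_on_add[OF assms(1)] Suc.IH) simp_all
  qed
  then show ?case using differentiableI[OF hd] by simp
qed

lemma Ck_on_sum:
  assumes "open S" "\<And>i. i \<in> A \<Longrightarrow> Ck_on n S (f i)"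
  shows "Ck_on n S (\<lambda>x. \<Sum>i\<in>A. f i x)"
  using assms(2)
  by (induction A rule: infinite_finite_induct) (auto intro!: Ck_on_add[OF assms(1)])

lemma linear_Basis_expand:
  fixes x :: "'a::euclidean_space"
  assumes "linear L"
  shows "L x = (\<Sum>b\<in>Basis. (x \<bullet> b) *\<^sub>R L b)"
proof -
  have "L x = L (\<Sum>b\<in>Basis. (x \<bullet> b) *\<^sub>R b)"
    by (simp only: euclidean_representation)
  then show ?thesis
    by (simp add: linear_sum[OF assms] linear_cmul[OF assms])
qed

lemma Ck_on_compose:
  fixes f :: "'a::real_normed_vector \<Rightarrow> 'b::euclidean_space" and g :: "'b \<Rightarrow> 'c::real_normed_vector"
  assumes "open S" "f ` S \<subseteq> T" "Ck_on n S f" "Ck_on n T g"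
  shows "Ck_on n S (\<lambda>x. g (f x))"
  using assms(3,4)
proof (induction n arbitrary: g)
  case 0
  then show ?case using continuous_on_compose2[OF _ _ assms(2)] by simp
next
  case (Suc n)
  have hd: "((\<lambda>x. g (f x)) has_derivative
      (\<lambda>v. frechet_derivative g (at (f x)) (frechet_derivative f (at x) v))) (at x)"
    if "x \<in> S" for x
    using Suc.prems that assms(2)
    by (intro has_derivative_compose[of f _ x UNIV g])
       (auto simp flip: frechet_derivative_works)
  have lin: "linear (frechet_derivative g (at (f x)))" if "x \<in> S" for x
    using Suc.prems that assms(2) by (intro linear_frechet_derivative) auto
  have "Ck_on n S (\<lambda>x. frechet_derivative (\<lambda>x. g (f x)) (at x) v)" for v
  proof (subst Ck_on_cong[OF assms(1)])
    show "frechet_derivative (\<lambda>x. g (f x)) (at x) v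
        = (\<Sum>b\<in>Basis. (frechet_derivative f (at x) v \<bullet> b) *\<^sub>R frechet_derivative g (at (f x)) b)"
      if "x \<in> S" for x
      unfolding frechet_derivative_at[OF hd[OF that], symmetric]
      by (rule linear_Basis_expand[OF lin[OF that]])
    have "Ck_on n S f"
      using Suc.prems Ck_on_Suc_imp by blast
    then have "Ck_on n S (\<lambda>x. frechet_derivative g (at (f x)) b)" for b
      using Suc.prems by (intro Suc.IH[of "\<lambda>y. frechet_derivative g (at y) b"]) simp_all
    moreover have "Ck_on n S (\<lambda>x. frechet_derivative f (at x) v \<bullet> b)" for b
      using Suc.prems
      by (intro Ck_on_bounded_linear_compose[OF assms(1) bounded_linear_inner_left]) simp
    ultimately show "Ck_on n S (\<lambda>x. \<Sum>b\<in>Basis.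
        (frechet_derivative f (at x) v \<bullet> b) *\<^sub>R frechet_derivative g (at (f x)) b)"
      by (intro Ck_on_sum[OF assms(1)] Ck_on_bilinear[OF assms(1) bounded_bilinear_scaleR])
  qed
  then show ?case using differentiableI[OF hd] by simp
qed

lemma smooth_on_cong:
  assumes "open S" "\<And>x. x \<in> S \<Longrightarrow> f x = g x"
  shows "smooth_on S f \<longleftrightarrow> smooth_on S g"
  unfolding smooth_on_def using Ck_on_cong[OF assms] by simp

lemma smooth_on_subset: "smooth_on S f \<Longrightarrow> T \<subseteq> S \<Longrightarrow> smooth_on T f"
  unfolding smooth_on_def using Ck_on_subset[of _ S f T] by simp

lemma smooth_on_local:
  assumes "\<And>x. x \<in> S \<Longrightarrow> \<exists>T. open T \<and> x \<in> T \<and> smooth_on T f"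
  shows "smooth_on S f"
proof -
  have "Ck_on n S f" for n
  proof (rule Ck_on_local)
    fix x assume "x \<in> S"
    from assms[OF this] obtain T where T: "open T" "x \<in> T" "smooth_on T f" by auto
    then have "Ck_on n T f" by (simp add: smooth_on_def)
    with T(1,2) show "\<exists>T. open T \<and> x \<in> T \<and> Ck_on n T f" by auto
  qed
  then show ?thesis by (simp add: smooth_on_def)
qed

lemma smooth_on_const [simp]: "smooth_on S (\<lambda>x. c)"
  by (simp add: smooth_on_def)

lemma smooth_on_bounded_linear: "bounded_linear L \<Longrightarrow> smooth_on S L"
  by (simp add: smooth_on_def Ck_on_bounded_linear)

lemma smooth_on_ident [simp]: "smooth_on S (\<lambda>x. x)"
  by (simp add: smooth_on_bounded_linear)

lemma smooth_on_bounded_linear_compose: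
  "open S \<Longrightarrow> bounded_linear L \<Longrightarrow> smooth_on S f \<Longrightarrow> smooth_on S (\<lambda>x. L (f x))"
  unfolding smooth_on_def using Ck_on_bounded_linear_compose[of S L _ f] by simp

lemma smooth_on_bilinear:
  "open S \<Longrightarrow> bounded_bilinear B \<Longrightarrow> smooth_on S f \<Longrightarrow> smooth_on S g \<Longrightarrow> smooth_on S (\<lambda>x. B (f x) (g x))"
  unfolding smooth_on_def using Ck_on_bilinear[of S B _ f g] by simp

lemma smooth_on_add:
  "open S \<Longrightarrow> smooth_on S f \<Longrightarrow> smooth_on S g \<Longrightarrow> smooth_on S (\<lambda>x. f x + g x)"
  unfolding smooth_on_def using Ck_on_add[of S _ f g] by simp

lemma smooth_on_minus:
  "open S \<Longrightarrow> smooth_on S f \<Longrightarrow> smooth_on S (\<lambda>x. - f x)"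
  by (rule smooth_on_bounded_linear_compose[OF _ bounded_linear_minus[OF bounded_linear_ident]])

lemma smooth_on_diff:
  "open S \<Longrightarrow> smooth_on S f \<Longrightarrow> smooth_on S g \<Longrightarrow> smooth_on S (\<lambda>x. f x - g x)"
  using smooth_on_add[of S f "\<lambda>x. - g x"] smooth_on_minus[of S g] by simp

lemma smooth_on_scaleR:
  "open S \<Longrightarrow> smooth_on S f \<Longrightarrow> smooth_on S g \<Longrightarrow> smooth_on S (\<lambda>x. f x *\<^sub>R g x)"
  by (rule smooth_on_bilinear[OF _ bounded_bilinear_scaleR])

lemma smooth_on_mult:
  fixes f g :: "'a::real_normed_vector \<Rightarrow> real"
  shows "open S \<Longrightarrow> smooth_on S f \<Longrightarrow> smooth_on S g \<Longrightarrow> smooth_on S (\<lambda>x. f x * g x)"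
  by (rule smooth_on_bilinear[OF _ bounded_bilinear_mult])

lemma smooth_on_inner:
  fixes f g :: "'a::real_normed_vector \<Rightarrow> 'b::real_inner"
  shows "open S \<Longrightarrow> smooth_on S f \<Longrightarrow> smooth_on S g \<Longrightarrow> smooth_on S (\<lambda>x. f x \<bullet> g x)"
  by (rule smooth_on_bilinear[OF _ bounded_bilinear_inner])

lemma smooth_on_Pair:
  assumes "open S" "smooth_on S f" "smooth_on S g"
  shows "smooth_on S (\<lambda>x. (f x, g x))"
proof -
  have "smooth_on S (\<lambda>x. (f x, 0) + (0, g x))"
    using assms by (intro smooth_on_add smooth_on_bounded_linear_compose[where L="\<lambda>u. (u, 0)"]
      smooth_on_bounded_linear_compose[where L="\<lambda>u. (0, u)"])
      (simp_all add: bounded_linear_Pair bounded_linear_ident bounded_linear_zero)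
  then show ?thesis by simp
qed

lemma smooth_on_sum:
  "open S \<Longrightarrow> (\<And>i. i \<in> A \<Longrightarrow> smooth_on S (f i)) \<Longrightarrow> smooth_on S (\<lambda>x. \<Sum>i\<in>A. f i x)"
  unfolding smooth_on_def using Ck_on_sum[of S A _ f] by simp

lemma smooth_on_compose:
  fixes f :: "'a::real_normed_vector \<Rightarrow> 'b::euclidean_space"
  shows "open S \<Longrightarrow> f ` S \<subseteq> T \<Longrightarrow> smooth_on S f \<Longrightarrow> smooth_on T g \<Longrightarrow> smooth_on S (\<lambda>x. g (f x))"
  unfolding smooth_on_def using Ck_on_compose[of S f T _ g] by simp

lemma smooth_on_imp_differentiable: "smooth_on S f \<Longrightarrow> x \<in> S \<Longrightarrow> f differentiable (at x)"
  unfolding smooth_on_def by (metis Ck_on.simps(2))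

lemma smooth_on_has_derivative:
  "smooth_on S f \<Longrightarrow> x \<in> S \<Longrightarrow> (f has_derivative frechet_derivative f (at x)) (at x)"
  using smooth_on_imp_differentiable frechet_derivative_works by blast

lemma smooth_on_linear_derivative:
  "smooth_on S f \<Longrightarrow> x \<in> S \<Longrightarrow> linear (frechet_derivative f (at x))"
  using smooth_on_imp_differentiable linear_frechet_derivative by blast

lemma smooth_on_imp_continuous_on: "smooth_on S f \<Longrightarrow> continuous_on S f"
  unfolding smooth_on_def by (metis Ck_on.simps(1))

lemma smooth_on_derivative: "smooth_on S f \<Longrightarrow> smooth_on S (\<lambda>x. frechet_derivative f (at x) v)"
  unfolding smooth_on_def by (metis Ck_on.simps(2))

lemma smooth_on_derivative_along:
  fixes f :: "'a::euclidean_space \<Rightarrow> 'b::real_normed_vector"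
  assumes "open S" "smooth_on S f" "smooth_on S V"
  shows "smooth_on S (\<lambda>x. frechet_derivative f (at x) (V x))"
proof (subst smooth_on_cong[OF assms(1)])
  show "frechet_derivative f (at x) (V x)
      = (\<Sum>b\<in>Basis. (V x \<bullet> b) *\<^sub>R frechet_derivative f (at x) b)" if "x \<in> S" for x
    by (rule linear_Basis_expand[OF smooth_on_linear_derivative[OF assms(2) that]])
  show "smooth_on S (\<lambda>x. \<Sum>b\<in>Basis. (V x \<bullet> b) *\<^sub>R frechet_derivative f (at x) b)"
    using assms by (intro smooth_on_sum smooth_on_scaleR smooth_on_inner smooth_on_derivative) simp_all
qed

lemma smooth_on_bilinear_family:
  fixes V W :: "'a::real_normed_vector \<Rightarrow> 'b::euclidean_space"
    and B :: "'a \<Rightarrow> 'b \<Rightarrow> 'b \<Rightarrow> 'c::real_normed_vector"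
  assumes "open S" "\<And>x. x \<in> S \<Longrightarrow> bilinear (B x)" "\<And>u v. smooth_on S (\<lambda>x. B x u v)"
    and "smooth_on S V" "smooth_on S W"
  shows "smooth_on S (\<lambda>x. B x (V x) (W x))"
proof -
  have *: "B x (V x) (W x) = (\<Sum>a\<in>Basis. (V x \<bullet> a) *\<^sub>R (\<Sum>b\<in>Basis. (W x \<bullet> b) *\<^sub>R B x a b))"
    if "x \<in> S" for x
  proof -
    have l: "linear (\<lambda>u. B x u w)" "linear (B x u)" for u w
      using assms(2)[OF that] unfolding bilinear_def by blast+
    have "B x (V x) (W x) = (\<Sum>a\<in>Basis. (V x \<bullet> a) *\<^sub>R B x a (W x))"
      by (rule linear_Basis_expand[OF l(1)])
    also have "\<dots> = (\<Sum>a\<in>Basis. (V x \<bullet> a) *\<^sub>R (\<Sum>b\<in>Basis. (W x \<bullet> b) *\<^sub>R B x a b))"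
      by (rule sum.cong[OF refl], rule arg_cong[where f="scaleR _"], rule linear_Basis_expand[OF l(2)])
    finally show ?thesis .
  qed
  have "smooth_on S (\<lambda>x. \<Sum>a\<in>Basis. (V x \<bullet> a) *\<^sub>R (\<Sum>b\<in>Basis. (W x \<bullet> b) *\<^sub>R B x a b))"
    by (intro smooth_on_sum smooth_on_scaleR smooth_on_inner assms smooth_on_const)
  with smooth_on_cong[OF assms(1) *] show ?thesis by simp
qed

lemma Ck_on_vector_derivative:
  fixes f :: "real \<Rightarrow> 'b::real_normed_vector"
  assumes S: "open S" and f': "\<And>t. t \<in> S \<Longrightarrow> (f has_vector_derivative f' t) (at t)"
    and "Ck_on n S f'"
  shows "Ck_on (Suc n) S f"
proof -
  have hd: "(f has_derivative (\<lambda>v. v *\<^sub>R f' t)) (at t)" if "t \<in> S" for t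
    using f'[OF that] by (simp add: has_vector_derivative_def)
  have "Ck_on n S (\<lambda>t. frechet_derivative f (at t) v)" for v
  proof (subst Ck_on_cong[OF S])
    show "frechet_derivative f (at t) v = v *\<^sub>R f' t" if "t \<in> S" for t
      using frechet_derivative_at[OF hd[OF that]] by metis
    show "Ck_on n S (\<lambda>t. v *\<^sub>R f' t)"
      by (rule Ck_on_bounded_linear_compose[OF S bounded_linear_scaleR_right assms(3)])
  qed
  then show ?thesis using differentiableI[OF hd] by simp
qed

lemma smooth_on_powr: "smooth_on {0<..} (\<lambda>r::real. r powr a)"
proof -
  have "Ck_on n {0<..} (\<lambda>r::real. r powr a)" for n
  proof (induction n arbitrary: a)
    case 0
    then show ?case by (auto intro!: continuous_intros)
  next
    case (Suc n)
    show ?case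
    proof (rule Ck_on_vector_derivative)
      show "((\<lambda>r::real. r powr a) has_vector_derivative a *\<^sub>R t powr (a - 1)) (at t)"
        if "t \<in> {0<..}" for t
        using that has_real_derivative_powr[of t a]
        by (simp add: has_real_derivative_iff_has_vector_derivative)
      show "Ck_on n {0<..} (\<lambda>t. a *\<^sub>R t powr (a - 1))"
        by (rule Ck_on_bounded_linear_compose[OF _ bounded_linear_scaleR_right Suc]) simp
    qed simp
  qed
  then show ?thesis by (simp add: smooth_on_def)
qed

lemma tendsto_inverse_power_times_exp:
  "((\<lambda>r::real. inverse r ^ k * exp (- inverse r)) \<longlongrightarrow> 0) (at_right 0)"
proof -
  have "((\<lambda>s::real. s ^ k / exp s) \<longlongrightarrow> 0) at_top"
    by (rule tendsto_power_div_exp_0)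
  then have "((\<lambda>r::real. inverse r ^ k / exp (inverse r)) \<longlongrightarrow> 0) (at_right 0)"
    by (rule filterlim_compose[OF _ filterlim_inverse_at_top_right])
  then show ?thesis by (simp add: exp_minus divide_inverse)
qed

definition flat_exp :: "nat \<Rightarrow> real \<Rightarrow> real" where
  "flat_exp k r = (if r \<le> 0 then 0 else inverse r ^ k * exp (- inverse r))"

lemma flat_exp_has_derivative:
  "(flat_exp k has_vector_derivative flat_exp (k + 2) r - real k * flat_exp (k + 1) r) (at r)"
proof -
  consider "r < 0" | "r > 0" | "r = 0" by linarith
  then show ?thesis
  proof cases
    case 1
    have "((\<lambda>r. 0) has_vector_derivative flat_exp (k + 2) r - real k * flat_exp (k + 1) r) (at r)"
      using 1 by (simp add: flat_exp_def)
    then show ?thesis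
      by (rule has_vector_derivative_transform_within_open[where S="{..<0}"])
         (use 1 in \<open>auto simp: flat_exp_def\<close>)
  next
    case 2
    have "((\<lambda>r. inverse r ^ k * exp (- inverse r)) has_real_derivative
        flat_exp (k + 2) r - real k * flat_exp (k + 1) r) (at r)"
      using 2 by (auto intro!: derivative_eq_intros)
         (cases k; simp add: flat_exp_def field_simps power2_eq_square)
    then have "((\<lambda>r. inverse r ^ k * exp (- inverse r)) has_vector_derivative
        flat_exp (k + 2) r - real k * flat_exp (k + 1) r) (at r)"
      by (simp add: has_real_derivative_iff_has_vector_derivative)
    then show ?thesis
      by (rule has_vector_derivative_transform_within_open[where S="{0<..}"])
         (use 2 in \<open>auto simp: flat_exp_def\<close>)
  next
    case 3
    have "((\<lambda>h. flat_exp k h / h) \<longlongrightarrow> 0) (at_right 0)"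
      by (rule tendsto_cong[THEN iffD1, OF _ tendsto_inverse_power_times_exp[of "Suc k"]])
         (auto simp: eventually_at_filter flat_exp_def divide_inverse)
    moreover have "((\<lambda>h. flat_exp k h / h) \<longlongrightarrow> 0) (at_left 0)"
      by (rule tendsto_cong[THEN iffD1, OF _ tendsto_const[of 0]])
         (auto simp: eventually_at_filter flat_exp_def)
    ultimately have "((\<lambda>h. flat_exp k h / h) \<longlongrightarrow> 0) (at 0)"
      by (simp add: filterlim_at_split)
    then have "(flat_exp k has_real_derivative 0) (at 0)"
      by (simp add: DERIV_def flat_exp_def)
    then show ?thesis
      using 3 by (simp add: has_real_derivative_iff_has_vector_derivative flat_exp_def)
  qed
qed

lemma smooth_on_flat_exp: "smooth_on UNIV (flat_exp k)"
proof -
  have "Ck_on n UNIV (flat_exp k)" for n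
  proof (induction n arbitrary: k)
    case 0
    have "isCont (flat_exp k) r" for r
      using flat_exp_has_derivative has_vector_derivative_continuous by blast
    then show ?case by (simp add: continuous_at_imp_continuous_on)
  next
    case (Suc n)
    show ?case
    proof (rule Ck_on_vector_derivative)
      have "Ck_on n UNIV (\<lambda>r. flat_exp (k + 2) r + (- real k) * flat_exp (k + 1) r)"
        by (intro Ck_on_add Ck_on_bounded_linear_compose[OF _ bounded_linear_mult_right] Suc)
           simp_all
      then show "Ck_on n UNIV (\<lambda>r. flat_exp (k + 2) r - real k * flat_exp (k + 1) r)"
        by simp
    qed (use flat_exp_has_derivative in auto)
  qed
  then show ?thesis by (simp add: smooth_on_def)
qed

lemma exists_smooth_bump:
  fixes x0 :: "'a::euclidean_space"
  assumes "open W" "x0 \<in> W"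
  shows "\<exists>(\<beta> :: 'a \<Rightarrow> real) K. smooth_on UNIV \<beta> \<and> \<beta> x0 = 1 \<and> compact K \<and> K \<subseteq> W \<and>
    (\<forall>x. x \<notin> K \<longrightarrow> \<beta> x = 0)"
proof -
  obtain \<epsilon> where \<epsilon>: "\<epsilon> > 0" "cball x0 \<epsilon> \<subseteq> W"
    using assms open_contains_cball by blast
  define \<beta> where "\<beta> x = inverse (flat_exp 0 (\<epsilon>\<^sup>2)) * flat_exp 0 (\<epsilon>\<^sup>2 - (x - x0) \<bullet> (x - x0))" for x
  have "smooth_on UNIV (\<lambda>x. flat_exp 0 (\<epsilon>\<^sup>2 - (x - x0) \<bullet> (x - x0)))"
    by (rule smooth_on_compose[OF _ _ _ smooth_on_flat_exp, where f="\<lambda>x. \<epsilon>\<^sup>2 - (x - x0) \<bullet> (x - x0)"])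
       (auto intro!: smooth_on_diff smooth_on_inner)
  then have "smooth_on UNIV \<beta>"
    unfolding \<beta>_def by (intro smooth_on_mult) simp_all
  moreover have "\<beta> x0 = 1"
    using \<epsilon>(1) by (simp add: \<beta>_def flat_exp_def)
  moreover have "\<beta> x = 0" if "x \<notin> cball x0 \<epsilon>" for x
  proof -
    have "\<epsilon> < norm (x - x0)" using that by (simp add: dist_norm norm_minus_commute)
    then have "\<epsilon>\<^sup>2 \<le> (norm (x - x0))\<^sup>2" using \<epsilon>(1) by (intro power_mono) auto
    then show ?thesis by (simp add: \<beta>_def flat_exp_def power2_norm_eq_inner)
  qed
  ultimately show ?thesis using \<epsilon>(2) by (intro exI[of _ \<beta>] exI[of _ "cball x0 \<epsilon>"]) simp
qed

text \<open>The second difference of \<open>f\<close> along \<open>u\<close> and \<open>v\<close> is, by the mean value theorem applied twice,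
  an intermediate value of either mixed derivative.\<close>

lemma mixed_derivative_mean_value:
  fixes f :: "'a::real_normed_vector \<Rightarrow> real"
  assumes f: "smooth_on S f" and s: "s > 0"
    and S: "\<And>a b. 0 \<le> a \<Longrightarrow> a \<le> s \<Longrightarrow> 0 \<le> b \<Longrightarrow> b \<le> s \<Longrightarrow> x + a *\<^sub>R u + b *\<^sub>R v \<in> S"
  obtains a b where "0 \<le> a" "a \<le> s" "0 \<le> b" "b \<le> s"
    "f (x + s *\<^sub>R u + s *\<^sub>R v) - f (x + s *\<^sub>R u) - f (x + s *\<^sub>R v) + f x =
      s * s * frechet_derivative (\<lambda>y. frechet_derivative f (at y) u) (at (x + a *\<^sub>R u + b *\<^sub>R v)) v"
proof -
  define D where "D y = frechet_derivative f (at y) u" for y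
  have D: "smooth_on S D"
    unfolding D_def by (rule smooth_on_derivative[OF f])
  have df: "((\<lambda>a. f (x + a *\<^sub>R u + b *\<^sub>R v)) has_real_derivative D (x + a *\<^sub>R u + b *\<^sub>R v)) (at a)"
    if "0 \<le> a" "a \<le> s" "0 \<le> b" "b \<le> s" for a b
  proof -
    have "((\<lambda>a. x + a *\<^sub>R u + b *\<^sub>R v) has_derivative (\<lambda>h. h *\<^sub>R u)) (at a)"
      by (auto intro!: derivative_eq_intros)
    from has_derivative_compose[OF this smooth_on_has_derivative[OF f S[OF that]]]
    show ?thesis
      by (simp add: has_field_derivative_def D_def mult.commute
          linear_cmul[OF smooth_on_linear_derivative[OF f S[OF that]]] mult_commute_abs)
  qed
  have dD: "((\<lambda>b. D (x + a *\<^sub>R u + b *\<^sub>R v)) has_real_derivative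
      frechet_derivative D (at (x + a *\<^sub>R u + b *\<^sub>R v)) v) (at b)"
    if "0 \<le> a" "a \<le> s" "0 \<le> b" "b \<le> s" for a b
  proof -
    have "((\<lambda>b. x + a *\<^sub>R u + b *\<^sub>R v) has_derivative (\<lambda>h. h *\<^sub>R v)) (at b)"
      by (auto intro!: derivative_eq_intros)
    from has_derivative_compose[OF this smooth_on_has_derivative[OF D S[OF that]]]
    show ?thesis
      by (simp add: has_field_derivative_def mult.commute
          linear_cmul[OF smooth_on_linear_derivative[OF D S[OF that]]] mult_commute_abs)
  qed
  define \<phi> where "\<phi> a = f (x + a *\<^sub>R u + s *\<^sub>R v) - f (x + a *\<^sub>R u + 0 *\<^sub>R v)" for a
  have "\<exists>a. 0 < a \<and> a < s \<and> \<phi> s - \<phi> 0 =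
      (s - 0) * (D (x + a *\<^sub>R u + s *\<^sub>R v) - D (x + a *\<^sub>R u + 0 *\<^sub>R v))"
    unfolding \<phi>_def by (rule MVT2[OF s]) (intro DERIV_diff df; use s in simp)
  then obtain a where a: "0 < a" "a < s"
    "\<phi> s - \<phi> 0 = s * (D (x + a *\<^sub>R u + s *\<^sub>R v) - D (x + a *\<^sub>R u + 0 *\<^sub>R v))" by auto
  have "\<exists>b. 0 < b \<and> b < s \<and> D (x + a *\<^sub>R u + s *\<^sub>R v) - D (x + a *\<^sub>R u + 0 *\<^sub>R v) =
      (s - 0) * frechet_derivative D (at (x + a *\<^sub>R u + b *\<^sub>R v)) v"
    by (rule MVT2[OF s]) (intro dD; use a s in simp)
  then obtain b where b: "0 < b" "b < s" "D (x + a *\<^sub>R u + s *\<^sub>R v) - D (x + a *\<^sub>R u + 0 *\<^sub>R v) =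
      s * frechet_derivative D (at (x + a *\<^sub>R u + b *\<^sub>R v)) v" by auto
  show thesis
    by (rule that[of a b]) (use a b in \<open>simp_all add: \<phi>_def flip: D_def\<close>)
qed

lemma mixed_derivatives_commute_real:
  fixes f :: "'a::real_normed_vector \<Rightarrow> real"
  assumes S: "open S" and x: "x \<in> S" and f: "smooth_on S f"
  shows "frechet_derivative (\<lambda>y. frechet_derivative f (at y) u) (at x) v
       = frechet_derivative (\<lambda>y. frechet_derivative f (at y) v) (at x) u"
proof -
  define H where "H u v y = frechet_derivative (\<lambda>y. frechet_derivative f (at y) u) (at y) v" for u v y
  have contH: "isCont (H u v) x" for u v
  proof -
    have "smooth_on S (H u v)"
      unfolding H_def by (intro smooth_on_derivative f)
    then show ?thesis
      using smooth_on_imp_continuous_on S x continuous_on_eq_continuous_at by blast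
  qed
  have close: "\<bar>H u v x - H v u x\<bar> < \<epsilon>" if \<epsilon>: "\<epsilon> > 0" for \<epsilon>
  proof -
    obtain d1 where d1: "d1 > 0" "\<And>y. dist y x < d1 \<Longrightarrow> dist (H u v y) (H u v x) < \<epsilon>/2"
      using contH[of u v] \<epsilon> half_gt_zero[OF \<epsilon>] unfolding continuous_at_eps_delta by blast
    obtain d2 where d2: "d2 > 0" "\<And>y. dist y x < d2 \<Longrightarrow> dist (H v u y) (H v u x) < \<epsilon>/2"
      using contH[of v u] \<epsilon> half_gt_zero[OF \<epsilon>] unfolding continuous_at_eps_delta by blast
    obtain d3 where d3: "d3 > 0" "\<And>y. dist y x < d3 \<Longrightarrow> y \<in> S"
      using S x unfolding open_dist by blast
    define d where "d = min d1 (min d2 d3)"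
    define N where "N = norm u + norm v + 1"
    define s where "s = d / (2 * N)"
    have d: "d > 0" using d1 d2 d3 by (simp add: d_def)
    have n: "0 < N" by (simp add: N_def add_nonneg_pos)
    have s: "s > 0" unfolding s_def using d n by simp
    have near: "dist (x + a *\<^sub>R u + b *\<^sub>R v) x < d"
      if "0 \<le> a" "a \<le> s" "0 \<le> b" "b \<le> s" for a b
    proof -
      have "norm (a *\<^sub>R u + b *\<^sub>R v) \<le> a * norm u + b * norm v"
        using that norm_triangle_ineq[of "a *\<^sub>R u" "b *\<^sub>R v"] by simp
      also have "\<dots> \<le> s * norm u + s * norm v"
        using that by (intro add_mono mult_right_mono) auto
      also have "\<dots> \<le> s * N"
        using s by (simp add: N_def algebra_simps)
      also have "\<dots> = d / 2" using n by (simp add: s_def)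
      also have "\<dots> < d" using d by simp
      finally show ?thesis by (simp add: dist_norm add.assoc)
    qed
    have near': "dist (x + a *\<^sub>R v + b *\<^sub>R u) x < d"
      if "0 \<le> a" "a \<le> s" "0 \<le> b" "b \<le> s" for a b
      using near[of b a] that by (simp add: add.commute add.left_commute)
    have inS: "x + a *\<^sub>R u + b *\<^sub>R v \<in> S" "x + a *\<^sub>R v + b *\<^sub>R u \<in> S"
      if "0 \<le> a" "a \<le> s" "0 \<le> b" "b \<le> s" for a b
      using near[OF that] near'[OF that] d3(2) by (simp_all add: d_def)
    obtain a b where ab: "0 \<le> a" "a \<le> s" "0 \<le> b" "b \<le> s"
      "f (x + s *\<^sub>R u + s *\<^sub>R v) - f (x + s *\<^sub>R u) - f (x + s *\<^sub>R v) + f x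
        = s * s * H u v (x + a *\<^sub>R u + b *\<^sub>R v)"
      unfolding H_def by (rule mixed_derivative_mean_value[OF f s inS(1)])
    obtain a' b' where ab': "0 \<le> a'" "a' \<le> s" "0 \<le> b'" "b' \<le> s"
      "f (x + s *\<^sub>R v + s *\<^sub>R u) - f (x + s *\<^sub>R v) - f (x + s *\<^sub>R u) + f x
        = s * s * H v u (x + a' *\<^sub>R v + b' *\<^sub>R u)"
      unfolding H_def by (rule mixed_derivative_mean_value[OF f s inS(2)])
    have "f (x + s *\<^sub>R v + s *\<^sub>R u) = f (x + s *\<^sub>R u + s *\<^sub>R v)"
      by (simp add: add.commute add.left_commute)
    then have "s * s * H u v (x + a *\<^sub>R u + b *\<^sub>R v) = s * s * H v u (x + a' *\<^sub>R v + b' *\<^sub>R u)"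
      using ab(5) ab'(5) by linarith
    then have "H u v (x + a *\<^sub>R u + b *\<^sub>R v) = H v u (x + a' *\<^sub>R v + b' *\<^sub>R u)"
      using s by simp
    moreover have "dist (H u v (x + a *\<^sub>R u + b *\<^sub>R v)) (H u v x) < \<epsilon>/2"
      by (rule d1(2)) (use near[of a b] ab d_def in linarith)
    moreover have "dist (H v u (x + a' *\<^sub>R v + b' *\<^sub>R u)) (H v u x) < \<epsilon>/2"
      by (rule d2(2)) (use near'[of a' b'] ab' d_def in linarith)
    ultimately show ?thesis unfolding dist_real_def by linarith
  qed
  have "H u v x = H v u x"
    using close[of "\<bar>H u v x - H v u x\<bar>"] by force
  then show ?thesis by (simp add: H_def)
qed

lemma mixed_derivatives_commute:
  fixes f :: "'a::real_normed_vector \<Rightarrow> 'b::euclidean_space"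
  assumes S: "open S" and x: "x \<in> S" and f: "smooth_on S f"
  shows "frechet_derivative (\<lambda>y. frechet_derivative f (at y) u) (at x) v
       = frechet_derivative (\<lambda>y. frechet_derivative f (at y) v) (at x) u"
proof (rule euclidean_eqI)
  fix b :: 'b assume "b \<in> Basis"
  have comp: "frechet_derivative (\<lambda>y. h y \<bullet> b) (at y) w = frechet_derivative h (at y) w \<bullet> b"
    if "smooth_on S h" "y \<in> S" for h :: "'a \<Rightarrow> 'b" and y w
    using frechet_derivative_at[OF bounded_linear.has_derivative[OF bounded_linear_inner_left
          smooth_on_has_derivative[OF that]]] by metis
  have twice: "frechet_derivative (\<lambda>y. frechet_derivative (\<lambda>y. f y \<bullet> b) (at y) u) (at x) v
      = frechet_derivative (\<lambda>y. frechet_derivative f (at y) u) (at x) v \<bullet> b" for u v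
  proof -
    have fb: "smooth_on S (\<lambda>y. f y \<bullet> b)"
      by (rule smooth_on_bounded_linear_compose[OF S bounded_linear_inner_left f])
    have "frechet_derivative (\<lambda>y. frechet_derivative (\<lambda>y. f y \<bullet> b) (at y) u) (at x)
        = frechet_derivative (\<lambda>y. frechet_derivative f (at y) u \<bullet> b) (at x)"
      by (rule frechet_derivative_transform_within_open[OF _ S x])
         (simp_all add: comp[OF f] smooth_on_imp_differentiable[OF smooth_on_derivative[OF fb] x])
    then show ?thesis by (simp add: comp[OF smooth_on_derivative[OF f] x])
  qed
  show "frechet_derivative (\<lambda>y. frechet_derivative f (at y) u) (at x) v \<bullet> b
      = frechet_derivative (\<lambda>y. frechet_derivative f (at y) v) (at x) u \<bullet> b"
    unfolding twice[symmetric]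
    by (intro mixed_derivatives_commute_real[OF S x] smooth_on_bounded_linear_compose[OF S
        bounded_linear_inner_left f])
qed

section \<open>Tangent vectors and vector fields in charts\<close>

lemma smooth_fun_chart:
  "smooth_fun M U h \<Longrightarrow> c \<in> atlas M \<Longrightarrow> smooth_on (cmap c ` (cdom c \<inter> U)) (\<lambda>x. h (cinv c x))"
  by (simp add: smooth_fun_def o_def)

lemma vector_field_chart:
  "vector_field M U X \<Longrightarrow> c \<in> atlas M \<Longrightarrow> smooth_on (cmap c ` (cdom c \<inter> U)) (\<lambda>x. X (cinv c x) c)"
  by (simp add: vector_field_def)

lemma vector_field_tangent: "vector_field M U X \<Longrightarrow> p \<in> U \<Longrightarrow> X p \<in> tangent_space M p"
  by (simp add: vector_field_def)

lemma vector_field_subset: "vector_field M U X \<Longrightarrow> V \<subseteq> U \<Longrightarrow> vector_field M V X"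
  unfolding vector_field_def
  by (auto intro!: smooth_on_subset[of "cmap _ ` (cdom _ \<inter> U)" _ "cmap _ ` (cdom _ \<inter> V)"])

definition trans_deriv :: "('a, 'e::euclidean_space) chart \<Rightarrow> ('a, 'e) chart \<Rightarrow> 'a \<Rightarrow> 'e \<Rightarrow> 'e" where
  "trans_deriv c d p = frechet_derivative (cmap d \<circ> cinv c) (at (cmap c p))"

definition tvec :: "('a, 'e::euclidean_space) manifold \<Rightarrow> ('a, 'e) chart \<Rightarrow> 'a \<Rightarrow> 'e \<Rightarrow> ('a, 'e) tangent" where
  "tvec M c p u = (\<lambda>d. if d \<in> charts_at M p then trans_deriv c d p u else 0)"

definition chart_field ::
  "('a, 'e::euclidean_space) manifold \<Rightarrow> ('a, 'e) chart \<Rightarrow> ('e \<Rightarrow> 'e) \<Rightarrow> ('a, 'e) vfield" where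
  "chart_field M c V = (\<lambda>p. tvec M c p (V (cmap c p)))"

locale charted =
  fixes M :: "('a, 'e::euclidean_space) manifold"
  assumes cover: "mpoints M = (\<Union>c\<in>atlas M. cdom c)"
    and openin_cdom: "c \<in> atlas M \<Longrightarrow> openin (mtop M) (cdom c)"
    and open_image: "c \<in> atlas M \<Longrightarrow> open (cmap c ` cdom c)"
    and homeo: "c \<in> atlas M \<Longrightarrow>
      homeomorphic_map (subtopology (mtop M) (cdom c)) (top_of_set (cmap c ` cdom c)) (cmap c)"
    and transition: "c \<in> atlas M \<Longrightarrow> d \<in> atlas M \<Longrightarrow>
      smooth_on (cmap c ` (cdom c \<inter> cdom d)) (cmap d \<circ> cinv c)"

lemma smooth_manifold_imp_charted: "smooth_manifold M \<Longrightarrow> charted M"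
  by (simp add: smooth_manifold_def charted_def)

context charted
begin

lemma charts_atD:
  assumes "c \<in> charts_at M p"
  shows "c \<in> atlas M" "p \<in> cdom c"
  using assms by (simp_all add: charts_at_def)

lemma charts_at_exists: "p \<in> mpoints M \<Longrightarrow> \<exists>c. c \<in> charts_at M p"
  unfolding charts_at_def using cover by auto

lemma cdom_subset: "c \<in> atlas M \<Longrightarrow> cdom c \<subseteq> mpoints M"
  using cover by auto

lemma topspace_cdom: "c \<in> atlas M \<Longrightarrow> topspace (subtopology (mtop M) (cdom c)) = cdom c"
  using cdom_subset by auto

lemma inj_on_cmap: "c \<in> atlas M \<Longrightarrow> inj_on (cmap c) (cdom c)"
  using homeomorphic_imp_injective_map[OF homeo] topspace_cdom by simp

lemma cinv_cmap: "c \<in> atlas M \<Longrightarrow> p \<in> cdom c \<Longrightarrow> cinv c (cmap c p) = p"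
  by (simp add: cinv_def inv_into_f_f inj_on_cmap)

lemma cinv_image:
  assumes "c \<in> atlas M" "x \<in> cmap c ` (cdom c \<inter> U)"
  shows "cinv c x \<in> cdom c" "cinv c x \<in> U" "cmap c (cinv c x) = x"
  using assms cinv_cmap by auto

lemma open_cmap_image:
  assumes "c \<in> atlas M" "openin (mtop M) U"
  shows "open (cmap c ` (cdom c \<inter> U))"
proof -
  have "openin (subtopology (mtop M) (cdom c)) (cdom c \<inter> U)"
    using assms by (simp add: openin_cdom openin_open_subtopology openin_Int)
  then have "openin (top_of_set (cmap c ` cdom c)) (cmap c ` (cdom c \<inter> U))"
    using homeomorphic_imp_open_map[OF homeo[OF assms(1)]] by (simp add: open_map_def)
  then show ?thesis using open_image[OF assms(1)] openin_open_trans by blast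
qed

lemma openin_cmap_vimage:
  assumes "c \<in> atlas M" "open V"
  shows "openin (mtop M) {p \<in> cdom c. cmap c p \<in> V}"
proof -
  have "continuous_map (subtopology (mtop M) (cdom c)) (top_of_set (cmap c ` cdom c)) (cmap c)"
    by (rule homeomorphic_imp_continuous_map[OF homeo[OF assms(1)]])
  then have "openin (subtopology (mtop M) (cdom c))
      {p \<in> topspace (subtopology (mtop M) (cdom c)). cmap c p \<in> (cmap c ` cdom c) \<inter> V}"
    using assms(2) by (intro openin_continuous_map_preimage) (auto intro: openin_open_Int)
  moreover have "{p \<in> topspace (subtopology (mtop M) (cdom c)). cmap c p \<in> (cmap c ` cdom c) \<inter> V}
      = {p \<in> cdom c. cmap c p \<in> V}"
    unfolding topspace_cdom[OF assms(1)] by auto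
  ultimately show ?thesis
    using openin_trans_full[OF _ openin_cdom[OF assms(1)]] by simp
qed

lemma open_overlap:
  "c \<in> atlas M \<Longrightarrow> d \<in> atlas M \<Longrightarrow> open (cmap c ` (cdom c \<inter> cdom d))"
  by (simp add: open_cmap_image openin_cdom)

lemma trans_has_derivative:
  assumes "c \<in> charts_at M p" "d \<in> charts_at M p"
  shows "((cmap d \<circ> cinv c) has_derivative trans_deriv c d p) (at (cmap c p))"
  unfolding trans_deriv_def
  by (rule smooth_on_has_derivative[OF transition]) (use assms in \<open>auto simp: charts_at_def\<close>)

lemma trans_linear:
  "c \<in> charts_at M p \<Longrightarrow> d \<in> charts_at M p \<Longrightarrow> linear (trans_deriv c d p)"
  using trans_has_derivative has_derivative_linear by blast

lemma trans_deriv_same: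
  assumes "c \<in> charts_at M p"
  shows "trans_deriv c c p u = u"
proof -
  have c: "c \<in> atlas M" "p \<in> cdom c" using assms by (rule charts_atD)+
  have "((cmap c \<circ> cinv c) has_derivative (\<lambda>u. u)) (at (cmap c p))"
    by (rule has_derivative_transform_within_open[OF has_derivative_ident open_image[OF c(1)]])
       (use c cinv_cmap in auto)
  from has_derivative_unique[OF this trans_has_derivative[OF assms assms]]
  show ?thesis by metis
qed

lemma trans_deriv_trans:
  assumes "c \<in> charts_at M p" "d \<in> charts_at M p" "e \<in> charts_at M p"
  shows "trans_deriv d e p (trans_deriv c d p u) = trans_deriv c e p u"
proof -
  have c: "c \<in> atlas M" "p \<in> cdom c" and d: "d \<in> atlas M" "p \<in> cdom d"
    using assms charts_atD by blast+
  have "(cmap d \<circ> cinv c) (cmap c p) = cmap d p" using c cinv_cmap by simp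
  then have "((\<lambda>x. (cmap e \<circ> cinv d) ((cmap d \<circ> cinv c) x)) has_derivative
      (\<lambda>u. trans_deriv d e p (trans_deriv c d p u))) (at (cmap c p))"
    using trans_has_derivative[OF assms(2,3)]
    by (intro has_derivative_compose[OF trans_has_derivative[OF assms(1,2)]]) (simp only:)
  then have "((cmap e \<circ> cinv c) has_derivative
      (\<lambda>u. trans_deriv d e p (trans_deriv c d p u))) (at (cmap c p))"
    by (rule has_derivative_transform_within_open[OF _ open_overlap[OF c(1) d(1)]])
       (use c d in \<open>auto simp: cinv_cmap\<close>)
  from has_derivative_unique[OF this trans_has_derivative[OF assms(1,3)]]
  show ?thesis by metis
qed

lemma tangent_trans:
  assumes "\<xi> \<in> tangent_space M p" "c \<in> charts_at M p" "d \<in> charts_at M p"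
  shows "\<xi> d = trans_deriv c d p (\<xi> c)"
  using bspec[OF bspec[OF conjunct1[OF assms(1)[unfolded tangent_space_def mem_Collect_eq]] assms(2)] assms(3)]
  unfolding trans_deriv_def .

lemma tangent_outside:
  assumes "\<xi> \<in> tangent_space M p" "c \<notin> charts_at M p"
  shows "\<xi> c = 0"
  using mp[OF spec[OF conjunct2[OF assms(1)[unfolded tangent_space_def mem_Collect_eq]]] assms(2)] .

lemma tangent_eqI:
  assumes "\<xi> \<in> tangent_space M p" "\<eta> \<in> tangent_space M p" "c \<in> charts_at M p" "\<xi> c = \<eta> c"
  shows "\<xi> = \<eta>"
proof
  fix d
  show "\<xi> d = \<eta> d"
  proof (cases "d \<in> charts_at M p")
    case True
    show ?thesis
      unfolding tangent_trans[OF assms(1,3) True] tangent_trans[OF assms(2,3) True] assms(4) ..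
  next
    case False
    show ?thesis unfolding tangent_outside[OF assms(1) False] tangent_outside[OF assms(2) False] ..
  qed
qed

lemma tangent_spaceI:
  assumes "\<And>c d. c \<in> charts_at M p \<Longrightarrow> d \<in> charts_at M p \<Longrightarrow> \<xi> d = trans_deriv c d p (\<xi> c)"
    and "\<And>c. c \<notin> charts_at M p \<Longrightarrow> \<xi> c = 0"
  shows "\<xi> \<in> tangent_space M p"
  unfolding tangent_space_def mem_Collect_eq trans_deriv_def[symmetric]
proof (intro conjI ballI allI impI)
  show "\<xi> d = trans_deriv c d p (\<xi> c)" if "c \<in> charts_at M p" "d \<in> charts_at M p" for c d
    using that by (rule assms(1))
  show "\<xi> c = 0" if "c \<notin> charts_at M p" for c
    using that by (rule assms(2))
qed

lemma tangent_lincomb: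
  assumes "\<xi> \<in> tangent_space M p" "\<eta> \<in> tangent_space M p"
  shows "(\<lambda>c. a *\<^sub>R \<xi> c + b *\<^sub>R \<eta> c) \<in> tangent_space M p"
proof (rule tangent_spaceI)
  fix c d assume cd: "c \<in> charts_at M p" "d \<in> charts_at M p"
  show "a *\<^sub>R \<xi> d + b *\<^sub>R \<eta> d = trans_deriv c d p (a *\<^sub>R \<xi> c + b *\<^sub>R \<eta> c)"
    unfolding linear_add[OF trans_linear[OF cd]] linear_cmul[OF trans_linear[OF cd]]
    by (simp only: tangent_trans[OF assms(1) cd] tangent_trans[OF assms(2) cd])
next
  fix c assume "c \<notin> charts_at M p"
  then show "a *\<^sub>R \<xi> c + b *\<^sub>R \<eta> c = 0"
    using tangent_outside[OF assms(1)] tangent_outside[OF assms(2)] by simp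
qed

lemma tvec_tangent:
  assumes "c \<in> charts_at M p"
  shows "tvec M c p u \<in> tangent_space M p"
  by (rule tangent_spaceI) (simp_all add: tvec_def trans_deriv_trans assms)

lemma tvec_same: "c \<in> charts_at M p \<Longrightarrow> tvec M c p u c = u"
  by (simp add: tvec_def trans_deriv_same)

lemma tvec_component:
  assumes "\<xi> \<in> tangent_space M p" "c \<in> charts_at M p"
  shows "tvec M c p (\<xi> c) = \<xi>"
  by (rule tangent_eqI[OF tvec_tangent[OF assms(2)] assms tvec_same[OF assms(2)]])

lemma tvec_lincomb:
  assumes "c \<in> charts_at M p"
  shows "tvec M c p (a *\<^sub>R u + b *\<^sub>R v) = (\<lambda>d. a *\<^sub>R tvec M c p u d + b *\<^sub>R tvec M c p v d)"
  using tangent_eqI[OF tvec_tangent[OF assms] tangent_lincomb[OF tvec_tangent[OF assms] tvec_tangent[OF assms]] assms]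
  by (simp add: tvec_same[OF assms])

lemma has_derivative_change_chart:
  assumes "c \<in> charts_at M p" "d \<in> charts_at M p"
    and h: "(h \<circ> cinv c has_derivative h') (at (cmap c p))"
  shows "(h \<circ> cinv d has_derivative (\<lambda>u. h' (trans_deriv d c p u))) (at (cmap d p))"
proof -
  have c: "c \<in> atlas M" "p \<in> cdom c" and d: "d \<in> atlas M" "p \<in> cdom d"
    using assms charts_atD by blast+
  have "(cmap c \<circ> cinv d) (cmap d p) = cmap c p" using d cinv_cmap by simp
  then have "((\<lambda>x. (h \<circ> cinv c) ((cmap c \<circ> cinv d) x)) has_derivative
      (\<lambda>u. h' (trans_deriv d c p u))) (at (cmap d p))"
    using h by (intro has_derivative_compose[OF trans_has_derivative[OF assms(2,1)]]) (simp only:)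
  then show ?thesis
    by (rule has_derivative_transform_within_open[OF _ open_overlap[OF d(1) c(1)]])
       (use c d in \<open>auto simp: cinv_cmap\<close>)
qed

lemma tangent_deriv_chart:
  assumes "c \<in> charts_at M p" "\<xi> \<in> tangent_space M p"
    and h: "(h \<circ> cinv c has_derivative h') (at (cmap c p))"
  shows "tangent_deriv M p \<xi> h = h' (\<xi> c)"
proof -
  define d where "d = (SOME c. c \<in> charts_at M p)"
  have d: "d \<in> charts_at M p" unfolding d_def using assms(1) by (rule someI)
  have "tangent_deriv M p \<xi> h = frechet_derivative (h \<circ> cinv d) (at (cmap d p)) (\<xi> d)"
    by (simp only: tangent_deriv_def Let_def d_def)
  also have "\<dots> = h' (trans_deriv d c p (\<xi> d))"
    unfolding frechet_derivative_at[OF has_derivative_change_chart[OF assms(1) d h], symmetric] ..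
  also have "\<dots> = h' (\<xi> c)"
    unfolding tangent_trans[OF assms(2) d assms(1)] ..
  finally show ?thesis .
qed

lemma vector_field_chart_field:
  assumes c: "c \<in> atlas M" and U: "openin (mtop M) U" "U \<subseteq> cdom c"
    and V: "smooth_on (cmap c ` U) V"
  shows "vector_field M U (chart_field M c V)"
  unfolding vector_field_def
proof (intro conjI ballI)
  show "chart_field M c V p \<in> tangent_space M p" if "p \<in> U" for p
    unfolding chart_field_def using that c U by (intro tvec_tangent) (auto simp: charts_at_def)
  fix d assume d: "d \<in> atlas M"
  have o: "open (cmap c ` (U \<inter> cdom d))"
    using open_cmap_image[OF c, of "U \<inter> cdom d"] U d
    by (simp add: openin_Int openin_cdom Int_absorb1 flip: Int_assoc)
  have o': "open (cmap d ` (cdom d \<inter> U))" by (rule open_cmap_image[OF d U(1)])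
  have g: "smooth_on (cmap c ` (U \<inter> cdom d)) (\<lambda>y. frechet_derivative (cmap d \<circ> cinv c) (at y) (V y))"
    by (rule smooth_on_derivative_along[OF o])
       (use U(2) in \<open>auto intro: smooth_on_subset[OF transition[OF c d]] smooth_on_subset[OF V]\<close>)
  have "smooth_on (cmap d ` (cdom d \<inter> U))
      (\<lambda>x. frechet_derivative (cmap d \<circ> cinv c) (at ((cmap c \<circ> cinv d) x)) (V ((cmap c \<circ> cinv d) x)))"
  proof (rule smooth_on_compose[OF o' _ _ g])
    show "(cmap c \<circ> cinv d) ` cmap d ` (cdom d \<inter> U) \<subseteq> cmap c ` (U \<inter> cdom d)"
      using cinv_cmap[OF d] by auto
    show "smooth_on (cmap d ` (cdom d \<inter> U)) (cmap c \<circ> cinv d)"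
      by (rule smooth_on_subset[OF transition[OF d c]]) (use U(2) in auto)
  qed
  moreover have "chart_field M c V (cinv d x) d =
      frechet_derivative (cmap d \<circ> cinv c) (at ((cmap c \<circ> cinv d) x)) (V ((cmap c \<circ> cinv d) x))"
    if "x \<in> cmap d ` (cdom d \<inter> U)" for x
    using cinv_image[OF d that] d U(2)
    by (auto simp: chart_field_def tvec_def trans_deriv_def charts_at_def)
  ultimately show "smooth_on (cmap d ` (cdom d \<inter> U)) (\<lambda>x. chart_field M c V (cinv d x) d)"
    by (subst smooth_on_cong[OF o'])
qed

lemma chart_field_same: "c \<in> charts_at M p \<Longrightarrow> chart_field M c V p c = V (cmap c p)"
  by (simp add: chart_field_def tvec_same)

lemma chart_field_representation:
  assumes "vector_field M U X" "p \<in> U" "c \<in> charts_at M p"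
  shows "chart_field M c (\<lambda>x. X (cinv c x) c) p = X p"
  using assms charts_atD[OF assms(3)]
  by (simp add: chart_field_def cinv_cmap tvec_component vector_field_tangent)

lemma vector_field_cong:
  assumes "openin (mtop M) U" "vector_field M U X" "\<And>p. p \<in> U \<Longrightarrow> Y p = X p"
  shows "vector_field M U Y"
  unfolding vector_field_def
proof (intro conjI ballI)
  show "Y p \<in> tangent_space M p" if "p \<in> U" for p
    unfolding assms(3)[OF that] by (rule vector_field_tangent[OF assms(2) that])
  show "smooth_on (cmap c ` (cdom c \<inter> U)) (\<lambda>x. Y (cinv c x) c)" if c: "c \<in> atlas M" for c
  proof (subst smooth_on_cong[OF open_cmap_image[OF c assms(1)]])
    show "Y (cinv c x) c = X (cinv c x) c" if "x \<in> cmap c ` (cdom c \<inter> U)" for x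
      using assms(3)[OF cinv_image(2)[OF c that]] by simp
    show "smooth_on (cmap c ` (cdom c \<inter> U)) (\<lambda>x. X (cinv c x) c)"
      by (rule vector_field_chart[OF assms(2) c])
  qed
qed

lemma vector_field_local:
  assumes "\<And>p. p \<in> U \<Longrightarrow> \<exists>V. openin (mtop M) V \<and> p \<in> V \<and> vector_field M V X"
  shows "vector_field M U X"
  unfolding vector_field_def
proof (intro conjI ballI)
  fix p assume "p \<in> U"
  from assms[OF this] obtain V where "p \<in> V" "vector_field M V X" by (elim exE conjE)
  then show "X p \<in> tangent_space M p" by (intro vector_field_tangent)
next
  fix c assume c: "c \<in> atlas M"
  show "smooth_on (cmap c ` (cdom c \<inter> U)) (\<lambda>x. X (cinv c x) c)"
  proof (rule smooth_on_local)
    fix x assume "x \<in> cmap c ` (cdom c \<inter> U)"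
    then obtain p where p: "p \<in> cdom c" "p \<in> U" "x = cmap c p" by auto
    obtain V where V: "openin (mtop M) V" "p \<in> V" "vector_field M V X"
      using assms[OF p(2)] by (elim exE conjE)
    show "\<exists>T. open T \<and> x \<in> T \<and> smooth_on T (\<lambda>x. X (cinv c x) c)"
      using p V(2)
      by (intro exI[of _ "cmap c ` (cdom c \<inter> V)"] conjI open_cmap_image[OF c V(1)]
          vector_field_chart[OF V(3) c]) simp
  qed
qed

lemma vector_field_add:
  assumes "openin (mtop M) U" "vector_field M U X" "vector_field M U Y"
  shows "vector_field M U (vf_add X Y)"
  unfolding vector_field_def
proof (intro conjI ballI)
  show "vf_add X Y p \<in> tangent_space M p" if "p \<in> U" for p
    using tangent_lincomb[of "X p" p "Y p" 1 1] assms that by (simp add: vf_add_def vector_field_tangent)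
  show "smooth_on (cmap c ` (cdom c \<inter> U)) (\<lambda>x. vf_add X Y (cinv c x) c)" if c: "c \<in> atlas M" for c
    unfolding vf_add_def
    by (rule smooth_on_add[OF open_cmap_image[OF c assms(1)] vector_field_chart[OF assms(2) c]
          vector_field_chart[OF assms(3) c]])
qed

lemma vector_field_scale:
  assumes "openin (mtop M) U" "smooth_fun M U h" "vector_field M U X"
  shows "vector_field M U (vf_scale h X)"
  unfolding vector_field_def
proof (intro conjI ballI)
  show "vf_scale h X p \<in> tangent_space M p" if "p \<in> U" for p
    using tangent_lincomb[of "X p" p "X p" "h p" 0] assms that
    by (simp add: vf_scale_def vector_field_tangent)
  show "smooth_on (cmap c ` (cdom c \<inter> U)) (\<lambda>x. vf_scale h X (cinv c x) c)" if c: "c \<in> atlas M" for c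
    unfolding vf_scale_def
    by (rule smooth_on_scaleR[OF open_cmap_image[OF c assms(1)] smooth_fun_chart[OF assms(2) c]
          vector_field_chart[OF assms(3) c]])
qed

lemma vector_field_diff:
  assumes "openin (mtop M) U" "vector_field M U X" "vector_field M U Y"
  shows "vector_field M U (vf_diff X Y)"
proof -
  have "vf_diff X Y = vf_add X (vf_scale (\<lambda>p. -1) Y)"
    by (simp add: vf_diff_def vf_add_def vf_scale_def)
  moreover have "smooth_fun M U (\<lambda>p. -1)" by (simp add: smooth_fun_def o_def)
  ultimately show ?thesis
    using assms by (simp add: vector_field_add vector_field_scale)
qed

lemma global_vector_field_exists:
  assumes "Hausdorff_space (mtop M)" "p \<in> mpoints M" "\<xi> \<in> tangent_space M p"
  obtains X where "vector_field M (mpoints M) X" "X p = \<xi>"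
proof -
  obtain c where c: "c \<in> charts_at M p" using charts_at_exists[OF assms(2)] by blast
  note c' = charts_atD[OF c]
  obtain \<beta> :: "'e \<Rightarrow> real" and K where \<beta>: "smooth_on UNIV \<beta>" "\<beta> (cmap c p) = 1" "compact K"
      "K \<subseteq> cmap c ` cdom c" "\<forall>x. x \<notin> K \<longrightarrow> \<beta> x = 0"
    using exists_smooth_bump[OF open_image[OF c'(1)] imageI[OF c'(2)]] by (elim exE conjE) simp
  define L where "L = {q \<in> cdom c. cmap c q \<in> K}"
  have "L \<subseteq> cdom c" "cmap c ` L = K" using \<beta>(4) by (auto simp: L_def)
  then have "compactin (subtopology (mtop M) (cdom c)) L"
    using homeomorphic_map_compactness[OF homeo[OF c'(1)], of L] \<beta>(3,4)
    unfolding topspace_cdom[OF c'(1)] by (simp add: compactin_subtopology)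
  then have "compactin (mtop M) L" by (simp add: compactin_subtopology)
  then have L: "openin (mtop M) (mpoints M - L)"
    using compactin_imp_closedin[OF assms(1)] by blast
  define X where "X q = (if q \<in> cdom c then chart_field M c (\<lambda>x. \<beta> x *\<^sub>R \<xi> c) q else (\<lambda>c. 0))" for q
  have "vector_field M (mpoints M) X"
  proof (rule vector_field_local)
    fix q assume q: "q \<in> mpoints M"
    show "\<exists>V. openin (mtop M) V \<and> q \<in> V \<and> vector_field M V X"
    proof (cases "q \<in> cdom c")
      case True
      have "smooth_on (cmap c ` cdom c) (\<lambda>x. \<beta> x *\<^sub>R \<xi> c)"
        by (rule smooth_on_scaleR[OF open_image[OF c'(1)] smooth_on_subset[OF \<beta>(1)] smooth_on_const]) simp
      then have "vector_field M (cdom c) (chart_field M c (\<lambda>x. \<beta> x *\<^sub>R \<xi> c))"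
        by (rule vector_field_chart_field[OF c'(1) openin_cdom[OF c'(1)] subset_refl])
      then have "vector_field M (cdom c) X"
        by (rule vector_field_cong[OF openin_cdom[OF c'(1)]]) (simp add: X_def)
      then show ?thesis using True openin_cdom[OF c'(1)] by blast
    next
      case False
      have X0: "X r = (\<lambda>c. 0)" if "r \<in> mpoints M - L" for r
      proof (cases "r \<in> cdom c")
        case True
        then have "\<beta> (cmap c r) = 0" using that \<beta>(5) by (auto simp: L_def)
        moreover have "tvec M c r 0 = (\<lambda>c. 0)"
          using tvec_lincomb[of c r 0 0 0 0] True c' by (simp add: charts_at_def)
        ultimately show ?thesis using True by (simp add: X_def chart_field_def)
      qed (simp add: X_def)
      have "vector_field M (mpoints M - L) X"
        unfolding vector_field_def
      proof (intro conjI ballI)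
        show "X r \<in> tangent_space M r" if r: "r \<in> mpoints M - L" for r
          unfolding X0[OF r] by (rule tangent_spaceI) (rule linear_0[OF trans_linear, symmetric], auto)
        show "smooth_on (cmap d ` (cdom d \<inter> (mpoints M - L))) (\<lambda>x. X (cinv d x) d)"
          if d: "d \<in> atlas M" for d
        proof (subst smooth_on_cong[OF open_cmap_image[OF d L]])
          show "X (cinv d x) d = 0" if "x \<in> cmap d ` (cdom d \<inter> (mpoints M - L))" for x
            unfolding X0[OF cinv_image(2)[OF d that]] ..
        qed (rule smooth_on_const)
      qed
      moreover have "q \<in> mpoints M - L" using False q by (simp add: L_def)
      ultimately show ?thesis using L by blast
    qed
  qed
  moreover have "X p = \<xi>"
    using c' c assms(3) by (simp add: X_def chart_field_def \<beta>(2) tvec_component)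
  ultimately show thesis by (rule that)
qed

end

section \<open>Orthonormal frames and traces\<close>

lemma has_derivative_linear_family:
  fixes B :: "'a::real_normed_vector \<Rightarrow> 'b::euclidean_space \<Rightarrow> 'c::real_normed_vector"
  assumes S: "open S" "x0 \<in> S" and lin: "\<And>x. x \<in> S \<Longrightarrow> linear (B x)"
    and B': "\<And>u. ((\<lambda>x. B x u) has_derivative B' u) (at x0)"
    and W: "(W has_derivative W') (at x0)"
  shows "((\<lambda>x. B x (W x)) has_derivative (\<lambda>h. B' (W x0) h + B x0 (W' h))) (at x0)"
proof -
  have expand: "((\<lambda>x. \<Sum>b\<in>Basis. (V x \<bullet> b) *\<^sub>R B x b) has_derivative
      (\<lambda>h. \<Sum>b\<in>Basis. (V x0 \<bullet> b) *\<^sub>R B' b h + (V' h \<bullet> b) *\<^sub>R B x0 b)) (at x0)"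
    if "(V has_derivative V') (at x0)" for V V'
    by (rule has_derivative_sum)
       (rule has_derivative_scaleR[OF has_derivative_inner_left[OF that] B'])
  have const: "B' u h = (\<Sum>b\<in>Basis. (u \<bullet> b) *\<^sub>R B' b h)" for u h
  proof -
    have "((\<lambda>x. B x u) has_derivative (\<lambda>h. \<Sum>b\<in>Basis. (u \<bullet> b) *\<^sub>R B' b h + (0 \<bullet> b) *\<^sub>R B x0 b)) (at x0)"
      by (rule has_derivative_transform_within_open[OF expand[OF has_derivative_const[of u]] S])
         (rule linear_Basis_expand[OF lin, symmetric])
    from fun_cong[OF has_derivative_unique[OF B' this], of h] show ?thesis by simp
  qed
  have "((\<lambda>x. B x (W x)) has_derivative
      (\<lambda>h. \<Sum>b\<in>Basis. (W x0 \<bullet> b) *\<^sub>R B' b h + (W' h \<bullet> b) *\<^sub>R B x0 b)) (at x0)"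
    by (rule has_derivative_transform_within_open[OF expand[OF W] S])
       (rule linear_Basis_expand[OF lin, symmetric])
  moreover have "(\<Sum>b\<in>Basis. (W x0 \<bullet> b) *\<^sub>R B' b h + (W' h \<bullet> b) *\<^sub>R B x0 b)
      = B' (W x0) h + B x0 (W' h)" for h
    unfolding sum.distrib const[of "W x0" h, symmetric]
      linear_Basis_expand[OF lin[OF S(2)], of "W' h", symmetric] ..
  ultimately show ?thesis by simp
qed

lemma has_derivative_bilinear_family:
  fixes B :: "'a::real_normed_vector \<Rightarrow> 'b::euclidean_space \<Rightarrow> 'b \<Rightarrow> 'c::real_normed_vector"
  assumes S: "open S" "x0 \<in> S" and bil: "\<And>x. x \<in> S \<Longrightarrow> bilinear (B x)"
    and B: "\<And>u v. smooth_on S (\<lambda>x. B x u v)"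
    and V: "(V has_derivative V') (at x0)" and W: "(W has_derivative W') (at x0)"
  shows "((\<lambda>x. B x (V x) (W x)) has_derivative
    (\<lambda>h. frechet_derivative (\<lambda>x. B x (V x0) (W x0)) (at x0) h + B x0 (V x0) (W' h)
      + B x0 (V' h) (W x0))) (at x0)"
proof -
  have l: "linear (\<lambda>u. B x u w)" "linear (B x u)" if "x \<in> S" for x u w
    using bil[OF that] unfolding bilinear_def by simp_all
  have 1: "((\<lambda>x. B x u (W x)) has_derivative
      (\<lambda>h. frechet_derivative (\<lambda>x. B x u (W x0)) (at x0) h + B x0 u (W' h))) (at x0)" for u
    by (rule has_derivative_linear_family[OF S l(2) smooth_on_has_derivative[OF B S(2)] W])
  show ?thesis
    by (rule has_derivative_linear_family[OF S l(1) 1 V])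
qed

lemma orthonormal_expansion:
  fixes G :: "'e::euclidean_space \<Rightarrow> 'e \<Rightarrow> real"
  assumes G: "bilinear G"
    and eps: "\<And>k. k < DIM('e) \<Longrightarrow> eps k \<in> {1, -1}"
    and e: "\<And>j k. j < DIM('e) \<Longrightarrow> k < DIM('e) \<Longrightarrow> G (e j) (e k) = (if j = k then eps k else 0)"
  shows "v = (\<Sum>k<DIM('e). (eps k * G v (e k)) *\<^sub>R e k)"
proof -
  let ?n = "DIM('e)"
  have l: "linear (\<lambda>u. G u w)" for w
    using G unfolding bilinear_def by simp
  have coeff: "G (\<Sum>k<?n. a k *\<^sub>R e k) (e j) = a j * eps j" if j: "j < ?n" for a j
  proof -
    have "G (\<Sum>k<?n. a k *\<^sub>R e k) (e j) = (\<Sum>k<?n. a k * G (e k) (e j))"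
      by (simp add: linear_sum[OF l] linear_cmul[OF l])
    also have "\<dots> = (\<Sum>k<?n. if k = j then a j * eps j else 0)"
      by (rule sum.cong) (use j in \<open>auto simp: e\<close>)
    finally show ?thesis using j by simp
  qed
  have nz: "eps k \<noteq> 0" "eps k * eps k = 1" if "k < ?n" for k
    using eps[OF that] by auto
  have inj: "inj_on e {..<?n}"
  proof (rule inj_onI, rule ccontr)
    fix j k assume "j \<in> {..<?n}" "k \<in> {..<?n}" "e j = e k" "j \<noteq> k"
    then show False using e[of j k] e[of k k] nz(1)[of k] by simp
  qed
  have "independent (e ` {..<?n})"
  proof
    assume "dependent (e ` {..<?n})"
    then obtain u where u: "\<exists>v\<in>e ` {..<?n}. u v \<noteq> 0" "(\<Sum>v\<in>e ` {..<?n}. u v *\<^sub>R v) = 0"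
      by (subst (asm) dependent_finite) auto
    from u(1) obtain j where j: "j < ?n" "u (e j) \<noteq> 0" by auto
    have "(\<Sum>k<?n. u (e k) *\<^sub>R e k) = 0" using u(2) by (simp add: sum.reindex[OF inj])
    then have "u (e j) * eps j = 0" using coeff[OF j(1), of "\<lambda>k. u (e k)"] linear_0[OF l] by simp
    then show False using j nz by simp
  qed
  then have "UNIV \<subseteq> span (e ` {..<?n})"
    by (intro card_ge_dim_independent) (simp_all add: card_image[OF inj])
  then have "v \<in> span (e ` {..<?n})" by auto
  then obtain u where "v = (\<Sum>w\<in>e ` {..<?n}. u w *\<^sub>R w)"
    by (subst (asm) span_finite) auto
  then have v: "v = (\<Sum>k<?n. u (e k) *\<^sub>R e k)" by (simp add: sum.reindex[OF inj])
  have "eps j * G v (e j) = u (e j)" if "j < ?n" for j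
    using coeff[OF that, of "\<lambda>k. u (e k)"] nz(2)[OF that] unfolding v[symmetric]
    by (simp add: mult.left_commute)
  then have "(\<Sum>k<?n. (eps k * G v (e k)) *\<^sub>R e k) = (\<Sum>k<?n. u (e k) *\<^sub>R e k)" by simp
  then show ?thesis using v by simp
qed

lemma trace_orthonormal:
  fixes G :: "'e::euclidean_space \<Rightarrow> 'e \<Rightarrow> real"
  assumes G: "bilinear G"
    and eps: "\<And>k. k < DIM('e) \<Longrightarrow> eps k \<in> {1, -1}"
    and e: "\<And>j k. j < DIM('e) \<Longrightarrow> k < DIM('e) \<Longrightarrow> G (e j) (e k) = (if j = k then eps k else 0)"
    and L: "linear L"
  shows "(\<Sum>k<DIM('e). eps k * G (L (e k)) (e k)) = (\<Sum>b\<in>Basis. L b \<bullet> b)"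
proof -
  have l: "linear (\<lambda>u. G u w)" for w
    using G unfolding bilinear_def by simp
  have "L b \<bullet> b = (\<Sum>k<DIM('e). eps k * G b (e k) * (L (e k) \<bullet> b))" for b
  proof -
    have "L b = L (\<Sum>k<DIM('e). (eps k * G b (e k)) *\<^sub>R e k)"
      using orthonormal_expansion[OF G eps e, of b] by metis
    then show ?thesis
      by (simp add: linear_sum[OF L] linear_cmul[OF L] inner_sum_left)
  qed
  then have "(\<Sum>b\<in>Basis. L b \<bullet> b)
      = (\<Sum>k<DIM('e). \<Sum>b\<in>Basis. eps k * G b (e k) * (L (e k) \<bullet> b))"
    by (simp add: sum.swap[of _ "{..<DIM('e)}"])
  also have "\<dots> = (\<Sum>k<DIM('e). eps k * G (L (e k)) (e k))"
    by (rule sum.cong[OF refl], subst linear_Basis_expand[OF l])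
       (simp add: sum_distrib_left mult_ac)
  finally show ?thesis by simp
qed

text \<open>Gram--Schmidt for an indefinite form: polarization provides a vector whose component
  orthogonal to the previous ones is not null, as long as these do not span the space.\<close>

lemma exists_local_orthonormal_frame:
  fixes G :: "'e::euclidean_space \<Rightarrow> 'e \<Rightarrow> 'e \<Rightarrow> real"
  assumes W0: "open W0" "x0 \<in> W0" and bil: "\<And>x. x \<in> W0 \<Longrightarrow> bilinear (G x)"
    and sym: "\<And>x u v. x \<in> W0 \<Longrightarrow> G x u v = G x v u"
    and smooth: "\<And>u v. smooth_on W0 (\<lambda>x. G x u v)"
    and nondeg: "\<And>u. (\<And>v. G x0 u v = 0) \<Longrightarrow> u = 0"
  shows "m \<le> DIM('e) \<Longrightarrow> \<exists>W e eps. open W \<and> x0 \<in> W \<and> W \<subseteq> W0 \<and>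
    (\<forall>k<m. smooth_on W (e k) \<and> eps k \<in> {1, -1}) \<and>
    (\<forall>x\<in>W. \<forall>j<m. \<forall>k<m. G x (e j x) (e k x) = (if j = k then eps k else 0))"
proof (induction m)
  case 0
  then show ?case using W0 by auto
next
  case (Suc m)
  then have "m \<le> DIM('e)" by simp
  from Suc.IH[OF this] obtain W e eps where W: "open W" "x0 \<in> W" "W \<subseteq> W0"
    and e_eps: "\<forall>k<m. smooth_on W (e k) \<and> eps k \<in> {1, -1}"
    and G_e: "\<forall>x\<in>W. \<forall>j<m. \<forall>k<m. G x (e j x) (e k x) = (if j = k then eps k else 0)"
    by (elim exE conjE)
  have e: "smooth_on W (e k)" and eps: "eps k \<in> {1, -1}" if "k < m" for k
    using e_eps that by simp_all
  have orth: "G x (e j x) (e k x) = (if j = k then eps k else 0)" if "x \<in> W" "j < m" "k < m" for x j k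
    using G_e that by simp
  have bil': "bilinear (G x)" if "x \<in> W" for x using bil W(3) that by auto
  have l: "linear (\<lambda>u. G x u w)" "linear (G x u)" if "x \<in> W" for x u w
    using bil'[OF that] unfolding bilinear_def by simp_all
  define Q where "Q x v = v - (\<Sum>k<m. (eps k * G x v (e k x)) *\<^sub>R e k x)" for x v
  have perp: "G x (Q x v) (e j x) = 0" if x: "x \<in> W" and j: "j < m" for x v j
  proof -
    have "G x (Q x v) (e j x) = G x v (e j x) - (\<Sum>k<m. eps k * G x v (e k x) * G x (e k x) (e j x))"
      by (simp add: Q_def linear_diff[OF l(1)[OF x]] linear_sum[OF l(1)[OF x]] linear_cmul[OF l(1)[OF x]])
    also have "(\<Sum>k<m. eps k * G x v (e k x) * G x (e k x) (e j x))
        = (\<Sum>k<m. if k = j then eps j * G x v (e j x) * eps j else 0)"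
      by (rule sum.cong) (use x j in \<open>auto simp: orth\<close>)
    finally show ?thesis using j eps[OF j] by auto
  qed
  have Q_add: "Q x (u + v) = Q x u + Q x v" if "x \<in> W" for x u v
    by (simp add: Q_def linear_add[OF l(1)[OF that]] algebra_simps sum.distrib)
  have "\<exists>v. G x0 (Q x0 v) (Q x0 v) \<noteq> 0"
  proof (rule ccontr)
    assume "\<not> ?thesis"
    then have null: "G x0 (Q x0 v) (Q x0 v) = 0" for v by blast
    have polar: "G x0 (Q x0 u) (Q x0 v) = 0" for u v
      using null[of "u + v"] null[of u] null[of v] sym[OF W0(2), of "Q x0 u" "Q x0 v"]
      by (simp add: Q_add[OF W(2)] linear_add[OF l(1)[OF W(2)]] linear_add[OF l(2)[OF W(2)]])
    have "Q x0 u = 0" for u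
    proof (rule nondeg)
      fix v
      define s where "s = (\<Sum>k<m. (eps k * G x0 v (e k x0)) *\<^sub>R e k x0)"
      have "G x0 (Q x0 u) s = (\<Sum>k<m. (eps k * G x0 v (e k x0)) *\<^sub>R G x0 (Q x0 u) (e k x0))"
        unfolding s_def by (simp only: linear_sum[OF l(2)[OF W(2)]] linear_cmul[OF l(2)[OF W(2)]])
      also have "\<dots> = 0"
        by (rule sum.neutral) (simp add: perp[OF W(2)])
      finally have "G x0 (Q x0 u) (Q x0 v + s) = 0"
        by (simp add: linear_add[OF l(2)[OF W(2)]] polar)
      moreover have "Q x0 v + s = v" by (simp add: Q_def s_def)
      ultimately show "G x0 (Q x0 u) v = 0" by simp
    qed
    then have rep: "(\<Sum>k<m. (eps k * G x0 u (e k x0)) *\<^sub>R e k x0) = u" for u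
      by (simp add: Q_def)
    have "(\<Sum>k<m. (eps k * G x0 u (e k x0)) *\<^sub>R e k x0) \<in> span ((\<lambda>k. e k x0) ` {..<m})" for u
      by (intro span_sum span_scale span_base imageI)
    then have "u \<in> span ((\<lambda>k. e k x0) ` {..<m})" for u unfolding rep .
    then have "dim (UNIV :: 'e set) \<le> card ((\<lambda>k. e k x0) ` {..<m})"
      by (intro dim_le_card) auto
    also have "\<dots> \<le> m" using card_image_le[of "{..<m}" "\<lambda>k. e k x0"] by simp
    finally show False using Suc.prems by simp
  qed
  then obtain v where v: "G x0 (Q x0 v) (Q x0 v) \<noteq> 0" by blast
  define q where "q x = G x (Q x v) (Q x v)" for x
  define \<sigma> where "\<sigma> = sgn (q x0)"
  have smoothW: "smooth_on W (\<lambda>x. G x u w)" for u w by (rule smooth_on_subset[OF smooth W(3)])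
  have term_smooth: "smooth_on W (\<lambda>x. (eps k * G x v (e k x)) *\<^sub>R e k x)" if "k < m" for k
  proof -
    have "smooth_on W (\<lambda>x. G x v (e k x))"
      by (rule smooth_on_bilinear_family[OF W(1) bil' smoothW smooth_on_const e[OF that]])
    then show ?thesis
      by (rule smooth_on_scaleR[OF W(1) smooth_on_mult[OF W(1) smooth_on_const] e[OF that]])
  qed
  have Qs: "smooth_on W (\<lambda>x. Q x v)"
    unfolding Q_def
    by (rule smooth_on_diff[OF W(1) smooth_on_const smooth_on_sum[OF W(1) term_smooth]]) simp
  have qs: "smooth_on W q"
    unfolding q_def by (rule smooth_on_bilinear_family[OF W(1) bil' smoothW Qs Qs])
  have \<sigma>: "\<sigma> \<in> {1, -1}" "\<sigma> * q x0 > 0" "\<sigma> * \<sigma> = 1"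
    using v by (auto simp: \<sigma>_def q_def sgn_if)
  define W' where "W' = W \<inter> (\<lambda>x. \<sigma> * q x) -` {0<..}"
  have W': "open W'" "x0 \<in> W'" "W' \<subseteq> W"
  proof -
    show "open W'" unfolding W'_def
      by (intro continuous_open_preimage continuous_on_mult_left smooth_on_imp_continuous_on qs W(1) open_greaterThan)
    show "x0 \<in> W'" using W(2) \<sigma>(2) by (simp add: W'_def)
  qed (auto simp: W'_def)
  have pos: "\<sigma> * q x > 0" if "x \<in> W'" for x using that by (simp add: W'_def)
  define r where "r x = (\<sigma> * q x) powr (-1/2)" for x
  define e' where "e' x = r x *\<^sub>R Q x v" for x
  have "smooth_on W' r"
    unfolding r_def
  proof (rule smooth_on_compose[OF W'(1) _ _ smooth_on_powr, where f="\<lambda>x. \<sigma> * q x"])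
    show "(\<lambda>x. \<sigma> * q x) ` W' \<subseteq> {0<..}" by (simp add: image_subset_iff pos)
    show "smooth_on W' (\<lambda>x. \<sigma> * q x)"
      by (rule smooth_on_mult[OF W'(1) smooth_on_const smooth_on_subset[OF qs W'(3)]])
  qed
  then have e's: "smooth_on W' e'"
    unfolding e'_def by (rule smooth_on_scaleR[OF W'(1) _ smooth_on_subset[OF Qs W'(3)]])
  have e'e': "G x (e' x) (e' x) = \<sigma>" if x: "x \<in> W'" for x
  proof -
    have xW: "x \<in> W" using x W'(3) by auto
    have rr: "r x * r x = inverse (\<sigma> * q x)"
    proof -
      have "y powr (-1/2) * y powr (-1/2) = inverse y" if "y > 0" for y :: real
        unfolding powr_add[symmetric] using that by (simp add: powr_minus)
      from this[OF pos[OF x]] show ?thesis by (simp only: r_def)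
    qed
    have "G x (e' x) (e' x) = (r x * r x) * q x"
      by (simp add: e'_def linear_cmul[OF l(1)[OF xW]] linear_cmul[OF l(2)[OF xW]] q_def)
    also have "\<dots> = \<sigma>"
      unfolding rr using pos[OF x] \<sigma>(1) by (auto simp: field_simps)
    finally show ?thesis .
  qed
  have e'e: "G x (e' x) (e j x) = 0" "G x (e j x) (e' x) = 0" if "x \<in> W'" "j < m" for x j
  proof -
    have xW: "x \<in> W" using that W'(3) by auto
    show "G x (e' x) (e j x) = 0"
      by (simp add: e'_def linear_cmul[OF l(1)[OF xW]] perp[OF xW that(2)])
    then show "G x (e j x) (e' x) = 0" using sym[of x "e j x" "e' x"] xW W(3) by auto
  qed
  show ?case
  proof (intro exI conjI allI ballI impI)
    show "open W'" "x0 \<in> W'" "W' \<subseteq> W0" using W' W(3) by auto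
    show "smooth_on W' ((e(m := e')) k)" if "k < Suc m" for k
      using e's smooth_on_subset[OF e W'(3), of k] that by (cases "k = m") simp_all
    show "(eps(m := \<sigma>)) k \<in> {1, -1}" if "k < Suc m" for k
      using \<sigma>(1) eps[of k] that by (cases "k = m") simp_all
    show "G x ((e(m := e')) j x) ((e(m := e')) k x) = (if j = k then (eps(m := \<sigma>)) k else 0)"
      if "x \<in> W'" "j < Suc m" "k < Suc m" for x j k
      using that e'e'[OF that(1)] e'e[OF that(1)] orth[of x j k] W'(3)
      by (cases "j = m"; cases "k = m") auto
  qed
qed

definition curv_coeff ::
  "('e::euclidean_space \<Rightarrow> 'e \<Rightarrow> 'e \<Rightarrow> 'e) \<Rightarrow> 'e \<Rightarrow> 'e \<Rightarrow> 'e \<Rightarrow> 'e \<Rightarrow> 'e" where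
  "curv_coeff \<Gamma> x u v w =
     frechet_derivative (\<lambda>y. \<Gamma> y v w) (at x) u - frechet_derivative (\<lambda>y. \<Gamma> y u w) (at x) v
     + \<Gamma> x u (\<Gamma> x v w) - \<Gamma> x v (\<Gamma> x u w)"

lemma frechet_derivative_bilinear_family_linear:
  fixes \<Gamma> :: "'e::euclidean_space \<Rightarrow> 'e \<Rightarrow> 'e \<Rightarrow> 'c::real_normed_vector"
  assumes S: "open S" "x \<in> S" and bil: "\<And>x. x \<in> S \<Longrightarrow> bilinear (\<Gamma> x)"
    and \<Gamma>: "\<And>u v. smooth_on S (\<lambda>x. \<Gamma> x u v)"
  shows "linear (\<lambda>v. frechet_derivative (\<lambda>y. \<Gamma> y v w) (at x) u)"
proof
  have l: "linear (\<lambda>v. \<Gamma> y v w)" if "y \<in> S" for y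
    using bil[OF that] unfolding bilinear_def by simp
  note d = smooth_on_has_derivative[OF \<Gamma> S(2)]
  show "frechet_derivative (\<lambda>y. \<Gamma> y (a + b) w) (at x) u
      = frechet_derivative (\<lambda>y. \<Gamma> y a w) (at x) u + frechet_derivative (\<lambda>y. \<Gamma> y b w) (at x) u" for a b
  proof -
    have "((\<lambda>y. \<Gamma> y (a + b) w) has_derivative (\<lambda>u. frechet_derivative (\<lambda>y. \<Gamma> y a w) (at x) u
        + frechet_derivative (\<lambda>y. \<Gamma> y b w) (at x) u)) (at x)"
      by (rule has_derivative_transform_within_open[OF has_derivative_add[OF d d] S])
         (simp add: linear_add[OF l])
    from fun_cong[OF frechet_derivative_at[OF this], of u] show ?thesis by simp
  qed
  show "frechet_derivative (\<lambda>y. \<Gamma> y (r *\<^sub>R b) w) (at x) u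
      = r *\<^sub>R frechet_derivative (\<lambda>y. \<Gamma> y b w) (at x) u" for r b
  proof -
    have "((\<lambda>y. \<Gamma> y (r *\<^sub>R b) w) has_derivative
        (\<lambda>u. r *\<^sub>R frechet_derivative (\<lambda>y. \<Gamma> y b w) (at x) u)) (at x)"
      by (rule has_derivative_transform_within_open[OF has_derivative_scaleR_right[OF d] S])
         (simp add: linear_cmul[OF l])
    from fun_cong[OF frechet_derivative_at[OF this], of u] show ?thesis by simp
  qed
qed

lemma curv_coeff_linear:
  assumes S: "open S" "x \<in> S" and bil: "\<And>x. x \<in> S \<Longrightarrow> bilinear (\<Gamma> x)"
    and \<Gamma>: "\<And>u v. smooth_on S (\<lambda>x. \<Gamma> x u v)"
  shows "linear (\<lambda>v. curv_coeff \<Gamma> x u v w)"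
proof -
  have l: "linear (\<lambda>v. \<Gamma> x v a)" "linear (\<Gamma> x a)" for a
    using bil[OF S(2)] unfolding bilinear_def by simp_all
  have 1: "linear (frechet_derivative (\<lambda>y. \<Gamma> y u w) (at x))"
    by (rule smooth_on_linear_derivative[OF \<Gamma> S(2)])
  have 2: "linear (\<lambda>v. \<Gamma> x u (\<Gamma> x v w))"
    using linear_compose[OF l(1)[of w] l(2)[of u]] by (simp add: o_def)
  show ?thesis
    unfolding curv_coeff_def
    by (intro linear_compose_sub linear_compose_add l 1 2
        frechet_derivative_bilinear_family_linear[OF S bil \<Gamma>])
qed

section \<open>Metrics, connections and curvature in charts\<close>

abbreviation coord_field :: "('a, 'e::euclidean_space) manifold \<Rightarrow> ('a, 'e) chart \<Rightarrow> 'e \<Rightarrow> ('a, 'e) vfield" where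
  "coord_field M c u \<equiv> chart_field M c (\<lambda>_. u)"

definition metric_in_chart ::
  "('a, 'e::euclidean_space) manifold \<Rightarrow> ('a, 'e) metric_tensor \<Rightarrow> ('a, 'e) chart \<Rightarrow>
     ('e \<Rightarrow> 'e \<Rightarrow> 'e \<Rightarrow> real) \<Rightarrow> bool" where
  "metric_in_chart M g c G \<longleftrightarrow>
     (\<forall>p\<in>cdom c. \<forall>\<xi>\<in>tangent_space M p. \<forall>\<eta>\<in>tangent_space M p. g p \<xi> \<eta> = G (cmap c p) (\<xi> c) (\<eta> c)) \<and>
     (\<forall>x\<in>cmap c ` cdom c. bilinear (G x) \<and> (\<forall>u v. G x u v = G x v u) \<and>
        (\<forall>u. (\<forall>v. G x u v = 0) \<longrightarrow> u = 0)) \<and>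
     (\<forall>u v. smooth_on (cmap c ` cdom c) (\<lambda>x. G x u v))"

definition connection_in_chart ::
  "('a, 'e::euclidean_space) manifold \<Rightarrow> ('a, 'e) connection \<Rightarrow> ('a, 'e) chart \<Rightarrow>
     ('e \<Rightarrow> 'e \<Rightarrow> 'e \<Rightarrow> 'e) \<Rightarrow> bool" where
  "connection_in_chart M D c \<Gamma> \<longleftrightarrow>
     (\<forall>U X Y. openin (mtop M) U \<and> vector_field M U X \<and> vector_field M U Y \<longrightarrow>
        (\<forall>p\<in>U \<inter> cdom c. D X Y p c =
           frechet_derivative (\<lambda>x. Y (cinv c x) c) (at (cmap c p)) (X p c)
           + \<Gamma> (cmap c p) (X p c) (Y p c))) \<and>
     (\<forall>x\<in>cmap c ` cdom c. bilinear (\<Gamma> x)) \<and>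
     (\<forall>u v. smooth_on (cmap c ` cdom c) (\<lambda>x. \<Gamma> x u v))"

definition preserves_fields :: "('a, 'e::euclidean_space) manifold \<Rightarrow> ('a, 'e) connection \<Rightarrow> bool" where
  "preserves_fields M D \<longleftrightarrow> (\<forall>U X Y. openin (mtop M) U \<and> vector_field M U X \<and> vector_field M U Y \<longrightarrow>
     vector_field M U (D X Y))"

lemma metric_in_chartD:
  assumes "metric_in_chart M g c G"
  shows "p \<in> cdom c \<Longrightarrow> \<xi> \<in> tangent_space M p \<Longrightarrow> \<eta> \<in> tangent_space M p \<Longrightarrow>
      g p \<xi> \<eta> = G (cmap c p) (\<xi> c) (\<eta> c)"
    and "x \<in> cmap c ` cdom c \<Longrightarrow> bilinear (G x)"
    and "x \<in> cmap c ` cdom c \<Longrightarrow> G x u v = G x v u"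
    and "x \<in> cmap c ` cdom c \<Longrightarrow> (\<And>v. G x u v = 0) \<Longrightarrow> u = 0"
    and "smooth_on (cmap c ` cdom c) (\<lambda>x. G x u v)"
  using assms unfolding metric_in_chart_def by auto

lemma connection_in_chartD:
  assumes "connection_in_chart M D c \<Gamma>"
  shows "openin (mtop M) U \<Longrightarrow> vector_field M U X \<Longrightarrow> vector_field M U Y \<Longrightarrow> p \<in> U \<Longrightarrow> p \<in> cdom c \<Longrightarrow>
      D X Y p c = frechet_derivative (\<lambda>x. Y (cinv c x) c) (at (cmap c p)) (X p c)
        + \<Gamma> (cmap c p) (X p c) (Y p c)"
    and "x \<in> cmap c ` cdom c \<Longrightarrow> bilinear (\<Gamma> x)"
    and "smooth_on (cmap c ` cdom c) (\<lambda>x. \<Gamma> x u v)"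
  using assms unfolding connection_in_chart_def by auto

lemma preserves_fieldsD:
  "preserves_fields M D \<Longrightarrow> openin (mtop M) U \<Longrightarrow> vector_field M U X \<Longrightarrow> vector_field M U Y \<Longrightarrow>
    vector_field M U (D X Y)"
  unfolding preserves_fields_def by simp

context charted
begin

lemma coord_field_vector_field: "c \<in> atlas M \<Longrightarrow> vector_field M (cdom c) (coord_field M c u)"
  by (rule vector_field_chart_field[OF _ openin_cdom subset_refl smooth_on_const])

lemma coord_field_same: "c \<in> atlas M \<Longrightarrow> p \<in> cdom c \<Longrightarrow> coord_field M c u p c = u"
  by (rule chart_field_same) (simp add: charts_at_def)

lemma frechet_derivative_coord_field:
  assumes c: "c \<in> atlas M" and p: "p \<in> cdom c"
  shows "frechet_derivative (\<lambda>x. coord_field M c u (cinv c x) c) (at (cmap c p)) v = 0"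
proof -
  have "((\<lambda>x. coord_field M c u (cinv c x) c) has_derivative (\<lambda>v. 0)) (at (cmap c p))"
    by (rule has_derivative_transform_within_open[OF has_derivative_const open_image[OF c] imageI[OF p]])
       (auto simp: cinv_cmap[OF c] coord_field_same[OF c])
  from fun_cong[OF frechet_derivative_at[OF this]] show ?thesis by metis
qed

lemma smooth_fun_chart_fun:
  assumes c: "c \<in> atlas M" and U: "openin (mtop M) U" "U \<subseteq> cdom c"
    and \<alpha>: "smooth_on (cmap c ` U) \<alpha>"
  shows "smooth_fun M U (\<lambda>p. \<alpha> (cmap c p))"
  unfolding smooth_fun_def
proof
  fix d assume d: "d \<in> atlas M"
  have "smooth_on (cmap d ` (cdom d \<inter> U)) (\<lambda>x. \<alpha> ((cmap c \<circ> cinv d) x))"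
  proof (rule smooth_on_compose[OF open_cmap_image[OF d U(1)] _ _ \<alpha>])
    show "(cmap c \<circ> cinv d) ` cmap d ` (cdom d \<inter> U) \<subseteq> cmap c ` U"
      using cinv_cmap[OF d] by auto
    show "smooth_on (cmap d ` (cdom d \<inter> U)) (cmap c \<circ> cinv d)"
      by (rule smooth_on_subset[OF transition[OF d c]]) (use U(2) in auto)
  qed
  then show "smooth_on (cmap d ` (cdom d \<inter> U)) ((\<lambda>p. \<alpha> (cmap c p)) \<circ> cinv d)"
    by (simp add: o_def)
qed

lemma tangent_deriv_chart_fun:
  assumes c: "c \<in> atlas M" and U: "openin (mtop M) U" "U \<subseteq> cdom c"
    and \<alpha>: "smooth_on (cmap c ` U) \<alpha>" and p: "p \<in> U" and \<xi>: "\<xi> \<in> tangent_space M p"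
  shows "tangent_deriv M p \<xi> (\<lambda>q. \<alpha> (cmap c q)) = frechet_derivative \<alpha> (at (cmap c p)) (\<xi> c)"
proof (rule tangent_deriv_chart[OF _ \<xi>])
  show "c \<in> charts_at M p" using c p U(2) by (auto simp: charts_at_def)
  have o: "open (cmap c ` U)" using open_cmap_image[OF c U(1)] U(2) by (simp add: Int_absorb1)
  show "((\<lambda>q. \<alpha> (cmap c q)) \<circ> cinv c has_derivative frechet_derivative \<alpha> (at (cmap c p))) (at (cmap c p))"
  proof (rule has_derivative_transform_within_open[OF smooth_on_has_derivative[OF \<alpha> imageI[OF p]] o imageI[OF p]])
    show "\<alpha> x = ((\<lambda>q. \<alpha> (cmap c q)) \<circ> cinv c) x" if "x \<in> cmap c ` U" for x
      using that U(2) cinv_cmap[OF c] by auto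
  qed
qed

end

locale charted_connection = charted M
  for M :: "('a, 'e::euclidean_space) manifold" +
  fixes nab :: "('a, 'e) connection"
  assumes affine: "affine_connection M nab"
begin

lemma nab_preserves: "preserves_fields M nab"
  using affine unfolding affine_connection_def preserves_fields_def by (elim conjE)

lemma nab_local:
  assumes "openin (mtop M) U" "vector_field M U X" "vector_field M U X'" "vector_field M U Y"
    "vector_field M U Y'" "\<And>p. p \<in> U \<Longrightarrow> X p = X' p" "\<And>p. p \<in> U \<Longrightarrow> Y p = Y' p" "p \<in> U"
  shows "nab X Y p = nab X' Y' p"
proof -
  have "\<forall>U X X' Y Y'. openin (mtop M) U \<and>
        vector_field M U X \<and> vector_field M U X' \<and> vector_field M U Y \<and> vector_field M U Y' \<and>
        (\<forall>p\<in>U. X p = X' p) \<and> (\<forall>p\<in>U. Y p = Y' p) \<longrightarrow> (\<forall>p\<in>U. nab X Y p = nab X' Y' p)"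
    using affine unfolding affine_connection_def by (elim conjE)
  note H = this[THEN spec[of _ U], THEN spec[of _ X], THEN spec[of _ X'], THEN spec[of _ Y],
      THEN spec[of _ Y']]
  have XX': "\<forall>p\<in>U. X p = X' p" by (rule ballI) (rule assms(6))
  have YY': "\<forall>p\<in>U. Y p = Y' p" by (rule ballI) (rule assms(7))
  have "\<forall>p\<in>U. nab X Y p = nab X' Y' p"
    by (rule mp[OF H conjI[OF assms(1) conjI[OF assms(2) conjI[OF assms(3) conjI[OF assms(4)
        conjI[OF assms(5) conjI[OF XX' YY']]]]]]])
  then show ?thesis using assms(8) by (rule bspec)
qed

lemma nab_add_left:
  assumes "openin (mtop M) U" "vector_field M U X" "vector_field M U X'" "vector_field M U Y" "p \<in> U"
  shows "nab (vf_add X X') Y p = vf_add (nab X Y) (nab X' Y) p"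
proof -
  have "\<forall>U X X' Y. openin (mtop M) U \<and>
        vector_field M U X \<and> vector_field M U X' \<and> vector_field M U Y \<longrightarrow>
        (\<forall>p\<in>U. nab (vf_add X X') Y p = vf_add (nab X Y) (nab X' Y) p)"
    using affine unfolding affine_connection_def by (elim conjE)
  then show ?thesis using assms by simp
qed

lemma nab_add_right:
  assumes "openin (mtop M) U" "vector_field M U X" "vector_field M U Y" "vector_field M U Y'" "p \<in> U"
  shows "nab X (vf_add Y Y') p = vf_add (nab X Y) (nab X Y') p"
proof -
  have "\<forall>U X Y Y'. openin (mtop M) U \<and>
        vector_field M U X \<and> vector_field M U Y \<and> vector_field M U Y' \<longrightarrow>
        (\<forall>p\<in>U. nab X (vf_add Y Y') p = vf_add (nab X Y) (nab X Y') p)"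
    using affine unfolding affine_connection_def by (elim conjE)
  then show ?thesis using assms by simp
qed

lemma nab_scale_left:
  assumes "openin (mtop M) U" "smooth_fun M U h" "vector_field M U X" "vector_field M U Y" "p \<in> U"
  shows "nab (vf_scale h X) Y p = vf_scale h (nab X Y) p"
proof -
  have "\<forall>U h X Y. openin (mtop M) U \<and>
        smooth_fun M U h \<and> vector_field M U X \<and> vector_field M U Y \<longrightarrow>
        (\<forall>p\<in>U. nab (vf_scale h X) Y p = vf_scale h (nab X Y) p)"
    using affine unfolding affine_connection_def by (elim conjE)
  then show ?thesis using assms by simp
qed

lemma nab_scale_right:
  assumes "openin (mtop M) U" "smooth_fun M U h" "vector_field M U X" "vector_field M U Y" "p \<in> U"
  shows "nab X (vf_scale h Y) p =
    vf_add (vf_scale (\<lambda>q. tangent_deriv M q (X q) h) Y) (vf_scale h (nab X Y)) p"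
proof -
  have "\<forall>U h X Y. openin (mtop M) U \<and>
        smooth_fun M U h \<and> vector_field M U X \<and> vector_field M U Y \<longrightarrow>
        (\<forall>p\<in>U. nab X (vf_scale h Y) p =
           vf_add (vf_scale (\<lambda>q. tangent_deriv M q (X q) h) Y) (vf_scale h (nab X Y)) p)"
    using affine unfolding affine_connection_def by (elim conjE)
  then show ?thesis using assms by simp
qed

lemma nab_chart_sum:
  assumes c: "c \<in> atlas M" and U: "openin (mtop M) U" "U \<subseteq> cdom c" and p: "p \<in> U"
    and X: "vector_field M U X" and B: "finite B"
    and \<alpha>: "\<And>b. b \<in> B \<Longrightarrow> smooth_on (cmap c ` U) (\<alpha> b)"
  shows "nab (chart_field M c (\<lambda>x. \<Sum>b\<in>B. \<alpha> b x *\<^sub>R b)) X p c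
      = (\<Sum>b\<in>B. \<alpha> b (cmap c p) *\<^sub>R nab (coord_field M c b) X p c)" (is ?left)
    and "nab X (chart_field M c (\<lambda>x. \<Sum>b\<in>B. \<alpha> b x *\<^sub>R b)) p c
      = (\<Sum>b\<in>B. frechet_derivative (\<alpha> b) (at (cmap c p)) (X p c) *\<^sub>R b
          + \<alpha> b (cmap c p) *\<^sub>R nab X (coord_field M c b) p c)" (is ?right)
proof -
  have o: "open (cmap c ` U)" using open_cmap_image[OF c U(1)] U(2) by (simp add: Int_absorb1)
  have at: "c \<in> charts_at M q" if "q \<in> U" for q using that c U(2) by (auto simp: charts_at_def)
  have "?left \<and> ?right"
    using B \<alpha>
  proof (induction B rule: finite_induct)
    case empty
    let ?Z = "chart_field M c (\<lambda>x. 0)"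
    have Z: "vector_field M U ?Z"
      by (rule vector_field_chart_field[OF c U smooth_on_const])
    have Z0: "?Z q = vf_scale (\<lambda>_. 0) ?Z q" if "q \<in> U" for q
      using tvec_lincomb[OF at[OF that], of 0 0 0 0] by (simp add: chart_field_def vf_scale_def)
    have s: "smooth_fun M U (\<lambda>_. 0)" by (rule smooth_fun_chart_fun[OF c U smooth_on_const])
    note Z' = vector_field_scale[OF U(1) s Z]
    have "nab ?Z X p = nab (vf_scale (\<lambda>_. 0) ?Z) X p"
      by (rule nab_local[OF U(1) Z Z' X X Z0 refl p])
    then have 1: "nab ?Z X p c = 0"
      unfolding nab_scale_left[OF U(1) s Z X p] by (simp add: vf_scale_def)
    have "nab X ?Z p = nab X (vf_scale (\<lambda>_. 0) ?Z) p"
      by (rule nab_local[OF U(1) X X Z Z' refl Z0 p])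
    moreover have "tangent_deriv M p (X p) (\<lambda>_. 0) = 0"
      using tangent_deriv_chart_fun[OF c U smooth_on_const p vector_field_tangent[OF X p], of 0] by simp
    ultimately have "nab X ?Z p c = 0"
      unfolding nab_scale_right[OF U(1) s X Z p] by (simp add: vf_scale_def vf_add_def)
    with 1 show ?case by simp
  next
    case (insert b B)
    let ?Z = "chart_field M c (\<lambda>x. \<Sum>b\<in>B. \<alpha> b x *\<^sub>R b)"
    let ?Z' = "chart_field M c (\<lambda>x. \<Sum>b\<in>insert b B. \<alpha> b x *\<^sub>R b)"
    let ?a = "\<lambda>q. \<alpha> b (cmap c q)"
    let ?E = "coord_field M c b"
    have \<alpha>: "smooth_on (cmap c ` U) (\<alpha> b')" if "b' \<in> insert b B" for b' by (rule insert.prems[OF that])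
    have Z: "vector_field M U ?Z"
      by (intro vector_field_chart_field[OF c U] smooth_on_sum[OF o] smooth_on_scaleR[OF o] smooth_on_const \<alpha>) simp
    have Z': "vector_field M U ?Z'"
      by (intro vector_field_chart_field[OF c U] smooth_on_sum[OF o] smooth_on_scaleR[OF o] smooth_on_const \<alpha>)
    have E: "vector_field M U ?E"
      by (rule vector_field_chart_field[OF c U smooth_on_const])
    have s: "smooth_fun M U ?a" by (rule smooth_fun_chart_fun[OF c U \<alpha>]) simp
    note aE = vector_field_scale[OF U(1) s E]
    note sum = vector_field_add[OF U(1) aE Z]
    have eq: "?Z' q = vf_add (vf_scale ?a ?E) ?Z q" if "q \<in> U" for q
      using tvec_lincomb[OF at[OF that], of "?a q" b 1] insert.hyps
      by (simp add: chart_field_def vf_scale_def vf_add_def)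
    have IH: "nab ?Z X p c = (\<Sum>b\<in>B. \<alpha> b (cmap c p) *\<^sub>R nab (coord_field M c b) X p c)"
      "nab X ?Z p c = (\<Sum>b\<in>B. frechet_derivative (\<alpha> b) (at (cmap c p)) (X p c) *\<^sub>R b
          + \<alpha> b (cmap c p) *\<^sub>R nab X (coord_field M c b) p c)"
      using insert.IH \<alpha> by simp_all
    have "nab ?Z' X p = nab (vf_add (vf_scale ?a ?E) ?Z) X p"
      by (rule nab_local[OF U(1) Z' sum X X eq refl p])
    also have "\<dots> = vf_add (nab (vf_scale ?a ?E) X) (nab ?Z X) p"
      by (rule nab_add_left[OF U(1) aE Z X p])
    finally have 1: "nab ?Z' X p c = ?a p *\<^sub>R nab ?E X p c + nab ?Z X p c"
      by (simp add: vf_add_def nab_scale_left[OF U(1) s E X p]) (simp add: vf_scale_def)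
    have "nab X ?Z' p = nab X (vf_add (vf_scale ?a ?E) ?Z) p"
      by (rule nab_local[OF U(1) X X Z' sum refl eq p])
    also have "\<dots> = vf_add (nab X (vf_scale ?a ?E)) (nab X ?Z) p"
      by (rule nab_add_right[OF U(1) X aE Z p])
    finally have "nab X ?Z' p c = nab X (vf_scale ?a ?E) p c + nab X ?Z p c"
      by (simp add: vf_add_def)
    moreover have "tangent_deriv M p (X p) ?a = frechet_derivative (\<alpha> b) (at (cmap c p)) (X p c)"
      by (rule tangent_deriv_chart_fun[OF c U \<alpha> p vector_field_tangent[OF X p]]) simp
    moreover have "?E p c = b" by (rule chart_field_same[OF at[OF p]])
    ultimately have 2: "nab X ?Z' p c = frechet_derivative (\<alpha> b) (at (cmap c p)) (X p c) *\<^sub>R b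
        + ?a p *\<^sub>R nab X ?E p c + nab X ?Z p c"
      unfolding nab_scale_right[OF U(1) s X E p] by (simp add: vf_scale_def vf_add_def)
    show ?case
      using 1 2 insert.hyps by (simp add: IH)
  qed
  then show ?left ?right by (rule conjunct1, rule conjunct2)
qed

lemma nab_chart_expand:
  assumes c: "c \<in> atlas M" and U: "openin (mtop M) U" and p: "p \<in> U" "p \<in> cdom c"
    and X: "vector_field M U X" and Y: "vector_field M U Y"
  shows "nab X Y p c = (\<Sum>b\<in>Basis. (X p c \<bullet> b) *\<^sub>R nab (coord_field M c b) Y p c)" (is ?left)
    and "nab X Y p c = frechet_derivative (\<lambda>x. Y (cinv c x) c) (at (cmap c p)) (X p c)
      + (\<Sum>b\<in>Basis. (Y p c \<bullet> b) *\<^sub>R nab X (coord_field M c b) p c)" (is ?right)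
proof -
  define V where "V = cdom c \<inter> U"
  have V: "openin (mtop M) V" "V \<subseteq> cdom c" "V \<subseteq> U" "p \<in> V"
    using U openin_cdom[OF c] p by (auto simp: V_def openin_Int)
  have o: "open (cmap c ` V)" unfolding V_def by (rule open_cmap_image[OF c U])
  have at: "c \<in> charts_at M q" if "q \<in> V" for q using that c V(2) by (auto simp: charts_at_def)
  note XV = vector_field_subset[OF X V(3)] and YV = vector_field_subset[OF Y V(3)]
  have smooth: "smooth_on (cmap c ` V) (\<lambda>x. Z (cinv c x) c)" if "vector_field M U Z" for Z
    unfolding V_def by (rule vector_field_chart[OF that c])
  have coeff: "smooth_on (cmap c ` V) (\<lambda>x. Z (cinv c x) c \<bullet> b)" if "vector_field M U Z" for Z b
    by (rule smooth_on_inner[OF o smooth[OF that] smooth_on_const])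
  have rep: "Z q = chart_field M c (\<lambda>x. \<Sum>b\<in>Basis. (Z (cinv c x) c \<bullet> b) *\<^sub>R b) q"
    if Z: "vector_field M U Z" and q: "q \<in> V" for Z q
    using chart_field_representation[OF Z _ at[OF q]] q V(3)
    unfolding euclidean_representation by auto
  have repf: "vector_field M V (chart_field M c (\<lambda>x. \<Sum>b\<in>Basis. (Z (cinv c x) c \<bullet> b) *\<^sub>R b))"
    if Z: "vector_field M U Z" for Z
    unfolding euclidean_representation by (rule vector_field_chart_field[OF c V(1,2) smooth[OF Z]])
  have cc: "cinv c (cmap c p) = p" by (rule cinv_cmap[OF c p(2)])
  have "nab X Y p = nab (chart_field M c (\<lambda>x. \<Sum>b\<in>Basis. (X (cinv c x) c \<bullet> b) *\<^sub>R b)) Y p"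
    by (rule nab_local[OF V(1) XV repf[OF X] YV YV rep[OF X] refl V(4)])
  then show ?left
    using nab_chart_sum(1)[OF c V(1,2,4) YV finite_Basis, where \<alpha>="\<lambda>b x. X (cinv c x) c \<bullet> b", OF coeff[OF X]] by (simp add: cc)
  have "frechet_derivative (\<lambda>x. Y (cinv c x) c \<bullet> b) (at (cmap c p)) u
      = frechet_derivative (\<lambda>x. Y (cinv c x) c) (at (cmap c p)) u \<bullet> b" for b u
    using frechet_derivative_at[OF has_derivative_inner_left[OF
        smooth_on_has_derivative[OF smooth[OF Y] imageI[OF V(4)]], of b]] by metis
  moreover have "nab X Y p = nab X (chart_field M c (\<lambda>x. \<Sum>b\<in>Basis. (Y (cinv c x) c \<bullet> b) *\<^sub>R b)) p"
    by (rule nab_local[OF V(1) XV XV YV repf[OF Y] refl rep[OF Y] V(4)])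
  ultimately show ?right
    using nab_chart_sum(2)[OF c V(1,2,4) XV finite_Basis, where \<alpha>="\<lambda>b x. Y (cinv c x) c \<bullet> b", OF coeff[OF Y]]
    by (simp add: cc sum.distrib euclidean_representation)
qed

definition christoffel :: "('a, 'e) chart \<Rightarrow> 'e \<Rightarrow> 'e \<Rightarrow> 'e \<Rightarrow> 'e" where
  "christoffel c x u v = (\<Sum>a\<in>Basis. (v \<bullet> a) *\<^sub>R (\<Sum>b\<in>Basis. (u \<bullet> b) *\<^sub>R
     nab (coord_field M c b) (coord_field M c a) (cinv c x) c))"

lemma connection_in_chart_christoffel:
  assumes c: "c \<in> atlas M"
  shows "connection_in_chart M nab c (christoffel c)"
  unfolding connection_in_chart_def
proof (intro conjI allI ballI impI)
  fix U X Y p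
  assume "openin (mtop M) U \<and> vector_field M U X \<and> vector_field M U Y" and p: "p \<in> U \<inter> cdom c"
  then have U: "openin (mtop M) U" and X: "vector_field M U X" and Y: "vector_field M U Y" by simp_all
  define V where "V = cdom c \<inter> U"
  have V: "openin (mtop M) V" "V \<subseteq> cdom c" "V \<subseteq> U" "p \<in> V"
    using U openin_cdom[OF c] p by (auto simp: V_def openin_Int)
  note XV = vector_field_subset[OF X V(3)]
  note E = vector_field_subset[OF coord_field_vector_field[OF c] V(2)]
  have pc: "p \<in> cdom c" using p by simp
  have cc: "cinv c (cmap c p) = p" by (rule cinv_cmap[OF c pc])
  have "nab X Y p c = frechet_derivative (\<lambda>x. Y (cinv c x) c) (at (cmap c p)) (X p c)
      + (\<Sum>a\<in>Basis. (Y p c \<bullet> a) *\<^sub>R nab X (coord_field M c a) p c)"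
    by (rule nab_chart_expand(2)[OF c U _ _ X Y]) (use p in simp_all)
  also have "(\<Sum>a\<in>Basis. (Y p c \<bullet> a) *\<^sub>R nab X (coord_field M c a) p c)
      = christoffel c (cmap c p) (X p c) (Y p c)"
    unfolding christoffel_def cc nab_chart_expand(1)[OF c V(1,4) pc XV E] ..
  finally show "nab X Y p c = frechet_derivative (\<lambda>x. Y (cinv c x) c) (at (cmap c p)) (X p c)
      + christoffel c (cmap c p) (X p c) (Y p c)" .
next
  fix x
  show "bilinear (christoffel c x)"
    unfolding bilinear_def christoffel_def
    by (intro conjI allI linearI)
       (simp_all add: inner_add_left algebra_simps sum.distrib scaleR_sum_right)
next
  fix u v
  have "smooth_on (cmap c ` (cdom c \<inter> cdom c))
      (\<lambda>x. nab (coord_field M c b) (coord_field M c a) (cinv c x) c)" for a b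
    by (rule vector_field_chart[OF preserves_fieldsD[OF nab_preserves openin_cdom[OF c]
        coord_field_vector_field[OF c] coord_field_vector_field[OF c]] c])
  then have "smooth_on (cmap c ` cdom c) (\<lambda>x. nab (coord_field M c b) (coord_field M c a) (cinv c x) c)" for a b
    by simp
  then show "smooth_on (cmap c ` cdom c) (\<lambda>x. christoffel c x u v)"
    unfolding christoffel_def
    by (intro smooth_on_sum[OF open_image[OF c]] smooth_on_scaleR[OF open_image[OF c] smooth_on_const])
qed

end

definition metric_coeff ::
  "('a, 'e::euclidean_space) manifold \<Rightarrow> ('a, 'e) metric_tensor \<Rightarrow> ('a, 'e) chart \<Rightarrow> 'e \<Rightarrow> 'e \<Rightarrow> 'e \<Rightarrow> real" where
  "metric_coeff M g c x u v = g (cinv c x) (tvec M c (cinv c x) u) (tvec M c (cinv c x) v)"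

lemma pseudo_riemannianD:
  assumes "pseudo_riemannian M g"
  shows "smooth_manifold M"
    and "p \<in> mpoints M \<Longrightarrow> \<xi> \<in> tangent_space M p \<Longrightarrow> \<eta> \<in> tangent_space M p \<Longrightarrow> g p \<xi> \<eta> = g p \<eta> \<xi>"
    and "p \<in> mpoints M \<Longrightarrow> \<xi> \<in> tangent_space M p \<Longrightarrow> \<eta> \<in> tangent_space M p \<Longrightarrow> \<zeta> \<in> tangent_space M p \<Longrightarrow>
      g p (\<lambda>c. a *\<^sub>R \<xi> c + b *\<^sub>R \<eta> c) \<zeta> = a * g p \<xi> \<zeta> + b * g p \<eta> \<zeta>"
    and "p \<in> mpoints M \<Longrightarrow> \<xi> \<in> tangent_space M p \<Longrightarrow> \<forall>\<eta>\<in>tangent_space M p. g p \<xi> \<eta> = 0 \<Longrightarrow> \<xi> = (\<lambda>c. 0)"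
    and "openin (mtop M) U \<Longrightarrow> vector_field M U X \<Longrightarrow> vector_field M U Y \<Longrightarrow>
      smooth_fun M U (\<lambda>p. g p (X p) (Y p))"
proof -
  note pr = assms[unfolded pseudo_riemannian_def]
  note pr2 = conjunct2[OF pr] and pr3 = conjunct2[OF conjunct2[OF pr]]
  note pr4 = conjunct2[OF pr3]
  show "smooth_manifold M" by (rule conjunct1[OF pr])
  show "g p \<xi> \<eta> = g p \<eta> \<xi>" if "p \<in> mpoints M" "\<xi> \<in> tangent_space M p" "\<eta> \<in> tangent_space M p"
    by (rule bspec[OF bspec[OF bspec[OF conjunct1[OF pr2] that(1)] that(2)] that(3)])
  show "g p (\<lambda>c. a *\<^sub>R \<xi> c + b *\<^sub>R \<eta> c) \<zeta> = a * g p \<xi> \<zeta> + b * g p \<eta> \<zeta>"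
    if "p \<in> mpoints M" "\<xi> \<in> tangent_space M p" "\<eta> \<in> tangent_space M p" "\<zeta> \<in> tangent_space M p"
    by (rule spec[OF spec[OF bspec[OF bspec[OF bspec[OF bspec[OF conjunct1[OF pr3] that(1)] that(2)] that(3)] that(4)]]])
  show "\<xi> = (\<lambda>c. 0)" if "p \<in> mpoints M" "\<xi> \<in> tangent_space M p" "\<forall>\<eta>\<in>tangent_space M p. g p \<xi> \<eta> = 0"
    by (rule mp[OF bspec[OF bspec[OF conjunct1[OF pr4] that(1)] that(2)] that(3)])
  show "smooth_fun M U (\<lambda>p. g p (X p) (Y p))"
    if "openin (mtop M) U" "vector_field M U X" "vector_field M U Y"
    by (rule mp[OF spec[OF spec[OF spec[OF conjunct2[OF pr4]]]] conjI[OF that(1) conjI[OF that(2,3)]]])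
qed

context charted
begin

lemma metric_in_chart_coeff:
  assumes g: "pseudo_riemannian M g" and c: "c \<in> atlas M"
  shows "metric_in_chart M g c (metric_coeff M g c)"
  unfolding metric_in_chart_def
proof (intro conjI ballI allI impI)
  note pr = pseudo_riemannianD[OF g]
  fix p \<xi> \<eta> assume p: "p \<in> cdom c" and t: "\<xi> \<in> tangent_space M p" "\<eta> \<in> tangent_space M p"
  have "c \<in> charts_at M p" using c p by (simp add: charts_at_def)
  then show "g p \<xi> \<eta> = metric_coeff M g c (cmap c p) (\<xi> c) (\<eta> c)"
    by (simp only: metric_coeff_def cinv_cmap[OF c p] tvec_component[OF t(1)] tvec_component[OF t(2)])
next
  note pr = pseudo_riemannianD[OF g]
  fix x assume "x \<in> cmap c ` cdom c"
  then obtain p where p: "p \<in> cdom c" "x = cmap c p" by (elim imageE)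
  have cp: "c \<in> charts_at M p" using c p by (simp add: charts_at_def)
  have pM: "p \<in> mpoints M" using cdom_subset[OF c] p by (elim subsetD)
  note t = tvec_tangent[OF cp]
  have eq: "metric_coeff M g c x u v = g p (tvec M c p u) (tvec M c p v)" for u v
    by (simp only: metric_coeff_def p(2) cinv_cmap[OF c p(1)])
  show sym: "metric_coeff M g c x u v = metric_coeff M g c x v u" for u v
    unfolding eq by (rule pr(2)[OF pM t t])
  have lin: "metric_coeff M g c x (a *\<^sub>R u + b *\<^sub>R v) w
      = a * metric_coeff M g c x u w + b * metric_coeff M g c x v w" for a b u v w
    unfolding eq tvec_lincomb[OF cp] by (rule pr(3)[OF pM t t t])
  have l: "linear (\<lambda>u. metric_coeff M g c x u w)" for w
    by (rule linearI) (use lin[of 1 _ 1 _ w] lin[of _ _ 0 0 w] in simp_all)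
  have "linear (metric_coeff M g c x w)" for w
    using l[of w] by (simp only: sym[of _ w])
  with l show "bilinear (metric_coeff M g c x)" unfolding bilinear_def by simp
  fix u assume u: "\<forall>v. metric_coeff M g c x u v = 0"
  have "\<forall>\<eta>\<in>tangent_space M p. g p (tvec M c p u) \<eta> = 0"
  proof
    fix \<eta> assume "\<eta> \<in> tangent_space M p"
    from tvec_component[OF this cp] spec[OF u, of "\<eta> c"] show "g p (tvec M c p u) \<eta> = 0"
      unfolding eq by simp
  qed
  from pr(4)[OF pM t this] have "tvec M c p u c = 0" by (rule fun_cong)
  then show "u = 0" unfolding tvec_same[OF cp] .
next
  fix u v
  note smooth_fun_chart[OF pseudo_riemannianD(5)[OF g openin_cdom[OF c]
        coord_field_vector_field[OF c] coord_field_vector_field[OF c]] c, of u v]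
  moreover have "metric_coeff M g c x u v
      = g (cinv c x) (coord_field M c u (cinv c x)) (coord_field M c v (cinv c x))" for x
    by (simp only: metric_coeff_def chart_field_def)
  ultimately show "smooth_on (cmap c ` cdom c) (\<lambda>x. metric_coeff M g c x u v)"
    by simp
qed

lemma metric_smooth_fun:
  assumes G: "\<And>c. c \<in> atlas M \<Longrightarrow> metric_in_chart M g c (G c)"
    and U: "openin (mtop M) U" and X: "vector_field M U X" and Y: "vector_field M U Y"
  shows "smooth_fun M U (\<lambda>p. g p (X p) (Y p))"
  unfolding smooth_fun_def
proof
  fix c assume c: "c \<in> atlas M"
  note m = metric_in_chartD[OF G[OF c]]
  let ?W = "cmap c ` (cdom c \<inter> U)"
  have sub: "?W \<subseteq> cmap c ` cdom c" by (rule image_mono) simp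
  have "smooth_on ?W (\<lambda>x. G c x (X (cinv c x) c) (Y (cinv c x) c))"
    by (rule smooth_on_bilinear_family[OF open_cmap_image[OF c U] m(2)[OF subsetD[OF sub]]
          smooth_on_subset[OF m(5) sub] vector_field_chart[OF X c] vector_field_chart[OF Y c]])
  moreover have "((\<lambda>p. g p (X p) (Y p)) \<circ> cinv c) x = G c x (X (cinv c x) c) (Y (cinv c x) c)"
    if "x \<in> ?W" for x
  proof -
    note i = cinv_image[OF c that]
    show ?thesis
      unfolding o_def m(1)[OF i(1) vector_field_tangent[OF X i(2)] vector_field_tangent[OF Y i(2)]] i(3) ..
  qed
  ultimately show "smooth_on ?W ((\<lambda>p. g p (X p) (Y p)) \<circ> cinv c)"
    by (subst smooth_on_cong[OF open_cmap_image[OF c U]])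
qed

lemma curvature_in_chart:
  assumes c: "c \<in> atlas M" and \<Gamma>: "connection_in_chart M D c \<Gamma>" and D: "preserves_fields M D"
    and br: "preserves_fields M (lie_bracket M)"
    and U: "openin (mtop M) U" and p: "p \<in> U" "p \<in> cdom c"
    and X: "vector_field M U X" and Y: "vector_field M U Y" and Z: "vector_field M U Z"
  shows "curvature M D X Y Z p c = curv_coeff \<Gamma> (cmap c p) (X p c) (Y p c) (Z p c)"
proof -
  note co = connection_in_chartD[OF \<Gamma>]
  define W where "W = cmap c ` (cdom c \<inter> U)"
  define x0 where "x0 = cmap c p"
  have W: "open W" "W \<subseteq> cmap c ` cdom c" "x0 \<in> W"
    unfolding W_def x0_def using p by (auto intro: open_cmap_image[OF c U])
  have cp: "c \<in> charts_at M p" using c p by (simp add: charts_at_def)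
  have cc: "cinv c x0 = p" unfolding x0_def by (rule cinv_cmap[OF c p(2)])
  define loc where "loc V x = V (cinv c x) c" for V :: "('a, 'e) vfield" and x
  have locp: "loc V x0 = V p c" for V by (simp only: loc_def cc)
  have smooth: "smooth_on W (loc V)" if "vector_field M U V" for V
    unfolding loc_def W_def by (rule vector_field_chart[OF that c])
  have bil: "bilinear (\<Gamma> x)" if "x \<in> W" for x by (rule co(2)) (use that W(2) in auto)
  have \<Gamma>s: "smooth_on W (\<lambda>x. \<Gamma> x u v)" for u v by (rule smooth_on_subset[OF co(3) W(2)])
  have l: "linear (\<lambda>u. \<Gamma> x0 u w)" "linear (\<Gamma> x0 w)" for w
    using bil[OF W(3)] unfolding bilinear_def by simp_all
  have D_loc: "loc (D A B) x = frechet_derivative (loc B) (at x) (loc A x) + \<Gamma> x (loc A x) (loc B x)"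
    if A: "vector_field M U A" and B: "vector_field M U B" and x: "x \<in> W" for A B x
  proof -
    note i = cinv_image[OF c x[unfolded W_def]]
    show ?thesis
      using co(1)[OF U A B i(2,1)] unfolding i(3) loc_def .
  qed
  let ?d = "\<lambda>V. frechet_derivative (loc V) (at x0)"
  have dlin: "linear (?d V)" if "vector_field M U V" for V
    by (rule smooth_on_linear_derivative[OF smooth[OF that] W(3)])
  have hd: "(loc V has_derivative ?d V) (at x0)" if "vector_field M U V" for V
    by (rule smooth_on_has_derivative[OF smooth[OF that] W(3)])
  have deriv: "?d (D A B) h = frechet_derivative (\<lambda>x. frechet_derivative (loc B) (at x) (A p c)) (at x0) h
      + ?d B (?d A h)
      + (frechet_derivative (\<lambda>x. \<Gamma> x (A p c) (B p c)) (at x0) h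
          + \<Gamma> x0 (A p c) (?d B h) + \<Gamma> x0 (?d A h) (B p c))"
    if A: "vector_field M U A" and B: "vector_field M U B" for A B h
  proof -
    have 1: "((\<lambda>x. frechet_derivative (loc B) (at x) (loc A x)) has_derivative
        (\<lambda>h. frechet_derivative (\<lambda>x. frechet_derivative (loc B) (at x) (loc A x0)) (at x0) h
          + ?d B (?d A h))) (at x0)"
      by (rule has_derivative_linear_family[OF W(1,3) smooth_on_linear_derivative[OF smooth[OF B]]
            smooth_on_has_derivative[OF smooth_on_derivative[OF smooth[OF B]] W(3)] hd[OF A]])
    have 2: "((\<lambda>x. \<Gamma> x (loc A x) (loc B x)) has_derivative
        (\<lambda>h. frechet_derivative (\<lambda>x. \<Gamma> x (loc A x0) (loc B x0)) (at x0) h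
          + \<Gamma> x0 (loc A x0) (?d B h) + \<Gamma> x0 (?d A h) (loc B x0))) (at x0)"
      by (rule has_derivative_bilinear_family[OF W(1,3) bil \<Gamma>s hd[OF A] hd[OF B]])
    have "(loc (D A B) has_derivative
        (\<lambda>h. frechet_derivative (\<lambda>x. frechet_derivative (loc B) (at x) (loc A x0)) (at x0) h
          + ?d B (?d A h) + (frechet_derivative (\<lambda>x. \<Gamma> x (loc A x0) (loc B x0)) (at x0) h
          + \<Gamma> x0 (loc A x0) (?d B h) + \<Gamma> x0 (?d A h) (loc B x0)))) (at x0)"
      by (rule has_derivative_transform_within_open[OF has_derivative_add[OF 1 2] W(1,3)])
         (rule D_loc[OF A B, symmetric])
    from fun_cong[OF frechet_derivative_at[OF this], of h] show ?thesis
      unfolding locp by (rule sym)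
  qed
  have second: "D A (D B Z) p c =
      frechet_derivative (\<lambda>x. frechet_derivative (loc Z) (at x) (B p c)) (at x0) (A p c)
      + ?d Z (?d B (A p c))
      + (frechet_derivative (\<lambda>x. \<Gamma> x (B p c) (Z p c)) (at x0) (A p c)
          + \<Gamma> x0 (B p c) (?d Z (A p c)) + \<Gamma> x0 (?d B (A p c)) (Z p c))
      + (\<Gamma> x0 (A p c) (?d Z (B p c)) + \<Gamma> x0 (A p c) (\<Gamma> x0 (B p c) (Z p c)))"
    if A: "vector_field M U A" and B: "vector_field M U B" for A B
    using D_loc[OF A preserves_fieldsD[OF D U B Z] W(3)] D_loc[OF B Z W(3)]
    unfolding locp deriv[OF B Z] by (simp add: linear_add[OF l(2)])
  note brXY = preserves_fieldsD[OF br U X Y]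
  have br_eq: "lie_bracket M X Y p c = ?d Y (X p c) - ?d X (Y p c)"
    using cp by (simp add: lie_bracket_def loc_def[abs_def] x0_def)
  have third: "D (lie_bracket M X Y) Z p c = ?d Z (?d Y (X p c)) - ?d Z (?d X (Y p c))
      + (\<Gamma> x0 (?d Y (X p c)) (Z p c) - \<Gamma> x0 (?d X (Y p c)) (Z p c))"
    using D_loc[OF brXY Z W(3)] unfolding locp br_eq
    by (simp only: linear_diff[OF dlin[OF Z]] linear_diff[OF l(1)])
  have symm: "frechet_derivative (\<lambda>x. frechet_derivative (loc Z) (at x) (Y p c)) (at x0) (X p c)
      = frechet_derivative (\<lambda>x. frechet_derivative (loc Z) (at x) (X p c)) (at x0) (Y p c)"
    by (rule mixed_derivatives_commute[OF W(1,3) smooth[OF Z]])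
  show ?thesis
    unfolding curvature_def vf_diff_def second[OF X Y] second[OF Y X] third curv_coeff_def
      x0_def[symmetric] symm
    by (simp add: algebra_simps)
qed

lemma curvature_vector_field:
  assumes D: "preserves_fields M D" and br: "preserves_fields M (lie_bracket M)"
    and U: "openin (mtop M) U" and X: "vector_field M U X" and Y: "vector_field M U Y" and Z: "vector_field M U Z"
  shows "vector_field M U (curvature M D X Y Z)"
  unfolding curvature_def
  by (intro vector_field_diff[OF U] preserves_fieldsD[OF D U] preserves_fieldsD[OF br U] X Y Z)

lemma orthonormal_frame_exists:
  assumes c: "c \<in> atlas M" and G: "metric_in_chart M g c G" and p: "p \<in> cdom c"
  shows "\<exists>U E eps. orthonormal_frame M g U E eps \<and> p \<in> U"
proof -
  note m = metric_in_chartD[OF G]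
  have "\<exists>W e eps. open W \<and> cmap c p \<in> W \<and> W \<subseteq> cmap c ` cdom c \<and>
    (\<forall>k<DIM('e). smooth_on W (e k) \<and> eps k \<in> {1, -1}) \<and>
    (\<forall>x\<in>W. \<forall>j<DIM('e). \<forall>k<DIM('e). G x (e j x) (e k x) = (if j = k then eps k else (0::real)))"
    by (rule exists_local_orthonormal_frame[OF open_image[OF c] imageI[OF p] m(2,3,5)
        m(4)[OF imageI[OF p]] order_refl])
  then obtain W e eps where W: "open W" "cmap c p \<in> W" "W \<subseteq> cmap c ` cdom c"
    and e: "\<forall>k<DIM('e). smooth_on W (e k) \<and> eps k \<in> {1, -1}"
    and G_e: "\<forall>x\<in>W. \<forall>j<DIM('e). \<forall>k<DIM('e). G x (e j x) (e k x) = (if j = k then eps k else (0::real))"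
    by (elim exE conjE)
  define U where "U = {q \<in> cdom c. cmap c q \<in> W}"
  have U: "openin (mtop M) U" "U \<subseteq> cdom c" "p \<in> U"
    unfolding U_def using W(2) p by (auto intro: openin_cmap_vimage[OF c W(1)])
  have img: "cmap c ` U \<subseteq> W" unfolding U_def by auto
  have vf: "vector_field M U (chart_field M c (e k))" if "k < DIM('e)" for k
    by (rule vector_field_chart_field[OF c U(1,2) smooth_on_subset[OF _ img]]) (use e that in simp)
  have "orthonormal_frame M g U (\<lambda>k. chart_field M c (e k)) eps"
    unfolding orthonormal_frame_def
  proof (intro conjI allI ballI impI)
    show "openin (mtop M) U" by (rule U(1))
    show "vector_field M U (chart_field M c (e k))" if "k < DIM('e)" for k by (rule vf[OF that])
    show "eps k \<in> {1, -1}" if "k < DIM('e)" for k using e that by simp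
    fix q j k assume q: "q \<in> U" and jk: "j < DIM('e)" "k < DIM('e)"
    have qc: "q \<in> cdom c" "c \<in> charts_at M q" "cmap c q \<in> W"
      using q c U(2) img by (auto simp: charts_at_def)
    show "g q (chart_field M c (e j) q) (chart_field M c (e k) q) = (if j = k then eps k else 0)"
      unfolding m(1)[OF qc(1) vector_field_tangent[OF vf[OF jk(1)] q] vector_field_tangent[OF vf[OF jk(2)] q]]
        chart_field_same[OF qc(2)]
      using G_e qc(3) jk by simp
  qed
  with U(3) show ?thesis by (intro exI conjI)
qed

theorem ricci_in_chart:
  assumes c: "c \<in> atlas M" and G: "metric_in_chart M g c G" and \<Gamma>: "connection_in_chart M D c \<Gamma>"
    and D: "preserves_fields M D" and br: "preserves_fields M (lie_bracket M)"
    and U: "openin (mtop M) U" and p: "p \<in> U" "p \<in> cdom c"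
    and X: "vector_field M U X" and Y: "vector_field M U Y"
  shows "ricci M g D X Y p = (\<Sum>b\<in>Basis. curv_coeff \<Gamma> (cmap c p) (X p c) b (Y p c) \<bullet> b)"
proof -
  note m = metric_in_chartD[OF G]
  note x0 = imageI[OF p(2), of "cmap c"]
  have lin: "linear (\<lambda>v. curv_coeff \<Gamma> (cmap c p) (X p c) v (Y p c))"
    by (rule curv_coeff_linear[OF open_image[OF c] x0 connection_in_chartD(2,3)[OF \<Gamma>]])
  have frame: "(\<Sum>k<DIM('e). eps k * g p (curvature M D X (E k) Y p) (E k p))
      = (\<Sum>b\<in>Basis. curv_coeff \<Gamma> (cmap c p) (X p c) b (Y p c) \<bullet> b)"
    if E: "orthonormal_frame M g V E eps" and pV: "p \<in> V" for V E eps
  proof -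
    have V: "openin (mtop M) V" and vfE: "vector_field M V (E k)" and eps: "eps k \<in> {1, -1}"
      if "k < DIM('e)" for k
      using E that unfolding orthonormal_frame_def by simp_all
    have orth: "g p (E j p) (E k p) = (if j = k then eps k else 0)"
      if "j < DIM('e)" "k < DIM('e)" for j k
      using E that pV unfolding orthonormal_frame_def by simp
    have UV: "openin (mtop M) (U \<inter> V)" "p \<in> U \<inter> V"
      using U V[of 0] p pV by (auto intro: openin_Int)
    have X': "vector_field M (U \<inter> V) X" "vector_field M (U \<inter> V) Y"
      by (rule vector_field_subset[OF X], simp) (rule vector_field_subset[OF Y], simp)
    have E': "vector_field M (U \<inter> V) (E k)" if "k < DIM('e)" for k
      by (rule vector_field_subset[OF vfE[OF that]]) simp
    have "g p (curvature M D X (E k) Y p) (E k p)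
        = G (cmap c p) (curv_coeff \<Gamma> (cmap c p) (X p c) (E k p c) (Y p c)) (E k p c)"
      if k: "k < DIM('e)" for k
    proof -
      note cv = curvature_vector_field[OF D br UV(1) X'(1) E'[OF k] X'(2)]
      show ?thesis
        unfolding m(1)[OF p(2) vector_field_tangent[OF cv UV(2)] vector_field_tangent[OF E'[OF k] UV(2)]]
          curvature_in_chart[OF c \<Gamma> D br UV(1,2) p(2) X'(1) E'[OF k] X'(2)] ..
    qed
    then have "(\<Sum>k<DIM('e). eps k * g p (curvature M D X (E k) Y p) (E k p))
        = (\<Sum>k<DIM('e). eps k * G (cmap c p) (curv_coeff \<Gamma> (cmap c p) (X p c) (E k p c) (Y p c)) (E k p c))"
      by (intro sum.cong) simp_all
    also have "\<dots> = (\<Sum>b\<in>Basis. curv_coeff \<Gamma> (cmap c p) (X p c) b (Y p c) \<bullet> b)"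
    proof (rule trace_orthonormal[OF m(2)[OF x0] eps _ lin])
      show "G (cmap c p) (E j p c) (E k p c) = (if j = k then eps k else 0)"
        if "j < DIM('e)" "k < DIM('e)" for j k
        using orth[OF that] unfolding m(1)[OF p(2) vector_field_tangent[OF vfE[OF that(1)] pV]
            vector_field_tangent[OF vfE[OF that(2)] pV]] .
    qed
    finally show ?thesis .
  qed
  show ?thesis
    unfolding ricci_def
  proof (rule the_equality)
    obtain V E eps where E: "orthonormal_frame M g V E eps" "p \<in> V"
      using orthonormal_frame_exists[OF c G p(2)] by (elim exE conjE)
    show "\<exists>V E eps. orthonormal_frame M g V E eps \<and> p \<in> V \<and>
        (\<Sum>b\<in>Basis. curv_coeff \<Gamma> (cmap c p) (X p c) b (Y p c) \<bullet> b)
          = (\<Sum>k<DIM('e). eps k * g p (curvature M D X (E k) Y p) (E k p))"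
      using E frame[OF E] by (intro exI conjI) (assumption, assumption, rule sym)
    fix r assume "\<exists>V E eps. orthonormal_frame M g V E eps \<and> p \<in> V \<and>
        r = (\<Sum>k<DIM('e). eps k * g p (curvature M D X (E k) Y p) (E k p))"
    then obtain V E eps where E: "orthonormal_frame M g V E eps" "p \<in> V"
      and r: "r = (\<Sum>k<DIM('e). eps k * g p (curvature M D X (E k) Y p) (E k p))" by (elim exE conjE)
    show "r = (\<Sum>b\<in>Basis. curv_coeff \<Gamma> (cmap c p) (X p c) b (Y p c) \<bullet> b)"
      unfolding r by (rule frame[OF E])
  qed
qed

lemma lie_bracket_preserves:
  assumes D: "preserves_fields M D" and tf: "torsion_free M D"
  shows "preserves_fields M (lie_bracket M)"
  unfolding preserves_fields_def
proof (intro allI impI)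
  fix U X Y assume "openin (mtop M) U \<and> vector_field M U X \<and> vector_field M U Y"
  then have U: "openin (mtop M) U" and X: "vector_field M U X" and Y: "vector_field M U Y" by simp_all
  have eq: "\<forall>p\<in>U. vf_diff (D X Y) (D Y X) p = lie_bracket M X Y p"
    by (rule mp[OF spec[OF spec[OF spec[OF tf[unfolded torsion_free_def]]]]]) (intro conjI U X Y)
  show "vector_field M U (lie_bracket M X Y)"
    by (rule vector_field_cong[OF U vector_field_diff[OF U preserves_fieldsD[OF D U X Y]
          preserves_fieldsD[OF D U Y X]]]) (rule bspec[OF eq, symmetric])
qed

lemma torsion_free_in_chart:
  assumes c: "c \<in> atlas M" and \<Gamma>: "connection_in_chart M D c \<Gamma>" and tf: "torsion_free M D"
    and x: "x \<in> cmap c ` cdom c"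
  shows "\<Gamma> x u v = \<Gamma> x v u"
proof -
  obtain p where p: "p \<in> cdom c" "x = cmap c p" using x by (elim imageE)
  have cp: "c \<in> charts_at M p" using c p by (simp add: charts_at_def)
  note E = coord_field_vector_field[OF c]
  have "\<forall>p\<in>cdom c. vf_diff (D (coord_field M c u) (coord_field M c v)) (D (coord_field M c v) (coord_field M c u)) p
      = lie_bracket M (coord_field M c u) (coord_field M c v) p"
    by (rule mp[OF spec[OF spec[OF spec[OF tf[unfolded torsion_free_def]]]]]) (intro conjI openin_cdom[OF c] E)
  from fun_cong[OF bspec[OF this p(1)], of c]
  have "D (coord_field M c u) (coord_field M c v) p c - D (coord_field M c v) (coord_field M c u) p c = 0"
    using cp by (simp add: vf_diff_def lie_bracket_def frechet_derivative_coord_field[OF c p(1)])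
  then show ?thesis
    unfolding connection_in_chartD(1)[OF \<Gamma> openin_cdom[OF c] E E p(1) p(1)]
      frechet_derivative_coord_field[OF c p(1)] coord_field_same[OF c p(1)]
    by (simp add: p(2))
qed

lemma metric_compatible_in_chart:
  assumes c: "c \<in> atlas M" and G: "metric_in_chart M g c G" and \<Gamma>: "connection_in_chart M D c \<Gamma>"
    and D: "preserves_fields M D" and mc: "metric_compatible M g D" and x: "x \<in> cmap c ` cdom c"
  shows "frechet_derivative (\<lambda>y. G y v w) (at x) u = G x (\<Gamma> x u v) w + G x v (\<Gamma> x u w)"
proof -
  note m = metric_in_chartD[OF G]
  obtain p where p: "p \<in> cdom c" "x = cmap c p" using x by (elim imageE)
  have cp: "c \<in> charts_at M p" using c p by (simp add: charts_at_def)
  note E = coord_field_vector_field[OF c] and o = openin_cdom[OF c]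
  note T = vector_field_tangent[OF E p(1)]
  have g_eq: "g q (coord_field M c v q) (coord_field M c w q) = G (cmap c q) v w" if "q \<in> cdom c" for q
    unfolding m(1)[OF that vector_field_tangent[OF E that] vector_field_tangent[OF E that]]
      coord_field_same[OF c that] ..
  have "\<forall>p\<in>cdom c. tangent_deriv M p (coord_field M c u p) (\<lambda>q. g q (coord_field M c v q) (coord_field M c w q)) =
      g p (D (coord_field M c u) (coord_field M c v) p) (coord_field M c w p)
      + g p (coord_field M c v p) (D (coord_field M c u) (coord_field M c w) p)"
    by (rule mp[OF spec[OF spec[OF spec[OF spec[OF mc[unfolded metric_compatible_def]]]]]])
       (intro conjI o E)
  note bspec[OF this p(1)]
  moreover have "tangent_deriv M p (coord_field M c u p) (\<lambda>q. g q (coord_field M c v q) (coord_field M c w q))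
      = frechet_derivative (\<lambda>y. G y v w) (at x) u"
  proof -
    have "((\<lambda>q. g q (coord_field M c v q) (coord_field M c w q)) \<circ> cinv c has_derivative
        frechet_derivative (\<lambda>y. G y v w) (at (cmap c p))) (at (cmap c p))"
    proof (rule has_derivative_transform_within_open[OF smooth_on_has_derivative[OF m(5) imageI[OF p(1)]]
          open_image[OF c] imageI[OF p(1)]])
      fix y assume "y \<in> cmap c ` cdom c"
      then have y: "y \<in> cmap c ` (cdom c \<inter> UNIV)" by simp
      note i = cinv_image[OF c y]
      show "G y v w = ((\<lambda>q. g q (coord_field M c v q) (coord_field M c w q)) \<circ> cinv c) y"
        unfolding o_def g_eq[OF i(1)] i(3) ..
    qed
    from tangent_deriv_chart[OF cp T this] show ?thesis
      unfolding coord_field_same[OF c p(1)] p(2) .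
  qed
  moreover have "g p (D (coord_field M c u) (coord_field M c v) p) (coord_field M c w p)
      = G x (\<Gamma> x u v) w" for v w
    unfolding m(1)[OF p(1) vector_field_tangent[OF preserves_fieldsD[OF D o E E] p(1)] T]
      connection_in_chartD(1)[OF \<Gamma> o E E p(1) p(1)]
      frechet_derivative_coord_field[OF c p(1)] coord_field_same[OF c p(1)] p(2) by simp
  moreover have "g p (coord_field M c v p) (D (coord_field M c u) (coord_field M c w) p)
      = G x v (\<Gamma> x u w)"
    unfolding m(1)[OF p(1) T vector_field_tangent[OF preserves_fieldsD[OF D o E E] p(1)]]
      connection_in_chartD(1)[OF \<Gamma> o E E p(1) p(1)]
      frechet_derivative_coord_field[OF c p(1)] coord_field_same[OF c p(1)] p(2) by simp
  ultimately show ?thesis by simp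
qed

lemma koszul_in_chart:
  assumes c: "c \<in> atlas M" and G: "metric_in_chart M g c G" and \<Gamma>: "connection_in_chart M D c \<Gamma>"
    and D: "preserves_fields M D" and tf: "torsion_free M D" and mc: "metric_compatible M g D"
    and x: "x \<in> cmap c ` cdom c"
  shows "2 * G x (\<Gamma> x u v) w = frechet_derivative (\<lambda>y. G y v w) (at x) u
    + frechet_derivative (\<lambda>y. G y u w) (at x) v - frechet_derivative (\<lambda>y. G y u v) (at x) w"
  unfolding metric_compatible_in_chart[OF c G \<Gamma> D mc x]
  using torsion_free_in_chart[OF c \<Gamma> tf x, of u v] torsion_free_in_chart[OF c \<Gamma> tf x, of u w]
    torsion_free_in_chart[OF c \<Gamma> tf x, of v w] metric_in_chartD(3)[OF G x]
  by simp

lemma quarter_symmetric_preserves: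
  assumes G: "\<And>c. c \<in> atlas M \<Longrightarrow> metric_in_chart M g c (G c)" and D: "preserves_fields M D"
    and P: "vector_field M (mpoints M) P"
  shows "preserves_fields M (quarter_symmetric g P lam1 lam2 D)"
  unfolding preserves_fields_def
proof (intro allI impI)
  fix U X Y assume "openin (mtop M) U \<and> vector_field M U X \<and> vector_field M U Y"
  then have U: "openin (mtop M) U" and X: "vector_field M U X" and Y: "vector_field M U Y" by simp_all
  have PU: "vector_field M U P" by (rule vector_field_subset[OF P openin_subset[OF U]])
  have scale: "smooth_fun M U (\<lambda>p. r * g p (A p) (B p))"
    if A: "vector_field M U A" and B: "vector_field M U B" for r A B
    unfolding smooth_fun_def
  proof
    fix c assume c: "c \<in> atlas M"
    show "smooth_on (cmap c ` (cdom c \<inter> U)) ((\<lambda>p. r * g p (A p) (B p)) \<circ> cinv c)"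
      unfolding o_def
      by (rule smooth_on_mult[OF open_cmap_image[OF c U] smooth_on_const
            smooth_fun_chart[OF metric_smooth_fun[OF G U A B] c]])
  qed
  have "quarter_symmetric g P lam1 lam2 D X Y = vf_add (vf_add (D X Y) (vf_scale (\<lambda>p. lam1 * g p (Y p) (P p)) X))
      (vf_scale (\<lambda>p. - lam2 * g p (X p) (Y p)) P)"
    by (simp add: quarter_symmetric_def vf_add_def vf_scale_def)
  moreover have "vector_field M U \<dots>"
    by (intro vector_field_add[OF U] vector_field_scale[OF U] preserves_fieldsD[OF D U] scale X Y PU)
  ultimately show "vector_field M U (quarter_symmetric g P lam1 lam2 D X Y)" by (simp only:)
qed

lemma quarter_symmetric_in_chart:
  assumes c: "c \<in> atlas M" and G: "metric_in_chart M g c G" and \<Gamma>: "connection_in_chart M D c \<Gamma>"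
    and P: "vector_field M (mpoints M) P" and Pc: "\<And>p. p \<in> cdom c \<Longrightarrow> P p c = P0"
  shows "connection_in_chart M (quarter_symmetric g P lam1 lam2 D) c
    (\<lambda>x u v. \<Gamma> x u v + (lam1 * G x v P0) *\<^sub>R u - (lam2 * G x u v) *\<^sub>R P0)"
  unfolding connection_in_chart_def
proof (intro conjI allI ballI impI)
  note m = metric_in_chartD[OF G] and co = connection_in_chartD[OF \<Gamma>]
  fix U X Y p assume "openin (mtop M) U \<and> vector_field M U X \<and> vector_field M U Y" and p: "p \<in> U \<inter> cdom c"
  then have U: "openin (mtop M) U" and X: "vector_field M U X" and Y: "vector_field M U Y" by simp_all
  have pU: "p \<in> U" and pc: "p \<in> cdom c" using p by simp_all
  have Pt: "P p \<in> tangent_space M p"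
    by (rule vector_field_tangent[OF P subsetD[OF cdom_subset[OF c] pc]])
  note Xt = vector_field_tangent[OF X pU] and Yt = vector_field_tangent[OF Y pU]
  show "quarter_symmetric g P lam1 lam2 D X Y p c =
      frechet_derivative (\<lambda>x. Y (cinv c x) c) (at (cmap c p)) (X p c)
      + (\<Gamma> (cmap c p) (X p c) (Y p c) + (lam1 * G (cmap c p) (Y p c) P0) *\<^sub>R X p c
         - (lam2 * G (cmap c p) (X p c) (Y p c)) *\<^sub>R P0)"
    unfolding quarter_symmetric_def m(1)[OF pc Yt Pt] m(1)[OF pc Xt Yt] co(1)[OF U X Y pU pc] Pc[OF pc]
    by simp
next
  note m = metric_in_chartD[OF G] and co = connection_in_chartD[OF \<Gamma>]
  fix x assume x: "x \<in> cmap c ` cdom c"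
  have l: "linear (\<lambda>u. \<Gamma> x u w)" "linear (\<Gamma> x w)" "linear (\<lambda>u. G x u w)" "linear (G x w)" for w
    using m(2)[OF x] co(2)[OF x] unfolding bilinear_def by simp_all
  show "bilinear (\<lambda>u v. \<Gamma> x u v + (lam1 * G x v P0) *\<^sub>R u - (lam2 * G x u v) *\<^sub>R P0)"
    unfolding bilinear_def
    by (intro conjI allI linearI)
       (simp_all add: linear_add[OF l(1)] linear_add[OF l(2)] linear_add[OF l(3)] linear_add[OF l(4)]
          linear_cmul[OF l(1)] linear_cmul[OF l(2)] linear_cmul[OF l(3)] linear_cmul[OF l(4)] algebra_simps)
next
  note m = metric_in_chartD[OF G] and co = connection_in_chartD[OF \<Gamma>]
  fix u v
  show "smooth_on (cmap c ` cdom c) (\<lambda>x. \<Gamma> x u v + (lam1 * G x v P0) *\<^sub>R u - (lam2 * G x u v) *\<^sub>R P0)"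
    by (intro smooth_on_diff[OF open_image[OF c]] smooth_on_add[OF open_image[OF c]] co(3)
        smooth_on_scaleR[OF open_image[OF c]] smooth_on_mult[OF open_image[OF c]] smooth_on_const m(5))
qed

end

section \<open>Warped products over an interval\<close>

lemma smooth_on_compose_snd:
  fixes f :: "'b::euclidean_space \<Rightarrow> 'c::real_normed_vector"
  assumes "open I" "open W" "smooth_on W f"
  shows "smooth_on ((I :: 'a::euclidean_space set) \<times> W) (\<lambda>x. f (snd x))"
  by (rule smooth_on_compose[OF open_Times[OF assms(1,2)] _ smooth_on_bounded_linear[OF bounded_linear_snd] assms(3)])
     auto

lemma smooth_on_compose_fst:
  fixes f :: "'a::euclidean_space \<Rightarrow> 'c::real_normed_vector"
  assumes "open I" "open W" "smooth_on I f"
  shows "smooth_on (I \<times> (W :: 'b::euclidean_space set)) (\<lambda>x. f (fst x))"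
  by (rule smooth_on_compose[OF open_Times[OF assms(1,2)] _ smooth_on_bounded_linear[OF bounded_linear_fst] assms(3)])
     auto

definition warped_chart :: "real set \<Rightarrow> ('a, 'e) chart \<Rightarrow> (real \<times> 'a, real \<times> 'e) chart" where
  "warped_chart I d = Chart (I \<times> cdom d) (\<lambda>(t, y). (t, cmap d y))"

text \<open>Inverse to \<open>warped_chart I\<close>; the fibre component of such a chart does not depend on the time,
  so evaluating it at \<open>0\<close> is harmless even if \<open>0 \<notin> I\<close>.\<close>

definition base_chart :: "(real \<times> 'a, real \<times> 'e) chart \<Rightarrow> ('a, 'e) chart" where
  "base_chart c = Chart (snd ` cdom c) (\<lambda>y. snd (cmap c (0, y)))"

lemma warped_chart_simps [simp]:
  "cdom (warped_chart I d) = I \<times> cdom d"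
  "cmap (warped_chart I d) (t, y) = (t, cmap d y)"
  by (simp_all add: warped_chart_def)

lemma image_warped_chart: "cmap (warped_chart I d) ` (I \<times> A) = I \<times> cmap d ` A"
  by (force simp: warped_chart_def)

lemma base_warped_chart: "I \<noteq> {} \<Longrightarrow> base_chart (warped_chart I d) = d"
  by (cases d) (simp add: base_chart_def warped_chart_def)

lemma atlas_warped_manifold: "atlas (warped_manifold I F) = warped_chart I ` atlas F"
  by (auto simp: warped_manifold_def product_manifold_def interval_manifold_def warped_chart_def)

lemma mtop_warped_manifold: "mtop (warped_manifold I F) = prod_topology (top_of_set I) (mtop F)"
  by (simp add: warped_manifold_def product_manifold_def interval_manifold_def)

locale warped_product =
  fixes I :: "real set" and F :: "('a, 'e::euclidean_space) manifold" and gF :: "('a, 'e) metric_tensor"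
    and f :: "real \<Rightarrow> real"
  assumes I: "open I" "I \<noteq> {}" and F: "pseudo_riemannian F gF"
    and f: "smooth_on I f" "\<forall>t\<in>I. f t > 0"
begin

abbreviation "WM \<equiv> warped_manifold I F"
abbreviation "gW \<equiv> warped_metric I f F gF"
abbreviation "wc \<equiv> warped_chart I"

sublocale F: charted F
  by (rule smooth_manifold_imp_charted[OF pseudo_riemannianD(1)[OF F]])

lemma cinv_warped_chart:
  assumes "d \<in> atlas F" "t \<in> I" "y \<in> cmap d ` cdom d"
  shows "cinv (wc d) (t, y) = (t, cinv d y)"
proof -
  obtain q where q: "q \<in> cdom d" "y = cmap d q" using assms(3) by (elim imageE)
  have "inj_on (cmap (wc d)) (cdom (wc d))"
    using F.inj_on_cmap[OF assms(1)] by (auto simp: inj_on_def)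
  from inv_into_f_f[OF this, of "(t, q)"] show ?thesis
    using q assms(2) F.cinv_cmap[OF assms(1) q(1)] by (simp add: cinv_def)
qed

lemma charted_WM: "charted WM"
proof
  show "mpoints WM = (\<Union>c\<in>atlas WM. cdom c)"
    using F.cover by (auto simp: mtop_warped_manifold atlas_warped_manifold)
next
  fix c assume "c \<in> atlas WM"
  then obtain d where d: "d \<in> atlas F" "c = wc d" unfolding atlas_warped_manifold by (elim imageE)
  show "openin (mtop WM) (cdom c)"
    by (simp add: d(2) mtop_warped_manifold openin_prod_Times_iff F.openin_cdom[OF d(1)])
  show "open (cmap c ` cdom c)"
    by (simp add: d(2) image_warped_chart open_Times I(1) F.open_image[OF d(1)])
  obtain g where g: "homeomorphic_maps (subtopology (mtop F) (cdom d)) (top_of_set (cmap d ` cdom d)) (cmap d) g"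
    using F.homeo[OF d(1)] unfolding homeomorphic_map_maps by (elim exE)
  have "homeomorphic_maps (top_of_set I) (top_of_set I) (\<lambda>t. t) (\<lambda>t. t)"
    using homeomorphic_maps_id[of "top_of_set I" "top_of_set I"] by (simp add: id_def)
  with g have "homeomorphic_maps (prod_topology (top_of_set I) (subtopology (mtop F) (cdom d)))
      (prod_topology (top_of_set I) (top_of_set (cmap d ` cdom d)))
      (\<lambda>(t, y). (t, cmap d y)) (\<lambda>(t, y). (t, g y))"
    unfolding homeomorphic_maps_prod by simp
  then have "homeomorphic_map (prod_topology (top_of_set I) (subtopology (mtop F) (cdom d)))
      (prod_topology (top_of_set I) (top_of_set (cmap d ` cdom d))) (cmap c)"
    unfolding homeomorphic_map_maps by (simp add: d(2) warped_chart_def) (rule exI)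
  moreover have "subtopology (mtop WM) (cdom c)
      = prod_topology (top_of_set I) (subtopology (mtop F) (cdom d))"
    by (simp add: d(2) mtop_warped_manifold subtopology_Times subtopology_subtopology)
  ultimately show "homeomorphic_map (subtopology (mtop WM) (cdom c)) (top_of_set (cmap c ` cdom c)) (cmap c)"
    by (simp add: d(2) image_warped_chart)
next
  fix c c' assume "c \<in> atlas WM" "c' \<in> atlas WM"
  then obtain d d' where d: "d \<in> atlas F" "c = wc d" and d': "d' \<in> atlas F" "c' = wc d'"
    unfolding atlas_warped_manifold by (elim imageE)
  let ?W = "cmap d ` (cdom d \<inter> cdom d')"
  have o: "open ?W" by (rule F.open_overlap[OF d(1) d'(1)])
  have img: "cmap c ` (cdom c \<inter> cdom c') = I \<times> ?W"
    unfolding d(2) d'(2) image_warped_chart[symmetric] by (simp add: Times_Int_Times)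
  have "smooth_on (I \<times> ?W) (\<lambda>x. (fst x, (cmap d' \<circ> cinv d) (snd x)))"
    by (rule smooth_on_Pair[OF open_Times[OF I(1) o] smooth_on_bounded_linear[OF bounded_linear_fst]
          smooth_on_compose_snd[OF I(1) o F.transition[OF d(1) d'(1)]]])
  moreover have "(cmap c' \<circ> cinv c) x = (fst x, (cmap d' \<circ> cinv d) (snd x))" if "x \<in> I \<times> ?W" for x
  proof -
    have "snd x \<in> cmap d ` cdom d" "fst x \<in> I" using that by auto
    from cinv_warped_chart[OF d(1) this(2,1)] show ?thesis
      by (simp add: d(2) d'(2) warped_chart_def)
  qed
  ultimately show "smooth_on (cmap c ` (cdom c \<inter> cdom c')) (cmap c' \<circ> cinv c)"
    unfolding img by (subst smooth_on_cong[OF open_Times[OF I(1) o]])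
qed

sublocale M: charted WM by (rule charted_WM)

lemma wc_atlas: "d \<in> atlas F \<Longrightarrow> wc d \<in> atlas WM"
  by (simp add: atlas_warped_manifold)

lemma wc_charts_at: "d \<in> charts_at F y \<Longrightarrow> t \<in> I \<Longrightarrow> wc d \<in> charts_at WM (t, y)"
  by (simp add: charts_at_def wc_atlas)

lemma charts_at_WM:
  assumes "c \<in> charts_at WM (t, y)"
  obtains d where "d \<in> charts_at F y" "c = wc d" "t \<in> I"
  using assms by (auto simp: charts_at_def atlas_warped_manifold)

lemma has_derivative_wc:
  assumes d: "d \<in> charts_at F y" and t: "t \<in> I"
    and h': "((\<lambda>x. h (fst x) (cinv d (snd x))) has_derivative h') (at (t, cmap d y))"
  shows "((\<lambda>(s, z). h s z) \<circ> cinv (wc d) has_derivative h') (at (cmap (wc d) (t, y)))"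
proof -
  note d' = F.charts_atD[OF d]
  have o: "open (I \<times> cmap d ` cdom d)" by (rule open_Times[OF I(1) F.open_image[OF d'(1)]])
  have m: "(t, cmap d y) \<in> I \<times> cmap d ` cdom d" using t d'(2) by simp
  show ?thesis
    unfolding warped_chart_simps
  proof (rule has_derivative_transform_within_open[OF h' o m])
    fix x assume x: "x \<in> I \<times> cmap d ` cdom d"
    have "cinv (wc d) (fst x, snd x) = (fst x, cinv d (snd x))"
      by (rule cinv_warped_chart[OF d'(1)]) (use x in auto)
    then show "h (fst x) (cinv d (snd x)) = ((\<lambda>(s, z). h s z) \<circ> cinv (wc d)) x" by simp
  qed
qed

lemma cmap_wc: "cmap (wc d) = (\<lambda>(s, z). (s, cmap d z))"
  by (simp add: warped_chart_def)

lemma trans_deriv_wc: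
  assumes d: "d \<in> charts_at F y" "d' \<in> charts_at F y" and t: "t \<in> I"
  shows "trans_deriv (wc d) (wc d') (t, y) u = (fst u, trans_deriv d d' y (snd u))"
proof -
  have 1: "((\<lambda>x. (fst x, cmap d' (cinv d (snd x)))) has_derivative
      (\<lambda>u. (fst u, trans_deriv d d' y (snd u)))) (at (t, cmap d y))"
  proof (rule has_derivative_Pair[OF has_derivative_fst[OF has_derivative_ident]])
    have "((\<lambda>x. (cmap d' \<circ> cinv d) (snd x)) has_derivative (\<lambda>u. trans_deriv d d' y (snd u))) (at (t, cmap d y))"
      by (rule has_derivative_compose[OF has_derivative_snd[OF has_derivative_ident]])
         (use F.trans_has_derivative[OF d] in \<open>simp only: snd_conv\<close>)
    then show "((\<lambda>x. cmap d' (cinv d (snd x))) has_derivative (\<lambda>u. trans_deriv d d' y (snd u))) (at (t, cmap d y))"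
      by (simp only: o_def)
  qed
  have "((\<lambda>(s, z). (s, cmap d' z)) \<circ> cinv (wc d) has_derivative
      (\<lambda>u. (fst u, trans_deriv d d' y (snd u)))) (at (cmap (wc d) (t, y)))"
    by (rule has_derivative_wc[OF d(1) t 1])
  from fun_cong[OF frechet_derivative_at[OF this], of u]
  show ?thesis
    unfolding trans_deriv_def cmap_wc by (rule sym)
qed

lemma tangent_deriv_fst:
  assumes d: "d \<in> charts_at F y" and t: "t \<in> I" and \<xi>: "\<xi> \<in> tangent_space WM (t, y)"
  shows "tangent_deriv WM (t, y) \<xi> fst = fst (\<xi> (wc d))"
proof -
  have "((\<lambda>(s, z :: 'a). s) \<circ> cinv (wc d) has_derivative fst) (at (cmap (wc d) (t, y)))"
    by (rule has_derivative_wc[OF d t]) (rule has_derivative_fst[OF has_derivative_ident])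
  moreover have "(\<lambda>(s, z :: 'a). s) = (fst :: real \<times> 'a \<Rightarrow> real)" by auto
  ultimately show ?thesis
    by (intro M.tangent_deriv_chart[OF wc_charts_at[OF d t] \<xi>]) (simp only:)
qed

lemma differential_snd:
  assumes \<xi>: "\<xi> \<in> tangent_space WM (t, y)" and t: "t \<in> I" and y: "y \<in> mpoints F"
  shows "d \<in> charts_at F y \<Longrightarrow> differential WM F snd (t, y) \<xi> d = snd (\<xi> (wc d))"
    and "differential WM F snd (t, y) \<xi> \<in> tangent_space F y"
proof -
  obtain d0 where d0: "d0 \<in> charts_at F y" using F.charts_at_exists[OF y] by (elim exE)
  define c0 where "c0 = (SOME c. c \<in> charts_at WM (t, y))"
  have c0: "c0 \<in> charts_at WM (t, y)" unfolding c0_def using wc_charts_at[OF d0 t] by (rule someI)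
  have *: "frechet_derivative (cmap d \<circ> snd \<circ> cinv c0) (at (cmap c0 (t, y))) (\<xi> c0) = snd (\<xi> (wc d))"
    if d: "d \<in> charts_at F y" for d
  proof -
    have "((\<lambda>x. cmap d (cinv d (snd x))) has_derivative snd) (at (t, cmap d y))"
    proof (rule has_derivative_transform_within_open[OF has_derivative_snd[OF has_derivative_ident]
          open_Times[OF I(1) F.open_image[OF F.charts_atD(1)[OF d]]]])
      show "(t, cmap d y) \<in> I \<times> cmap d ` cdom d" using t F.charts_atD(2)[OF d] by simp
      show "snd x = cmap d (cinv d (snd x))" if "x \<in> I \<times> cmap d ` cdom d" for x
        using F.cinv_image(3)[OF F.charts_atD(1)[OF d], of "snd x" UNIV] that by auto
    qed
    then have "((\<lambda>(s :: real, z). cmap d z) \<circ> cinv (wc d) has_derivative snd) (at (cmap (wc d) (t, y)))"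
      by (rule has_derivative_wc[OF d t])
    moreover have "(\<lambda>(s :: real, z). cmap d z) = cmap d \<circ> snd" by auto
    ultimately have "((cmap d \<circ> snd) \<circ> cinv (wc d) has_derivative snd) (at (cmap (wc d) (t, y)))"
      by (simp only:)
    from fun_cong[OF frechet_derivative_at[OF M.has_derivative_change_chart[OF wc_charts_at[OF d t] c0 this]],
        of "\<xi> c0"] M.tangent_trans[OF \<xi> c0 wc_charts_at[OF d t]]
    show ?thesis by (simp only:)
  qed
  have eq: "differential WM F snd (t, y) \<xi> = (\<lambda>d. if d \<in> charts_at F y then snd (\<xi> (wc d)) else 0)"
    unfolding differential_def Let_def c0_def[symmetric] snd_conv using * by auto
  then show 1: "d \<in> charts_at F y \<Longrightarrow> differential WM F snd (t, y) \<xi> d = snd (\<xi> (wc d))" for d by simp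
  show "differential WM F snd (t, y) \<xi> \<in> tangent_space F y"
  proof (rule F.tangent_spaceI)
    fix c d assume cd: "c \<in> charts_at F y" "d \<in> charts_at F y"
    show "differential WM F snd (t, y) \<xi> d = trans_deriv c d y (differential WM F snd (t, y) \<xi> c)"
      unfolding 1[OF cd(1)] 1[OF cd(2)]
        M.tangent_trans[OF \<xi> wc_charts_at[OF cd(1) t] wc_charts_at[OF cd(2) t]] trans_deriv_wc[OF cd t]
      by simp
  next
    fix c assume "c \<notin> charts_at F y"
    then show "differential WM F snd (t, y) \<xi> c = 0" by (simp add: eq)
  qed
qed

definition warped_coeff :: "('a, 'e) chart \<Rightarrow> real \<times> 'e \<Rightarrow> real \<times> 'e \<Rightarrow> real \<times> 'e \<Rightarrow> real" where
  "warped_coeff d x u v = - (fst u * fst v) + (f (fst x))\<^sup>2 * metric_coeff F gF d (snd x) (snd u) (snd v)"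

lemma metric_in_chart_wc:
  assumes d: "d \<in> atlas F"
  shows "metric_in_chart WM gW (wc d) (warped_coeff d)"
  unfolding metric_in_chart_def
proof (intro conjI ballI allI impI)
  note m = metric_in_chartD[OF F.metric_in_chart_coeff[OF F d]]
  fix p \<xi> \<eta> assume p: "p \<in> cdom (wc d)" and t: "\<xi> \<in> tangent_space WM p" "\<eta> \<in> tangent_space WM p"
  obtain t y where ty: "p = (t, y)" "t \<in> I" "y \<in> cdom d" using p by auto
  have yF: "y \<in> mpoints F" using F.cdom_subset[OF d] ty(3) by (elim subsetD)
  have dy: "d \<in> charts_at F y" using d ty(3) by (simp add: charts_at_def)
  note t' = t[unfolded ty(1)]
  show "gW p \<xi> \<eta> = warped_coeff d (cmap (wc d) p) (\<xi> (wc d)) (\<eta> (wc d))"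
    unfolding warped_metric_def Let_def ty(1) tangent_deriv_fst[OF dy ty(2) t'(1)] fst_conv snd_conv
      tangent_deriv_fst[OF dy ty(2) t'(2)]
      m(1)[OF ty(3) differential_snd(2)[OF t'(1) ty(2) yF] differential_snd(2)[OF t'(2) ty(2) yF]]
      differential_snd(1)[OF t'(1) ty(2) yF dy] differential_snd(1)[OF t'(2) ty(2) yF dy]
    by (simp add: warped_coeff_def)
next
  note m = metric_in_chartD[OF F.metric_in_chart_coeff[OF F d]]
  fix x assume "x \<in> cmap (wc d) ` cdom (wc d)"
  then have x: "fst x \<in> I" "snd x \<in> cmap d ` cdom d" by auto
  have l: "linear (\<lambda>u. metric_coeff F gF d (snd x) u w)" "linear (metric_coeff F gF d (snd x) w)" for w
    using m(2)[OF x(2)] unfolding bilinear_def by simp_all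
  show "bilinear (warped_coeff d x)"
    unfolding bilinear_def warped_coeff_def
    by (intro conjI allI linearI)
       (simp_all add: linear_add[OF l(1)] linear_add[OF l(2)] linear_cmul[OF l(1)] linear_cmul[OF l(2)] algebra_simps)
  show "warped_coeff d x u v = warped_coeff d x v u" for u v
    unfolding warped_coeff_def using m(3)[OF x(2), of "snd u" "snd v"] by simp
  fix u assume u: "\<forall>v. warped_coeff d x u v = 0"
  have "fst u = 0"
    using spec[OF u, of "(1, 0)"] by (simp add: warped_coeff_def linear_0[OF l(2)])
  moreover have "snd u = 0"
  proof (rule m(4)[OF x(2)])
    fix v
    show "metric_coeff F gF d (snd x) (snd u) v = 0"
      using spec[OF u, of "(0, v)"] f(2) x(1) by (auto simp: warped_coeff_def)
  qed
  ultimately show "u = 0" by (simp add: prod_eq_iff)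
next
  note m = metric_in_chartD[OF F.metric_in_chart_coeff[OF F d]]
  fix u v
  have o: "open (I \<times> cmap d ` cdom d)" by (rule open_Times[OF I(1) F.open_image[OF d]])
  show "smooth_on (cmap (wc d) ` cdom (wc d)) (\<lambda>x. warped_coeff d x u v)"
    unfolding warped_coeff_def warped_chart_simps image_warped_chart power2_eq_square
    by (intro smooth_on_add[OF o] smooth_on_mult[OF o] smooth_on_const
        smooth_on_compose_fst[OF I(1) F.open_image[OF d] f(1)]
        smooth_on_compose_snd[OF I(1) F.open_image[OF d] m(5)])
qed

lemma time_field_wc:
  assumes "d \<in> atlas F" "p \<in> cdom (wc d)"
  shows "time_field I F p (wc d) = (1, 0)"
proof -
  obtain t y where ty: "p = (t, y)" "t \<in> I" "y \<in> cdom d" using assms(2) by auto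
  have "((\<lambda>s. (s, cmap d y)) has_vector_derivative (1, 0)) (at t)"
    unfolding has_vector_derivative_def
    by (rule has_derivative_eq_rhs[OF has_derivative_Pair[OF has_derivative_ident has_derivative_const]])
       (simp add: fun_eq_iff)
  then show ?thesis
    using wc_charts_at[of d y t] assms(1) ty by (simp add: time_field_def vector_derivative_at charts_at_def)
qed

lemma vector_field_components:
  assumes out: "\<And>p c. c \<notin> charts_at WM p \<Longrightarrow> X p c = 0"
    and comp: "\<And>d p. d \<in> atlas F \<Longrightarrow> p \<in> cdom (wc d) \<Longrightarrow> X p (wc d) = (a, V (snd p) d)"
    and V: "vector_field F (mpoints F) V"
  shows "vector_field WM (mpoints WM) X"
  unfolding vector_field_def
proof (intro conjI ballI)
  fix p assume "p \<in> mpoints WM"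
  then obtain t y where p: "p = (t, y)" "t \<in> I" "y \<in> mpoints F" by (auto simp: mtop_warped_manifold)
  show "X p \<in> tangent_space WM p"
  proof (rule M.tangent_spaceI[OF _ out])
    fix c c' assume "c \<in> charts_at WM p" "c' \<in> charts_at WM p"
    then obtain d d' where d: "d \<in> charts_at F y" "c = wc d" and d': "d' \<in> charts_at F y" "c' = wc d'"
      unfolding p(1) by (elim charts_at_WM)
    have pd: "p \<in> cdom (wc d)" "p \<in> cdom (wc d')"
      using p F.charts_atD(2)[OF d(1)] F.charts_atD(2)[OF d'(1)] by simp_all
    show "X p c' = trans_deriv c c' p (X p c)"
      unfolding d(2) d'(2) comp[OF F.charts_atD(1)[OF d(1)] pd(1)] comp[OF F.charts_atD(1)[OF d'(1)] pd(2)]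
      unfolding p(1) trans_deriv_wc[OF d(1) d'(1) p(2)] snd_conv fst_conv
        F.tangent_trans[OF vector_field_tangent[OF V p(3)] d(1) d'(1)] ..
  qed
next
  fix c assume "c \<in> atlas WM"
  then obtain d where d: "d \<in> atlas F" "c = wc d" unfolding atlas_warped_manifold by (elim imageE)
  have o: "open (I \<times> cmap d ` cdom d)" by (rule open_Times[OF I(1) F.open_image[OF d(1)]])
  have sub: "cdom c \<inter> mpoints WM = I \<times> cdom d"
    using F.cdom_subset[OF d(1)] by (auto simp: d(2) mtop_warped_manifold)
  have Vs: "smooth_on (cmap d ` cdom d) (\<lambda>x. V (cinv d x) d)"
    by (rule smooth_on_subset[OF vector_field_chart[OF V d(1)]]) (use F.cdom_subset[OF d(1)] in auto)
  have "smooth_on (I \<times> cmap d ` cdom d) (\<lambda>x. (a, V (cinv d (snd x)) d))"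
    by (rule smooth_on_Pair[OF o smooth_on_const smooth_on_compose_snd[OF I(1) F.open_image[OF d(1)] Vs]])
  moreover have "X (cinv c x) c = (a, V (cinv d (snd x)) d)" if x: "x \<in> I \<times> cmap d ` cdom d" for x
  proof -
    have 1: "cinv c x = (fst x, cinv d (snd x))"
      using cinv_warped_chart[OF d(1), of "fst x" "snd x"] x by (simp add: d(2) mem_Times_iff)
    have "cinv c x \<in> cdom (wc d)"
      using F.cinv_image(1)[OF d(1), of "snd x" UNIV] x unfolding 1 by auto
    from comp[OF d(1) this] have "X (fst x, cinv d (snd x)) (wc d) = (a, V (cinv d (snd x)) d)"
      unfolding 1 snd_conv .
    then show ?thesis unfolding 1 unfolding d(2) .
  qed
  ultimately show "smooth_on (cmap c ` (cdom c \<inter> mpoints WM)) (\<lambda>x. X (cinv c x) c)"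
    unfolding sub unfolding d(2) image_warped_chart by (subst smooth_on_cong[OF o]) 
qed

lemma zero_vector_field: "vector_field F (mpoints F) (\<lambda>p c. 0)"
  unfolding vector_field_def
  by (intro conjI ballI F.tangent_spaceI smooth_on_const)
     (simp_all add: linear_0 F.trans_linear)

lemma time_field_vector_field: "vector_field WM (mpoints WM) (time_field I F)"
proof (rule vector_field_components[OF _ _ zero_vector_field])
  show "time_field I F p c = 0" if "c \<notin> charts_at WM p" for p c
    using that by (cases p) (simp add: time_field_def)
  show "time_field I F p (wc d) = (1, 0)" if "d \<in> atlas F" "p \<in> cdom (wc d)" for d p
    by (rule time_field_wc[OF that])
qed

definition lift :: "('a, 'e) vfield \<Rightarrow> (real \<times> 'a, real \<times> 'e) vfield" where
  "lift V = (\<lambda>p c. if c \<in> charts_at WM p then (0, V (snd p) (base_chart c)) else 0)"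

lemma lift_wc:
  assumes "d \<in> atlas F" "p \<in> cdom (wc d)"
  shows "lift V p (wc d) = (0, V (snd p) d)"
  using assms wc_atlas[OF assms(1)] by (simp add: lift_def charts_at_def base_warped_chart[OF I(2)])

lemma lift_vector_field:
  assumes "vector_field F (mpoints F) V"
  shows "vector_field WM (mpoints WM) (lift V)"
proof (rule vector_field_components[where V=V and a=0])
  show "lift V p c = 0" if "c \<notin> charts_at WM p" for p c
    using that by (simp add: lift_def)
  show "lift V p (wc d) = (0, V (snd p) d)" if "d \<in> atlas F" "p \<in> cdom (wc d)" for d p
    by (rule lift_wc[OF that])
qed (rule assms)

end

lemma sum_Basis_prod:
  fixes h :: "'a::euclidean_space \<times> 'b::euclidean_space \<Rightarrow> 'c::comm_monoid_add"
  shows "(\<Sum>b\<in>Basis. h b) = (\<Sum>a\<in>Basis. h (a, 0)) + (\<Sum>b\<in>Basis. h (0, b))"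
proof -
  have "(\<Sum>b\<in>Basis. h b) = (\<Sum>b\<in>(\<lambda>a. (a, 0)) ` Basis. h b) + (\<Sum>b\<in>(\<lambda>b. (0, b)) ` Basis. h b)"
    unfolding Basis_prod_def by (rule sum.union_disjoint) auto
  then show ?thesis by (simp add: sum.reindex inj_on_def)
qed

text \<open>The common shape, in product coordinates, of the Levi-Civita connection of the warped metric
  and of its quarter-symmetric modifications; \<open>h\<close> and \<open>\<Gamma>\<close> are the metric and the Christoffel map of
  the fibre.\<close>

definition warped_conn ::
  "(real \<Rightarrow> real) \<Rightarrow> (real \<Rightarrow> real) \<Rightarrow> (real \<Rightarrow> real) \<Rightarrow> real \<Rightarrow>
     ('e::euclidean_space \<Rightarrow> 'e \<Rightarrow> 'e \<Rightarrow> real) \<Rightarrow> ('e \<Rightarrow> 'e \<Rightarrow> 'e \<Rightarrow> 'e) \<Rightarrow>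
     real \<times> 'e \<Rightarrow> real \<times> 'e \<Rightarrow> real \<times> 'e \<Rightarrow> real \<times> 'e" where
  "warped_conn a b c \<mu> h \<Gamma> x u v =
     (b (fst x) * h (snd x) (snd u) (snd v) + \<mu> * fst u * fst v,
      \<Gamma> (snd x) (snd u) (snd v) + (c (fst x) * fst u) *\<^sub>R snd v + (a (fst x) * fst v) *\<^sub>R snd u)"

lemma warped_conn_derivative:
  fixes h :: "'e::euclidean_space \<Rightarrow> 'e \<Rightarrow> 'e \<Rightarrow> real"
  assumes W: "y \<in> W" and h: "\<And>u v. smooth_on W (\<lambda>y. h y u v)" and \<Gamma>: "\<And>u v. smooth_on W (\<lambda>y. \<Gamma> y u v)"
    and a: "(a has_real_derivative a') (at t)" and b: "(b has_real_derivative b') (at t)"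
    and c: "(c has_real_derivative c') (at t)"
  shows "frechet_derivative (\<lambda>x. warped_conn a b c \<mu> h \<Gamma> x v w) (at (t, y)) u =
    (b' * fst u * h y (snd v) (snd w) + b t * frechet_derivative (\<lambda>y. h y (snd v) (snd w)) (at y) (snd u),
     frechet_derivative (\<lambda>y. \<Gamma> y (snd v) (snd w)) (at y) (snd u)
       + (c' * fst u * fst v) *\<^sub>R snd w + (a' * fst u * fst w) *\<^sub>R snd v)"
proof -
  have real: "((\<lambda>x. k (fst x)) has_derivative (\<lambda>u. k' * fst u)) (at (t, y))"
    if "(k has_real_derivative k') (at t)" for k k'
    by (rule has_derivative_compose[OF has_derivative_fst[OF has_derivative_ident]])
       (use that in \<open>simp add: has_field_derivative_def\<close>)
  have fibre: "((\<lambda>x. k (snd x)) has_derivative (\<lambda>u. frechet_derivative k (at y) (snd u))) (at (t, y))"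
    if "smooth_on W k" for k :: "'e \<Rightarrow> 'z::real_normed_vector"
    by (rule has_derivative_compose[OF has_derivative_snd[OF has_derivative_ident]])
       (use smooth_on_has_derivative[OF that W] in simp)
  have "((\<lambda>x. warped_conn a b c \<mu> h \<Gamma> x v w) has_derivative
    (\<lambda>u. (b t * frechet_derivative (\<lambda>y. h y (snd v) (snd w)) (at y) (snd u) + (b' * fst u) * h y (snd v) (snd w) + 0,
      frechet_derivative (\<lambda>y. \<Gamma> y (snd v) (snd w)) (at y) (snd u)
        + ((c' * fst u) * fst v) *\<^sub>R snd w + ((a' * fst u) * fst w) *\<^sub>R snd v))) (at (t, y))"
    unfolding warped_conn_def
    using has_derivative_mult[OF real[OF b] fibre[OF h[of "snd v" "snd w"]]]
    by (intro has_derivative_Pair has_derivative_add has_derivative_const fibre[OF \<Gamma>]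
        has_derivative_scaleR_left has_derivative_mult_left real[OF a] real[OF c]) simp_all
  from fun_cong[OF frechet_derivative_at[OF this], of u] show ?thesis
    by (simp add: algebra_simps)
qed

lemma warped_conn_ricci:
  fixes h :: "'e::euclidean_space \<Rightarrow> 'e \<Rightarrow> 'e \<Rightarrow> real"
  assumes oW: "open W" and W: "y \<in> W"
    and h: "\<And>u v. smooth_on W (\<lambda>y. h y u v)" and \<Gamma>: "\<And>u v. smooth_on W (\<lambda>y. \<Gamma> y u v)"
    and hb: "\<And>y. y \<in> W \<Longrightarrow> bilinear (h y)" and \<Gamma>b: "\<And>y. y \<in> W \<Longrightarrow> bilinear (\<Gamma> y)"
    and a: "(a has_real_derivative a') (at t)" and b: "(b has_real_derivative b') (at t)"
    and c: "(c has_real_derivative c') (at t)"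
    and \<Gamma>s: "\<And>u v. \<Gamma> y u v = \<Gamma> y v u"
  shows "(\<Sum>v\<in>Basis. curv_coeff (warped_conn a b c \<mu> h \<Gamma>) (t, y) u v w \<bullet> v) =
    (\<Sum>v\<in>Basis. curv_coeff \<Gamma> y (snd u) v (snd w) \<bullet> v)
    + real DIM('e) * (a' + a t * c t - a t * \<mu>) * (fst u * fst w)
    + (a t * b t * (1 - real DIM('e)) - b' + b t * c t - \<mu> * b t) * h y (snd u) (snd w)"
proof -
  have hl: "linear (\<lambda>u. h y u w)" "linear (h y w)" for w
    using hb[OF W] unfolding bilinear_def by simp_all
  have \<Gamma>l: "linear (\<lambda>u. \<Gamma> y u w)" "linear (\<Gamma> y w)" for w
    using \<Gamma>b[OF W] unfolding bilinear_def by simp_all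
  note d = warped_conn_derivative[OF W h \<Gamma> a b c]
  note lin = linear_add[OF \<Gamma>l(2)] linear_cmul[OF \<Gamma>l(2)] linear_cmul[OF hl(2)] linear_0[OF hl(1)]
    linear_0[OF hl(2)] linear_0[OF \<Gamma>l(1)] linear_0[OF \<Gamma>l(2)]
  have dh0: "frechet_derivative (\<lambda>y. h y u v) (at y) 0 = 0" "frechet_derivative (\<lambda>y. \<Gamma> y u v) (at y) 0 = 0" for u v
    by (rule linear_0[OF smooth_on_linear_derivative[OF h W]])
       (rule linear_0[OF smooth_on_linear_derivative[OF \<Gamma> W]])
  have dz: "frechet_derivative (\<lambda>y. h y 0 v) (at y) u = 0" for u v
    by (rule linear_0[OF frechet_derivative_bilinear_family_linear[OF oW W hb h]])
  have time: "fst (curv_coeff (warped_conn a b c \<mu> h \<Gamma>) (t, y) u (1, 0) w)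
      = (- b' + b t * c t - \<mu> * b t) * h y (snd u) (snd w)"
    unfolding curv_coeff_def d
    by (simp add: warped_conn_def lin dh0 dz) (simp add: algebra_simps)
  have fibre: "snd (curv_coeff (warped_conn a b c \<mu> h \<Gamma>) (t, y) u (0, v) w)
      = curv_coeff \<Gamma> y (snd u) v (snd w) + ((a' + a t * c t - a t * \<mu>) * (fst u * fst w)) *\<^sub>R v
        + (a t * b t) *\<^sub>R (h y v (snd w) *\<^sub>R snd u - h y (snd u) (snd w) *\<^sub>R v)" for v
    unfolding curv_coeff_def d
    by (simp add: warped_conn_def lin dh0) (simp add: algebra_simps \<Gamma>s[of v "snd u"])
  define K where "K = (a' + a t * c t - a t * \<mu>) * (fst u * fst w)"
  have "(\<Sum>v\<in>Basis. snd (curv_coeff (warped_conn a b c \<mu> h \<Gamma>) (t, y) u (0, v) w) \<bullet> v)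
      = (\<Sum>v\<in>Basis. curv_coeff \<Gamma> y (snd u) v (snd w) \<bullet> v + (K - a t * b t * h y (snd u) (snd w)) * (v \<bullet> v)
          + a t * b t * ((snd u \<bullet> v) * h y v (snd w)))"
    unfolding fibre K_def[symmetric]
    by (rule sum.cong) (simp_all add: inner_add_left inner_diff_left algebra_simps)
  also have "\<dots> = (\<Sum>v\<in>Basis. curv_coeff \<Gamma> y (snd u) v (snd w) \<bullet> v)
      + real DIM('e) * (K - a t * b t * h y (snd u) (snd w))
      + a t * b t * (\<Sum>v\<in>Basis. (snd u \<bullet> v) * h y v (snd w))"
    by (simp add: sum.distrib sum_distrib_left)
  also have "(\<Sum>v\<in>Basis. (snd u \<bullet> v) * h y v (snd w)) = h y (snd u) (snd w)"
    using linear_Basis_expand[OF hl(1), of "snd u" "snd w"] by simp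
  finally show ?thesis
    unfolding sum_Basis_prod by (simp add: inner_prod_def time K_def algebra_simps)
qed

lemma (in charted) connection_in_chart_cong:
  assumes c: "c \<in> atlas M" and \<Gamma>: "connection_in_chart M D c \<Gamma>"
    and eq: "\<And>x u v. x \<in> cmap c ` cdom c \<Longrightarrow> \<Gamma>' x u v = \<Gamma> x u v"
  shows "connection_in_chart M D c \<Gamma>'"
  unfolding connection_in_chart_def
proof (intro conjI allI ballI impI)
  note co = connection_in_chartD[OF \<Gamma>]
  fix U X Y p assume "openin (mtop M) U \<and> vector_field M U X \<and> vector_field M U Y" and p: "p \<in> U \<inter> cdom c"
  then have U: "openin (mtop M) U" and X: "vector_field M U X" and Y: "vector_field M U Y" by simp_all
  have pU: "p \<in> U" and pc: "p \<in> cdom c" using p by simp_all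
  show "D X Y p c = frechet_derivative (\<lambda>x. Y (cinv c x) c) (at (cmap c p)) (X p c)
      + \<Gamma>' (cmap c p) (X p c) (Y p c)"
    unfolding co(1)[OF U X Y pU pc] eq[OF imageI[OF pc]] ..
next
  fix x assume x: "x \<in> cmap c ` cdom c"
  have "\<Gamma>' x = \<Gamma> x" by (intro ext eq[OF x])
  then show "bilinear (\<Gamma>' x)" using connection_in_chartD(2)[OF \<Gamma> x] by simp
next
  fix u v
  show "smooth_on (cmap c ` cdom c) (\<lambda>x. \<Gamma>' x u v)"
    by (subst smooth_on_cong[OF open_image[OF c] eq]) (assumption, rule connection_in_chartD(3)[OF \<Gamma>])
qed

locale warped_connection = warped_product I F gF f
  for I and F :: "('a, 'e::euclidean_space) manifold" and gF f +
  fixes nabF :: "('a, 'e) connection" and nab :: "(real \<times> 'a, real \<times> 'e) connection"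
  assumes nabF: "levi_civita F gF nabF"
    and nab: "levi_civita (warped_manifold I F) (warped_metric I f F gF) nab"
begin

sublocale Fn: charted_connection F nabF
  using nabF by unfold_locales (simp add: levi_civita_def)

sublocale Mn: charted_connection WM nab
  using nab by unfold_locales (simp add: levi_civita_def)

abbreviation "h d \<equiv> metric_coeff F gF d"
abbreviation "\<Gamma>F d \<equiv> Fn.christoffel d"

lemma torsion_metric:
  "torsion_free F nabF" "metric_compatible F gF nabF" "torsion_free WM nab" "metric_compatible WM gW nab"
  using nab nabF by (simp_all add: levi_civita_def)

lemma f_deriv:
  assumes "t \<in> I"
  shows "(f has_real_derivative deriv f t) (at t)" "(deriv f has_real_derivative deriv (deriv f) t) (at t)"
    "f t > 0"
proof -
  have 1: "(f has_real_derivative deriv f t) (at t)" if "t \<in> I" for t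
    using smooth_on_imp_differentiable[OF f(1) that] by (simp add: DERIV_deriv_iff_real_differentiable)
  then show "(f has_real_derivative deriv f t) (at t)" using assms .
  have "frechet_derivative f (at t) 1 = deriv f t" if "t \<in> I" for t
    using fun_cong[OF frechet_derivative_at[OF 1[OF that, unfolded has_field_derivative_def]], of 1] by simp
  then have "smooth_on I (deriv f)"
    using smooth_on_cong[OF I(1), of "\<lambda>t. frechet_derivative f (at t) 1" "deriv f"]
      smooth_on_derivative[OF f(1), of 1] by simp
  from smooth_on_imp_differentiable[OF this assms]
  show "(deriv f has_real_derivative deriv (deriv f) t) (at t)"
    by (simp add: DERIV_deriv_iff_real_differentiable)
  show "f t > 0" using f(2) assms by simp
qed

lemma warped_coeff_derivative:
  assumes d: "d \<in> atlas F" and t: "t \<in> I" and y: "y \<in> cmap d ` cdom d"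
  shows "frechet_derivative (\<lambda>x. warped_coeff d x v w) (at (t, y)) u =
    2 * f t * deriv f t * fst u * h d y (snd v) (snd w)
    + (f t)\<^sup>2 * frechet_derivative (\<lambda>y. h d y (snd v) (snd w)) (at y) (snd u)"
proof -
  note m = metric_in_chartD[OF F.metric_in_chart_coeff[OF F d]]
  have 1: "((\<lambda>x. f (fst x)) has_derivative (\<lambda>u. deriv f t * fst u)) (at (t, y))"
    by (rule has_derivative_compose[OF has_derivative_fst[OF has_derivative_ident]])
       (use f_deriv(1)[OF t] in \<open>simp add: has_field_derivative_def\<close>)
  have 2: "((\<lambda>x. h d (snd x) (snd v) (snd w)) has_derivative
      (\<lambda>u. frechet_derivative (\<lambda>y. h d y (snd v) (snd w)) (at y) (snd u))) (at (t, y))"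
    by (rule has_derivative_compose[OF has_derivative_snd[OF has_derivative_ident]])
       (use smooth_on_has_derivative[OF m(5) y] in simp)
  from fun_cong[OF frechet_derivative_at[OF has_derivative_add[OF has_derivative_const[of "- (fst v * fst w)"]
        has_derivative_mult[OF has_derivative_power[OF 1, of 2] 2]]], of u]
  show ?thesis by (simp add: warped_coeff_def algebra_simps)
qed

lemma christoffel_wc:
  assumes d: "d \<in> atlas F" and x: "x \<in> cmap (wc d) ` cdom (wc d)"
  shows "Mn.christoffel (wc d) x u v = warped_conn (\<lambda>t. deriv f t / f t) (\<lambda>t. f t * deriv f t)
    (\<lambda>t. deriv f t / f t) 0 (h d) (\<Gamma>F d) x u v" (is "?A = ?B")
proof -
  obtain t y where ty: "x = (t, y)" "t \<in> I" "y \<in> cmap d ` cdom d"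
    using x unfolding warped_chart_simps image_warped_chart by auto
  note G = metric_in_chart_wc[OF d]
  note mW = metric_in_chartD[OF G]
  note Gh = F.metric_in_chart_coeff[OF F d]
  note m = metric_in_chartD[OF Gh]
  have hl: "linear (\<lambda>u. h d y u w)" "linear (h d y w)" for w
    using m(2)[OF ty(3)] unfolding bilinear_def by simp_all
  have Gl: "linear (\<lambda>u. warped_coeff d x u w)" for w
    using conjunct2[OF mW(2)[OF x, unfolded bilinear_def]] by (rule spec)
  have "?A - ?B = 0"
  proof (rule mW(4)[OF x])
    fix w
    note kM = M.koszul_in_chart[OF wc_atlas[OF d] G Mn.connection_in_chart_christoffel[OF wc_atlas[OF d]]
        Mn.nab_preserves torsion_metric(3,4) x, of u v w]
    note kF = F.koszul_in_chart[OF d Gh Fn.connection_in_chart_christoffel[OF d]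
        Fn.nab_preserves torsion_metric(1,2) ty(3), of "snd u" "snd v" "snd w"]
    have "f t \<noteq> 0" using f_deriv(3)[OF ty(2)] by simp
    then have "2 * warped_coeff d x ?B w = - 2 * f t * deriv f t * h d y (snd u) (snd v) * fst w
        + (f t)\<^sup>2 * (2 * h d y (\<Gamma>F d y (snd u) (snd v)) (snd w))
        + 2 * f t * deriv f t * (fst u * h d y (snd v) (snd w) + fst v * h d y (snd u) (snd w))"
      unfolding ty(1) warped_coeff_def warped_conn_def
      by (simp add: linear_add[OF hl(1)] linear_cmul[OF hl(1)] field_simps power2_eq_square)
    also have "\<dots> = 2 * warped_coeff d x ?A w"
      unfolding kM kF unfolding ty(1) warped_coeff_derivative[OF d ty(2,3)]
      by (simp add: algebra_simps)
    finally have "warped_coeff d x ?B w = warped_coeff d x ?A w" by simp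
    then show "warped_coeff d x (?A - ?B) w = 0" by (simp add: linear_diff[OF Gl])
  qed
  then show ?thesis by simp
qed

lemma quarter_symmetric_wc:
  assumes d: "d \<in> atlas F"
  shows "connection_in_chart WM (quarter_symmetric gW (time_field I F) lam1 lam2 nab) (wc d)
    (warped_conn (\<lambda>t. deriv f t / f t - lam1) (\<lambda>t. f t * deriv f t - lam2 * (f t)\<^sup>2)
      (\<lambda>t. deriv f t / f t) (lam2 - lam1) (h d) (\<Gamma>F d))"
proof (rule M.connection_in_chart_cong[OF wc_atlas[OF d] M.quarter_symmetric_in_chart[OF wc_atlas[OF d]
      metric_in_chart_wc[OF d] Mn.connection_in_chart_christoffel[OF wc_atlas[OF d]]
      time_field_vector_field time_field_wc[OF d]]])
  show "p \<in> cdom (wc d)" if "p \<in> cdom (wc d)" for p using that .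
next
  fix x u v assume x: "x \<in> cmap (wc d) ` cdom (wc d)"
  then have y: "snd x \<in> cmap d ` cdom d" by auto
  note m = metric_in_chartD[OF F.metric_in_chart_coeff[OF F d]]
  have "h d (snd x) w 0 = 0" for w
    using m(2)[OF y] linear_0 unfolding bilinear_def by blast
  then show "warped_conn (\<lambda>t. deriv f t / f t - lam1) (\<lambda>t. f t * deriv f t - lam2 * (f t)\<^sup>2)
      (\<lambda>t. deriv f t / f t) (lam2 - lam1) (h d) (\<Gamma>F d) x u v
    = Mn.christoffel (wc d) x u v + (lam1 * warped_coeff d x v (1, 0)) *\<^sub>R u
      - (lam2 * warped_coeff d x u v) *\<^sub>R (1, 0)"
    unfolding christoffel_wc[OF d x]
    by (cases u) (simp add: warped_conn_def warped_coeff_def algebra_simps)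
qed

definition fibre_ricci :: "('a, 'e) chart \<Rightarrow> 'e \<Rightarrow> 'e \<Rightarrow> 'e \<Rightarrow> real" where
  "fibre_ricci d y u w = (\<Sum>b\<in>Basis. curv_coeff (\<Gamma>F d) y u b w \<bullet> b)"

lemma ricci_fibre:
  assumes d: "d \<in> charts_at F q" and q: "q \<in> mpoints F"
    and X: "vector_field F (mpoints F) X" and Y: "vector_field F (mpoints F) Y"
  shows "ricci F gF nabF X Y q = fibre_ricci d (cmap d q) (X q d) (Y q d)"
    and "gF q (X q) (Y q) = h d (cmap d q) (X q d) (Y q d)"
proof -
  note d' = F.charts_atD[OF d]
  note G = F.metric_in_chart_coeff[OF F d'(1)]
  show "ricci F gF nabF X Y q = fibre_ricci d (cmap d q) (X q d) (Y q d)"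
    unfolding fibre_ricci_def
    by (rule F.ricci_in_chart[OF d'(1) G Fn.connection_in_chart_christoffel[OF d'(1)]
          Fn.nab_preserves F.lie_bracket_preserves[OF Fn.nab_preserves torsion_metric(1)]
          openin_topspace q d'(2) X Y])
  show "gF q (X q) (Y q) = h d (cmap d q) (X q d) (Y q d)"
    by (rule metric_in_chartD(1)[OF G d'(2) vector_field_tangent[OF X q] vector_field_tangent[OF Y q]])
qed

definition "radial lam1 lam2 t = real DIM('e) * (lam2 * (deriv f t / f t) - deriv (deriv f) t / f t
  + lam1\<^sup>2 - lam1 * lam2)"

definition "spherical lam1 lam2 t = - (f t * deriv (deriv f) t) + (1 - real DIM('e)) * (deriv f t)\<^sup>2
  + (lam2\<^sup>2 - real DIM('e) * lam1 * lam2) * (f t)\<^sup>2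
  + (real DIM('e) * lam1 + (real DIM('e) - 1) * lam2) * (f t * deriv f t)"

lemma ricci_warped:
  assumes d: "d \<in> charts_at F q" and t: "t \<in> I" and q: "q \<in> mpoints F"
    and X: "vector_field WM (mpoints WM) X" and Y: "vector_field WM (mpoints WM) Y"
    and u: "X (t, q) (wc d) = u" and w: "Y (t, q) (wc d) = w"
  shows "ricci WM gW (quarter_symmetric gW (time_field I F) lam1 lam2 nab) X Y (t, q) =
      fibre_ricci d (cmap d q) (snd u) (snd w) - radial lam1 lam2 t * (fst u * fst w)
      + spherical lam1 lam2 t * h d (cmap d q) (snd u) (snd w)" (is ?ric)
    and "gW (t, q) (X (t, q)) (Y (t, q)) = - (fst u * fst w) + (f t)\<^sup>2 * h d (cmap d q) (snd u) (snd w)" (is ?met)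
proof -
  note d' = F.charts_atD[OF d]
  note G = metric_in_chart_wc[OF d'(1)]
  note m = metric_in_chartD[OF F.metric_in_chart_coeff[OF F d'(1)]]
  note co = connection_in_chartD[OF Fn.connection_in_chart_christoffel[OF d'(1)]]
  have p: "(t, q) \<in> mpoints WM" using t q by (simp add: mtop_warped_manifold)
  have pc: "(t, q) \<in> cdom (wc d)" using t d'(2) by simp
  note y = imageI[OF d'(2), of "cmap d"]
  have Gall: "metric_in_chart WM gW c (warped_coeff (base_chart c))" if c: "c \<in> atlas WM" for c
  proof -
    obtain d where d: "d \<in> atlas F" "c = wc d" using c unfolding atlas_warped_manifold by (elim imageE)
    show ?thesis unfolding d(2) base_warped_chart[OF I(2)] by (rule metric_in_chart_wc[OF d(1)])
  qed
  have f0: "f t \<noteq> 0" using f_deriv(3)[OF t] by simp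
  define a b c \<mu> where abc: "a = (\<lambda>t. deriv f t / f t - lam1)" "b = (\<lambda>t. f t * deriv f t - lam2 * (f t)\<^sup>2)"
    "c = (\<lambda>t. deriv f t / f t)" "\<mu> = lam2 - lam1"
  define c' where "c' = (deriv (deriv f) t * f t - (deriv f t)\<^sup>2) / (f t)\<^sup>2"
  define b' where "b' = (deriv f t)\<^sup>2 + f t * deriv (deriv f) t - 2 * lam2 * f t * deriv f t"
  have c': "(c has_real_derivative c') (at t)"
    unfolding abc c'_def power2_eq_square by (rule DERIV_divide[OF f_deriv(2,1)[OF t] f0])
  have a': "(a has_real_derivative c') (at t)"
    using DERIV_diff[OF c' DERIV_const[of lam1]] by (simp add: abc)
  have b': "(b has_real_derivative b') (at t)"
    unfolding abc b'_def using f_deriv(1,2)[OF t]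
    by (auto intro!: derivative_eq_intros simp: power2_eq_square algebra_simps)
  have "ricci WM gW (quarter_symmetric gW (time_field I F) lam1 lam2 nab) X Y (t, q) =
      (\<Sum>v\<in>Basis. curv_coeff (warped_conn a b c \<mu> (h d) (\<Gamma>F d)) (t, cmap d q) u v w \<bullet> v)"
    using M.ricci_in_chart[OF wc_atlas[OF d'(1)] G quarter_symmetric_wc[OF d'(1)]
        M.quarter_symmetric_preserves[OF Gall Mn.nab_preserves time_field_vector_field]
        M.lie_bracket_preserves[OF Mn.nab_preserves torsion_metric(3)] openin_topspace p pc X Y]
    unfolding abc u w by simp
  also have "\<dots> = fibre_ricci d (cmap d q) (snd u) (snd w)
      + real DIM('e) * (c' + a t * c t - a t * \<mu>) * (fst u * fst w)
      + (a t * b t * (1 - real DIM('e)) - b' + b t * c t - \<mu> * b t) * h d (cmap d q) (snd u) (snd w)"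
    unfolding fibre_ricci_def
    by (rule warped_conn_ricci[OF F.open_image[OF d'(1)] y m(5) co(3) m(2) co(2) a' b' c'])
       (assumption | rule F.torsion_free_in_chart[OF d'(1) Fn.connection_in_chart_christoffel[OF d'(1)]
          torsion_metric(1) y])+
  also have "real DIM('e) * (c' + a t * c t - a t * \<mu>) = - radial lam1 lam2 t"
    using f0 by (simp add: abc c'_def radial_def field_simps power2_eq_square)
  also have "a t * b t * (1 - real DIM('e)) - b' + b t * c t - \<mu> * b t = spherical lam1 lam2 t"
    using f0 by (simp add: abc b'_def spherical_def field_simps power2_eq_square)
  finally show ?ric by simp
  show ?met
    using metric_in_chartD(1)[OF G pc vector_field_tangent[OF X p] vector_field_tangent[OF Y p]]
    unfolding u w by (simp add: warped_coeff_def)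
qed

lemma fibre_field_exists:
  assumes "d \<in> charts_at F q" "q \<in> mpoints F"
  obtains X where "vector_field F (mpoints F) X" "X q d = u"
proof -
  have "Hausdorff_space (mtop F)"
    using pseudo_riemannianD(1)[OF F] by (simp add: smooth_manifold_def)
  from F.global_vector_field_exists[OF this assms(2) F.tvec_tangent[OF assms(1), of u]]
  obtain X where "vector_field F (mpoints F) X" "X q = tvec F d q u" .
  then show thesis using F.tvec_same[OF assms(1)] by (intro that[of X]) simp_all
qed

theorem einstein_iff:
  assumes ne: "mpoints F \<noteq> {}"
  shows "einstein WM gW (quarter_symmetric gW (time_field I F) lam1 lam2 nab) \<alpha> \<longleftrightarrow>
    (\<exists>\<alpha>F. einstein F gF nabF \<alpha>F \<and> (\<forall>t\<in>I. radial lam1 lam2 t = \<alpha>) \<and>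
      (\<forall>t\<in>I. \<alpha>F + spherical lam1 lam2 t - \<alpha> * (f t)\<^sup>2 = 0))"
    (is "?lhs \<longleftrightarrow> ?rhs")
proof
  assume L: ?lhs
  have R: "ricci WM gW (quarter_symmetric gW (time_field I F) lam1 lam2 nab) X Y (t, q)
      = \<alpha> * gW (t, q) (X (t, q)) (Y (t, q))"
    if "vector_field WM (mpoints WM) X" "vector_field WM (mpoints WM) Y" "t \<in> I" "q \<in> mpoints F" for X Y t q
    using L that unfolding einstein_def by (simp add: mtop_warped_manifold)
  obtain q0 where q0: "q0 \<in> mpoints F" using ne unfolding ex_in_conv[symmetric] by (elim exE)
  obtain d0 where d0: "d0 \<in> charts_at F q0" using F.charts_at_exists[OF q0] by (elim exE)
  have fibre: "fibre_ricci d (cmap d q) (X q d) (Y q d)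
      = (\<alpha> * (f t)\<^sup>2 - spherical lam1 lam2 t) * h d (cmap d q) (X q d) (Y q d)"
    if t: "t \<in> I" and q: "q \<in> mpoints F" and d: "d \<in> charts_at F q"
      and X: "vector_field F (mpoints F) X" and Y: "vector_field F (mpoints F) Y" for t q d X Y
  proof -
    have "(t, q) \<in> cdom (wc d)" using t F.charts_atD[OF d] by simp
    note l = lift_wc[OF F.charts_atD(1)[OF d] this, unfolded snd_conv]
    show ?thesis
      using R[OF lift_vector_field[OF X] lift_vector_field[OF Y] t q]
      unfolding ricci_warped[OF d t q lift_vector_field[OF X] lift_vector_field[OF Y] l l]
      by (simp add: algebra_simps)
  qed
  have radial: "radial lam1 lam2 t = \<alpha>" if t: "t \<in> I" for t
  proof -
    have T: "time_field I F (t, q0) (wc d0) = (1, 0)"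
      by (rule time_field_wc) (use t F.charts_atD[OF d0] in simp_all)
    have y0: "cmap d0 q0 \<in> cmap d0 ` cdom d0" by (rule imageI[OF F.charts_atD(2)[OF d0]])
    have "linear (h d0 (cmap d0 q0) 0)"
      using metric_in_chartD(2)[OF F.metric_in_chart_coeff[OF F F.charts_atD(1)[OF d0]] y0]
      unfolding bilinear_def by simp
    then have h0: "h d0 (cmap d0 q0) 0 0 = 0" by (rule linear_0)
    then have r0: "fibre_ricci d0 (cmap d0 q0) 0 0 = 0"
      using fibre[OF t q0 d0 zero_vector_field zero_vector_field] by simp
    show ?thesis
      using R[OF time_field_vector_field time_field_vector_field t q0]
      unfolding ricci_warped[OF d0 t q0 time_field_vector_field time_field_vector_field T T]
      by (simp add: h0 r0)
  qed
  obtain t0 where t0: "t0 \<in> I" using I(2) by auto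
  define \<alpha>F where "\<alpha>F = \<alpha> * (f t0)\<^sup>2 - spherical lam1 lam2 t0"
  have "einstein F gF nabF \<alpha>F"
    unfolding einstein_def
  proof (intro allI impI ballI, elim conjE)
    fix X Y q assume X: "vector_field F (mpoints F) X" and Y: "vector_field F (mpoints F) Y" and q: "q \<in> mpoints F"
    obtain d where d: "d \<in> charts_at F q" using F.charts_at_exists[OF q] by (elim exE)
    show "ricci F gF nabF X Y q = \<alpha>F * gF q (X q) (Y q)"
      unfolding ricci_fibre[OF d q X Y] fibre[OF t0 q d X Y] \<alpha>F_def ..
  qed
  moreover have "\<alpha>F + spherical lam1 lam2 t - \<alpha> * (f t)\<^sup>2 = 0" if t: "t \<in> I" for t
  proof -
    note m = metric_in_chartD[OF F.metric_in_chart_coeff[OF F F.charts_atD(1)[OF d0]]]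
    obtain u :: 'e where u: "u \<noteq> 0" using nonzero_Basis SOME_Basis by blast
    have "\<exists>v. h d0 (cmap d0 q0) u v \<noteq> 0"
    proof (rule ccontr)
      assume "\<not> ?thesis"
      then have "h d0 (cmap d0 q0) u v = 0" for v by simp
      from m(4)[OF imageI[OF F.charts_atD(2)[OF d0]] this] u show False by simp
    qed
    then obtain v where v: "h d0 (cmap d0 q0) u v \<noteq> 0" by (elim exE)
    obtain X where X: "vector_field F (mpoints F) X" "X q0 d0 = u" by (rule fibre_field_exists[OF d0 q0])
    obtain Y where Y: "vector_field F (mpoints F) Y" "Y q0 d0 = v" by (rule fibre_field_exists[OF d0 q0])
    have "(\<alpha> * (f t)\<^sup>2 - spherical lam1 lam2 t) * h d0 (cmap d0 q0) u v = \<alpha>F * h d0 (cmap d0 q0) u v"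
      unfolding \<alpha>F_def
      by (rule trans[OF fibre[OF t q0 d0 X(1) Y(1), unfolded X(2) Y(2), symmetric]
            fibre[OF t0 q0 d0 X(1) Y(1), unfolded X(2) Y(2)]])
    then show ?thesis using v by simp
  qed
  ultimately show ?rhs using radial by (intro exI[of _ \<alpha>F] conjI ballI)
next
  assume ?rhs
  then obtain \<alpha>F where E: "einstein F gF nabF \<alpha>F" and rad: "\<forall>t\<in>I. radial lam1 lam2 t = \<alpha>"
    and sph: "\<forall>t\<in>I. \<alpha>F + spherical lam1 lam2 t - \<alpha> * (f t)\<^sup>2 = 0" by (elim exE conjE)
  show ?lhs
    unfolding einstein_def
  proof (intro allI impI ballI, elim conjE)
    fix X Y p assume X: "vector_field WM (mpoints WM) X" and Y: "vector_field WM (mpoints WM) Y"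
      and "p \<in> mpoints WM"
    then obtain t q where p: "p = (t, q)" "t \<in> I" "q \<in> mpoints F" by (auto simp: mtop_warped_manifold)
    obtain d where d: "d \<in> charts_at F q" using F.charts_at_exists[OF p(3)] by (elim exE)
    define u w where uw: "u = X (t, q) (wc d)" "w = Y (t, q) (wc d)"
    obtain A where A: "vector_field F (mpoints F) A" "A q d = snd u" by (rule fibre_field_exists[OF d p(3)])
    obtain B where B: "vector_field F (mpoints F) B" "B q d = snd w" by (rule fibre_field_exists[OF d p(3)])
    have "ricci F gF nabF A B q = \<alpha>F * gF q (A q) (B q)"
      using E A(1) B(1) p(3) unfolding einstein_def by simp
    then have 1: "fibre_ricci d (cmap d q) (snd u) (snd w) = \<alpha>F * h d (cmap d q) (snd u) (snd w)"
      unfolding ricci_fibre[OF d p(3) A(1) B(1)] A(2) B(2) .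
    have 2: "\<alpha>F = \<alpha> * (f t)\<^sup>2 - spherical lam1 lam2 t" "radial lam1 lam2 t = \<alpha>"
      using sph rad p(2) by (simp_all add: algebra_simps eq_diff_eq)
    show "ricci WM gW (quarter_symmetric gW (time_field I F) lam1 lam2 nab) X Y p = \<alpha> * gW p (X p) (Y p)"
      unfolding p(1) ricci_warped[OF d p(2,3) X Y uw[symmetric]] 1 2 by (simp add: algebra_simps)
  qed
qed

end

theorem theorem3p11:
  fixes I :: "real set"
    and F :: "('a, 'e::euclidean_space) manifold"
    and gF :: "('a, 'e) metric_tensor"
    and nabF :: "('a, 'e) connection"
    and nab :: "(real \<times> 'a, real \<times> 'e) connection"
    and f :: "real \<Rightarrow> real"
    and l :: nat
    and lam1 lam2 \<alpha> :: real
  assumes I: "open I" "is_interval I" "I \<noteq> {}"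
    and F: "pseudo_riemannian F gF" "mpoints F \<noteq> {}" "DIM('e) = l"
    and f: "smooth_on I f" "\<forall>t\<in>I. f t > 0"
    and lam: "lam1 \<noteq> 0" "lam2 \<noteq> 0"
    and nabF: "levi_civita F gF nabF"
    and nab: "levi_civita (warped_manifold I F) (warped_metric I f F gF) nab"
  shows "einstein (warped_manifold I F) (warped_metric I f F gF)
           (quarter_symmetric (warped_metric I f F gF) (time_field I F) lam1 lam2 nab) \<alpha>
         \<longleftrightarrow>
         (\<exists>\<alpha>F.
            einstein F gF nabF \<alpha>F \<and>
            (\<forall>t\<in>I. real l * (lam2 * (deriv f t / f t) - deriv (deriv f) t / f t
                              + lam1\<^sup>2 - lam1 * lam2) = \<alpha>) \<and>
            (\<forall>t\<in>I. \<alpha>F - f t * deriv (deriv f) t + (1 - real l) * (deriv f t)\<^sup>2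
                     + (lam2\<^sup>2 - real l * lam1 * lam2 - \<alpha>) * (f t)\<^sup>2
                     + (real l * lam1 + (real l - 1) * lam2) * (f t * deriv f t) = 0))"
proof -
  note ne = F(2) and l = F(3)
  interpret warped_connection I F gF f nabF nab
    using I(1,3) F(1) f nabF nab by unfold_locales
  have "\<alpha>F + spherical lam1 lam2 t - \<alpha> * (f t)\<^sup>2 =
      \<alpha>F - f t * deriv (deriv f) t + (1 - real l) * (deriv f t)\<^sup>2
        + (lam2\<^sup>2 - real l * lam1 * lam2 - \<alpha>) * (f t)\<^sup>2
        + (real l * lam1 + (real l - 1) * lam2) * (f t * deriv f t)" for \<alpha>F t
    by (simp add: spherical_def l algebra_simps)
  then show ?thesis
    using einstein_iff[OF ne, of lam1 lam2 \<alpha>] by (simp only: radial_def l)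
qed

end
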